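(* Let $(M,g)$ be a conformally flat pseudo-Riemannian manifold of dimension $n\geqslant 3$. Consider the following system for a function $\bar t$ (with $\bar t_i=\nabla_i\bar t$) and a totally symmetric, trace-free tensor field $S_{ijk}$: \begin{align*} \text{(a)}\quad \nabla_i\bar t_j&=\Big(\tfrac{3}{n-2}R_{ij}+\tfrac{1}{3(n-2)}S_i{}^{ab}S_{jab}+\tfrac13\bar t_i\bar t_j\Big)_\circ+\tfrac1n g_{ij}\nabla^a\bar t_a,\\ \text{(b)}\quad \nabla^a\bar t_a&=\tfrac{3}{2(n-1)}R+\tfrac{3n+2}{6(n-1)(n+2)}S^{abc}S_{abc}-\tfrac{n-2}{6}\bar t^a\bar t_a,\\ \text{(c)}\quad \nabla_lS_{ijk}&=\tfrac1{18}\Pi_{ijk}\Big(S_{il}{}^{a}S_{jka}+3S_{ijl}\bar t_k+S_{ijk}\bar t_l+\big(\tfrac{4}{n-2}S_j{}^{ab}S_{kab}-3S_{jka}\bar t^a\big)g_{il}\Big). \end{align*} (i) If the Weyl curvature of $g$ vanishes and $$\big(S_{ij}{}^{a}S_{kla}-S_{ik}{}^{a}S_{jla}\big)_\circ=0, \qquad (\ast)$$ then the Ricci identities $$\nabla_m\nabla_lS_{ijk}-\nabla_l\nabla_mS_{ijk}=R^a{}_{ilm}S_{ajk}+R^a{}_{jlm}S_{iak}+R^a{}_{klm}S_{ija},\qquad \nabla_k\nabla_j\bar t_i-\nabla_j\nabla_k\bar t_i=R^a{}_{ijk}\bar t_a,$$ in which all derivatives of $S$ and $\bar t_i$ on the left-hand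 sides are expressed by means of (a)--(c), are satisfied. (ii) Let $x_0\in M$. Let $\Psi_{ijk}$ be a totally symmetric, trace-free tensor at $x_0$ satisfying $$\big(g^{ab}(\Psi_{bij}\Psi_{kla}-\Psi_{bik}\Psi_{jla})\big)_\circ=0 .$$ Then $S_{ijk}(x_0)=\Psi_{ijk}$, together with arbitrary initial values $\bar t(x_0)$ and $\nabla\bar t(x_0)$, can be extended to solutions $S_{ijk}(x)$ and $\bar t(x)$ of (a)--(c) in a neighbourhood of $x_0$.
   Context: $\nabla$ is the Levi-Civita connection of $g$ (assumed analytic), indices are raised and lowered with $g$. The curvature convention is $\nabla_k\nabla_j\alpha_i-\nabla_j\nabla_k\alpha_i=R^m{}_{ijk}\alpha_m$, with Ricci tensor $R_{ij}=R^a{}_{iaj}$ and scalar curvature $R=R^a{}_a$ (positive on round spheres). The subscript $\circ$ denotes projection onto the totally trace-free part. $\Pi_{ijk}X_{ijkl}$ denotes the following operation: sum $X$ over all $6$ permutations of the indices $i,j,k$ (no normalising factor), then take the part that is trace-free with respect to the three indices $i,j,k$ (for each fixed $l$). All tensors $\Psi$, $S$ have real components and trace-free means $g^{ij}\Psi_{ijk}=0$. *)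

theory Defs
  imports "HOL-Analysis.Analysis"
begin

section \<open>Smooth and real-analytic functions on open subsets of coordinate space\<close>

definition pd :: "'n \<Rightarrow> (real^'n \<Rightarrow> real) \<Rightarrow> real^'n \<Rightarrow> real" where
  "pd k f x = frechet_derivative f (at x) (axis k 1)"

fun Ck_on :: "nat \<Rightarrow> (real^'n) set \<Rightarrow> (real^'n \<Rightarrow> real) \<Rightarrow> bool" where
  "Ck_on 0 U f \<longleftrightarrow> continuous_on U f"
| "Ck_on (Suc r) U f \<longleftrightarrow> (\<forall>x\<in>U. f differentiable (at x)) \<and> (\<forall>k. Ck_on r U (pd k f))"

definition smooth_on :: "(real^'n) set \<Rightarrow> (real^'n \<Rightarrow> real) \<Rightarrow> bool" where
  "smooth_on U f \<longleftrightarrow> (\<forall>r. Ck_on r U f)"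

text \<open>Real analytic: \<open>C\<^sup>\<infinity>\<close> and near every point equal to the (absolutely convergent) sum of
  a power series over all multi-indices.\<close>

definition real_analytic_on :: "(real^'n) set \<Rightarrow> (real^'n \<Rightarrow> real) \<Rightarrow> bool" where
  "real_analytic_on U f \<longleftrightarrow> smooth_on U f \<and>
     (\<forall>x\<in>U. \<exists>(c :: ('n \<Rightarrow> nat) \<Rightarrow> real) r. r > 0 \<and>
        (\<forall>y\<in>ball x r. ((\<lambda>\<alpha>. c \<alpha> * (\<Prod>i\<in>UNIV. (y $ i - x $ i) ^ \<alpha> i)) has_sum f y) UNIV))"


section \<open>Manifolds and metrics\<close>

text \<open>A chart is a pair of its domain and its coordinate map.\<close>

type_synonym ('m, 'n) chart = "'m set \<times> ('m \<Rightarrow> real^'n)"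

definition chart_image :: "('m, 'n::finite) chart \<Rightarrow> (real^'n) set" where
  "chart_image c = snd c ` fst c"

definition is_chart :: "('m::topological_space, 'n::finite) chart \<Rightarrow> bool" where
  "is_chart c \<longleftrightarrow> open (fst c) \<and> open (chart_image c) \<and>
     homeomorphism (fst c) (chart_image c) (snd c) (inv_into (fst c) (snd c))"

definition transition :: "('m, 'n::finite) chart \<Rightarrow> ('m, 'n) chart \<Rightarrow> real^'n \<Rightarrow> real^'n" where
  "transition c c' = snd c' \<circ> inv_into (fst c) (snd c)"

definition analytic_atlas :: "('m::topological_space, 'n::finite) chart set \<Rightarrow> bool" where
  "analytic_atlas A \<longleftrightarrow> (\<forall>c\<in>A. is_chart c) \<and> (\<Union>c\<in>A. fst c) = UNIV \<and>
     (\<forall>c\<in>A. \<forall>c'\<in>A. \<forall>i. real_analytic_on (snd c ` (fst c \<inter> fst c')) (\<lambda>y. transition c c' y $ i))"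

text \<open>A metric is given by its component matrices: \<open>g c y\<close> is the matrix of \<open>g\<close> in the chart
  \<open>c\<close> at the point with coordinates \<open>y\<close>.  The last clause is the tensor transformation law.\<close>

definition pseudo_riemannian_metric ::
  "('m::topological_space, 'n::finite) chart set \<Rightarrow> (('m, 'n) chart \<Rightarrow> real^'n \<Rightarrow> real^'n^'n) \<Rightarrow> bool"
  where
  "pseudo_riemannian_metric A g \<longleftrightarrow>
     (\<forall>c\<in>A. \<forall>y\<in>chart_image c. transpose (g c y) = g c y \<and> invertible (g c y)) \<and>
     (\<forall>c\<in>A. \<forall>i j. real_analytic_on (chart_image c) (\<lambda>y. g c y $ i $ j)) \<and>
     (\<forall>c\<in>A. \<forall>c'\<in>A. \<forall>y\<in>snd c ` (fst c \<inter> fst c').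
        let J = matrix (frechet_derivative (transition c c') (at y))
        in g c y = transpose J ** g c' (transition c c' y) ** J)"


section \<open>Tensor calculus in a chart\<close>

text \<open>A covariant tensor of rank \<open>r\<close> is a function \<open>T\<close> of index lists of length \<open>r\<close>:
  \<open>T [i, j, k]\<close> is the component with indices \<open>i, j, k\<close>.  Values on lists of other lengths are
  irrelevant.  Below, \<open>h\<close> is a metric as a function of the coordinates, \<open>\<gamma>\<close> its matrix at one
  point.\<close>

type_synonym 'n tensor = "'n list \<Rightarrow> real"

definition tens2 :: "('n \<Rightarrow> 'n \<Rightarrow> real) \<Rightarrow> 'n tensor" where
  "tens2 f I = f (I!0) (I!1)"
definition tens3 :: "('n \<Rightarrow> 'n \<Rightarrow> 'n \<Rightarrow> real) \<Rightarrow> 'n tensor" where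
  "tens3 f I = f (I!0) (I!1) (I!2)"
definition tens4 :: "('n \<Rightarrow> 'n \<Rightarrow> 'n \<Rightarrow> 'n \<Rightarrow> real) \<Rightarrow> 'n tensor" where
  "tens4 f I = f (I!0) (I!1) (I!2) (I!3)"

abbreviation ginv :: "real^'n^'n \<Rightarrow> 'n \<Rightarrow> 'n \<Rightarrow> real" where
  "ginv \<gamma> a b \<equiv> matrix_inv \<gamma> $ a $ b"

definition christoffel :: "(real^'n \<Rightarrow> real^'n^'n) \<Rightarrow> real^'n \<Rightarrow> 'n \<Rightarrow> 'n \<Rightarrow> 'n \<Rightarrow> real" where
  "christoffel h x m i j = (\<Sum>a\<in>UNIV. ginv (h x) m a *
     (pd i (\<lambda>y. h y $ a $ j) x + pd j (\<lambda>y. h y $ a $ i) x - pd a (\<lambda>y. h y $ i $ j) x)) / 2"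

text \<open>Levi-Civita derivative; the differentiation index comes first:
  \<open>covD h T x [l, i, j, k]\<close> is \<open>\<nabla>\<^sub>l T\<^sub>i\<^sub>j\<^sub>k\<close> at \<open>x\<close>.\<close>

definition covD ::
  "(real^'n \<Rightarrow> real^'n^'n) \<Rightarrow> (real^'n \<Rightarrow> 'n tensor) \<Rightarrow> real^'n \<Rightarrow> 'n tensor" where
  "covD h T x L = (let l = hd L; I = tl L in
     pd l (\<lambda>y. T y I) x
     - (\<Sum>s<length I. \<Sum>a\<in>UNIV. christoffel h x a l (I!s) * T x (I[s := a])))"

text \<open>\<open>riemann h x m i j k\<close> is \<open>R\<^sup>m\<^sub>i\<^sub>j\<^sub>k\<close>, fixed by
  \<open>\<nabla>\<^sub>k \<nabla>\<^sub>j \<alpha>\<^sub>i - \<nabla>\<^sub>j \<nabla>\<^sub>k \<alpha>\<^sub>i = R\<^sup>m\<^sub>i\<^sub>j\<^sub>k \<alpha>\<^sub>m\<close>.\<close>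

definition riemann ::
  "(real^'n \<Rightarrow> real^'n^'n) \<Rightarrow> real^'n \<Rightarrow> 'n \<Rightarrow> 'n \<Rightarrow> 'n \<Rightarrow> 'n \<Rightarrow> real" where
  "riemann h x m i j k =
     pd j (\<lambda>y. christoffel h y m k i) x - pd k (\<lambda>y. christoffel h y m j i) x
     + (\<Sum>a\<in>UNIV. christoffel h x m j a * christoffel h x a k i
                  - christoffel h x m k a * christoffel h x a j i)"

definition ricci :: "(real^'n \<Rightarrow> real^'n^'n) \<Rightarrow> real^'n \<Rightarrow> 'n \<Rightarrow> 'n \<Rightarrow> real" where
  "ricci h x i j = (\<Sum>a\<in>UNIV. riemann h x a i a j)"

definition scalar_curv :: "(real^'n \<Rightarrow> real^'n^'n) \<Rightarrow> real^'n \<Rightarrow> real" where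
  "scalar_curv h x = (\<Sum>a\<in>UNIV. \<Sum>b\<in>UNIV. ginv (h x) a b * ricci h x a b)"

definition weyl ::
  "(real^'n \<Rightarrow> real^'n^'n) \<Rightarrow> real^'n \<Rightarrow> 'n \<Rightarrow> 'n \<Rightarrow> 'n \<Rightarrow> 'n \<Rightarrow> real" where
  "weyl h x i j k l = (let n = real CARD('n); \<gamma> = h x; Ric = ricci h x in
     (\<Sum>m\<in>UNIV. \<gamma> $ i $ m * riemann h x m j k l)
     - (\<gamma> $ i $ k * Ric j l - \<gamma> $ i $ l * Ric j k + \<gamma> $ j $ l * Ric i k - \<gamma> $ j $ k * Ric i l) / (n - 2)
     + scalar_curv h x / ((n - 1) * (n - 2)) * (\<gamma> $ i $ k * \<gamma> $ j $ l - \<gamma> $ i $ l * \<gamma> $ j $ k))"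

definition weyl_vanishes ::
  "('m, 'n::finite) chart set \<Rightarrow> (('m, 'n) chart \<Rightarrow> real^'n \<Rightarrow> real^'n^'n) \<Rightarrow> bool" where
  "weyl_vanishes A g \<longleftrightarrow> (\<forall>c\<in>A. \<forall>x\<in>chart_image c. \<forall>i j k l. weyl (g c) x i j k l = 0)"

text \<open>Near every point some positive multiple of the metric is flat.\<close>

definition conformally_flat ::
  "('m, 'n::finite) chart set \<Rightarrow> (('m, 'n) chart \<Rightarrow> real^'n \<Rightarrow> real^'n^'n) \<Rightarrow> bool" where
  "conformally_flat A g \<longleftrightarrow> (\<forall>c\<in>A. \<forall>x\<in>chart_image c. \<exists>W \<rho>.
     open W \<and> x \<in> W \<and> W \<subseteq> chart_image c \<and> smooth_on W \<rho> \<and> (\<forall>y\<in>W. \<rho> y > 0) \<and>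
     (\<forall>y\<in>W. \<forall>m i j k. riemann (\<lambda>z. \<rho> z *\<^sub>R g c z) y m i j k = 0))"


section \<open>Symmetric tensors and trace-free parts\<close>

definition totally_symmetric :: "nat \<Rightarrow> 'n tensor \<Rightarrow> bool" where
  "totally_symmetric r T \<longleftrightarrow> (\<forall>I J. length I = r \<longrightarrow> mset I = mset J \<longrightarrow> T I = T J)"

definition totally_tracefree :: "real^'n^'n \<Rightarrow> nat \<Rightarrow> 'n tensor \<Rightarrow> bool" where
  "totally_tracefree \<gamma> r T \<longleftrightarrow> (\<forall>I p q. length I = r \<longrightarrow> p < q \<longrightarrow> q < r \<longrightarrow>
     (\<Sum>a\<in>UNIV. \<Sum>b\<in>UNIV. ginv \<gamma> a b * T (I[p := a, q := b])) = 0)"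

text \<open>Sums of terms \<open>\<gamma> \<otimes> U\<close>, with \<open>\<gamma>\<close> in any two slots \<open>p < q\<close> and an arbitrary tensor
  \<open>U p q\<close> of rank \<open>r - 2\<close> in the remaining ones.\<close>

definition pure_trace :: "real^'n^'n \<Rightarrow> nat \<Rightarrow> 'n tensor \<Rightarrow> bool" where
  "pure_trace \<gamma> r T \<longleftrightarrow> (\<exists>U :: nat \<Rightarrow> nat \<Rightarrow> 'n tensor. \<forall>I. length I = r \<longrightarrow>
     T I = (\<Sum>q<r. \<Sum>p<q. \<gamma> $ (I!p) $ (I!q) * U p q (nths I (- {p, q}))))"

text \<open>The tensors of rank \<open>r\<close> are the direct sum of the totally trace-free and the pure-trace
  ones (for nondegenerate symmetric \<open>\<gamma>\<close>), so the choice below is unambiguous on index lists of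
  length \<open>r\<close>.\<close>

definition tf_part :: "real^'n^'n \<Rightarrow> nat \<Rightarrow> 'n tensor \<Rightarrow> 'n tensor" where
  "tf_part \<gamma> r T = (SOME T0. totally_tracefree \<gamma> r T0 \<and> pure_trace \<gamma> r (\<lambda>I. T I - T0 I))"

text \<open>The operation \<open>\<Pi>\<^sub>i\<^sub>j\<^sub>k\<close>, without normalising factor.\<close>

definition Pi_op :: "real^'n^'n \<Rightarrow> ('n \<Rightarrow> 'n \<Rightarrow> 'n \<Rightarrow> real) \<Rightarrow> 'n \<Rightarrow> 'n \<Rightarrow> 'n \<Rightarrow> real" where
  "Pi_op \<gamma> X i j k = tf_part \<gamma> 3
     (tens3 (\<lambda>i j k. X i j k + X i k j + X j i k + X j k i + X k i j + X k j i)) [i, j, k]"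


section \<open>The overdetermined system\<close>

text \<open>For a function \<open>t\<close> with gradient \<open>t\<^sub>i\<close> and a totally symmetric trace-free \<open>S\<^sub>i\<^sub>j\<^sub>k\<close>, the
  system prescribes (a) \<open>\<nabla>\<^sub>i t\<^sub>j\<close> up to its trace, (b) that trace \<open>\<nabla>\<^sup>a t\<^sub>a\<close>, and (c)
  \<open>\<nabla>\<^sub>l S\<^sub>i\<^sub>j\<^sub>k\<close>, all as functions of \<open>S\<close>, \<open>t\<^sub>i\<close> and the curvature.\<close>

text \<open>\<open>contr1 \<gamma> S i j k l\<close> is \<open>S\<^sub>i\<^sub>j\<^sup>a S\<^sub>k\<^sub>l\<^sub>a\<close> and \<open>contr2 \<gamma> S i j\<close> is \<open>S\<^sub>i\<^sup>a\<^sup>b S\<^sub>j\<^sub>a\<^sub>b\<close>.\<close>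

definition contr1 :: "real^'n^'n \<Rightarrow> 'n tensor \<Rightarrow> 'n \<Rightarrow> 'n \<Rightarrow> 'n \<Rightarrow> 'n \<Rightarrow> real" where
  "contr1 \<gamma> S i j k l = (\<Sum>a\<in>UNIV. \<Sum>b\<in>UNIV. ginv \<gamma> a b * S [i, j, b] * S [k, l, a])"

definition contr2 :: "real^'n^'n \<Rightarrow> 'n tensor \<Rightarrow> 'n \<Rightarrow> 'n \<Rightarrow> real" where
  "contr2 \<gamma> S i j = (\<Sum>a\<in>UNIV. \<Sum>b\<in>UNIV. \<Sum>c\<in>UNIV. \<Sum>d\<in>UNIV.
     ginv \<gamma> a c * ginv \<gamma> b d * S [i, c, d] * S [j, a, b])"

definition norm2S :: "real^'n^'n \<Rightarrow> 'n tensor \<Rightarrow> real" where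
  "norm2S \<gamma> S = (\<Sum>c\<in>UNIV. \<Sum>d\<in>UNIV. ginv \<gamma> c d * contr2 \<gamma> S c d)"

definition norm2t :: "real^'n^'n \<Rightarrow> 'n tensor \<Rightarrow> real" where
  "norm2t \<gamma> \<tau> = (\<Sum>a\<in>UNIV. \<Sum>b\<in>UNIV. ginv \<gamma> a b * \<tau> [a] * \<tau> [b])"

definition contrSt :: "real^'n^'n \<Rightarrow> 'n tensor \<Rightarrow> 'n tensor \<Rightarrow> 'n \<Rightarrow> 'n \<Rightarrow> real" where
  "contrSt \<gamma> S \<tau> j k = (\<Sum>a\<in>UNIV. \<Sum>b\<in>UNIV. ginv \<gamma> a b * S [j, k, a] * \<tau> [b])"

definition star_condition :: "real^'n^'n \<Rightarrow> 'n tensor \<Rightarrow> bool" where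
  "star_condition \<gamma> S \<longleftrightarrow> (\<forall>i j k l.
     tf_part \<gamma> 4 (tens4 (\<lambda>i j k l. contr1 \<gamma> S i j k l - contr1 \<gamma> S i k j l)) [i, j, k, l] = 0)"

text \<open>The right-hand sides of (a), (b), (c) at one point, as functions of the metric, the Ricci
  tensor \<open>Ric\<close>, the scalar curvature \<open>R\<close>, the covector \<open>\<tau>\<close>, the tensor \<open>S\<close>
  and, in (a), the divergence \<open>D\<close> of \<open>\<tau>\<close>.\<close>

definition rhs_a ::
  "real^'n^'n \<Rightarrow> ('n \<Rightarrow> 'n \<Rightarrow> real) \<Rightarrow> 'n tensor \<Rightarrow> 'n tensor \<Rightarrow> real \<Rightarrow> 'n tensor" where
  "rhs_a \<gamma> Ric S \<tau> D = (let n = real CARD('n) in tens2 (\<lambda>i j.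
     tf_part \<gamma> 2 (tens2 (\<lambda>i j. 3 / (n - 2) * Ric i j
                             + 1 / (3 * (n - 2)) * contr2 \<gamma> S i j
                             + 1 / 3 * \<tau> [i] * \<tau> [j])) [i, j]
     + 1 / n * \<gamma> $ i $ j * D))"

definition rhs_b :: "real^'n^'n \<Rightarrow> real \<Rightarrow> 'n tensor \<Rightarrow> 'n tensor \<Rightarrow> real" where
  "rhs_b \<gamma> R S \<tau> = (let n = real CARD('n) in
     3 / (2 * (n - 1)) * R + (3 * n + 2) / (6 * (n - 1) * (n + 2)) * norm2S \<gamma> S
     - (n - 2) / 6 * norm2t \<gamma> \<tau>)"

definition rhs_c :: "real^'n^'n \<Rightarrow> 'n tensor \<Rightarrow> 'n tensor \<Rightarrow> 'n tensor" where
  "rhs_c \<gamma> S \<tau> = (let n = real CARD('n) in tens4 (\<lambda>l i j k.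
     1 / 18 * Pi_op \<gamma> (\<lambda>i j k. contr1 \<gamma> S i l j k + 3 * S [i, j, l] * \<tau> [k] + S [i, j, k] * \<tau> [l]
        + (4 / (n - 2) * contr2 \<gamma> S j k - 3 * contrSt \<gamma> S \<tau> j k) * \<gamma> $ i $ l) i j k))"

definition grad :: "(real^'n \<Rightarrow> real) \<Rightarrow> real^'n \<Rightarrow> 'n tensor" where
  "grad t x I = pd (hd I) t x"

definition divergence :: "(real^'n \<Rightarrow> real^'n^'n) \<Rightarrow> (real^'n \<Rightarrow> 'n tensor) \<Rightarrow> real^'n \<Rightarrow> real" where
  "divergence h \<tau> x = (\<Sum>a\<in>UNIV. \<Sum>b\<in>UNIV. ginv (h x) a b * covD h \<tau> x [a, b])"

definition solves_system_at ::
  "(real^'n \<Rightarrow> real^'n^'n) \<Rightarrow> (real^'n \<Rightarrow> real) \<Rightarrow> (real^'n \<Rightarrow> 'n tensor) \<Rightarrow> real^'n \<Rightarrow> bool" where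
  "solves_system_at h t S x \<longleftrightarrow>
     (\<forall>i j. covD h (grad t) x [i, j]
        = rhs_a (h x) (ricci h x) (S x) (grad t x) (divergence h (grad t) x) [i, j]) \<and>
     divergence h (grad t) x = rhs_b (h x) (scalar_curv h x) (S x) (grad t x) \<and>
     (\<forall>l i j k. covD h S x [l, i, j, k] = rhs_c (h x) (S x) (grad t x) [l, i, j, k])"

text \<open>\<open>\<nabla>\<^sub>i t\<^sub>j\<close> and \<open>\<nabla>\<^sub>l S\<^sub>i\<^sub>j\<^sub>k\<close> as expressed through (a), (b) and (c).\<close>

definition Dt_expr ::
  "(real^'n \<Rightarrow> real^'n^'n) \<Rightarrow> (real^'n \<Rightarrow> real) \<Rightarrow> (real^'n \<Rightarrow> 'n tensor) \<Rightarrow> real^'n \<Rightarrow> 'n tensor" where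
  "Dt_expr h t S y = rhs_a (h y) (ricci h y) (S y) (grad t y)
                      (rhs_b (h y) (scalar_curv h y) (S y) (grad t y))"

definition DS_expr ::
  "(real^'n \<Rightarrow> real^'n^'n) \<Rightarrow> (real^'n \<Rightarrow> real) \<Rightarrow> (real^'n \<Rightarrow> 'n tensor) \<Rightarrow> real^'n \<Rightarrow> 'n tensor" where
  "DS_expr h t S y = rhs_c (h y) (S y) (grad t y)"

text \<open>The Ricci identities with the inner derivatives replaced by (a)--(c).  The outer
  derivative of these expressions involves first derivatives of \<open>S\<close> and \<open>grad t\<close> at \<open>x\<close> only;
  if \<open>solves_system_at h t S x\<close>, these too have the values prescribed by (a)--(c), so the
  identities become algebraic conditions on \<open>S\<close> and \<open>grad t\<close> at \<open>x\<close>.  It would not do to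
  assume (a)--(c) on a neighbourhood instead: the Ricci identities then hold for free.\<close>

definition ricci_identities_at ::
  "(real^'n \<Rightarrow> real^'n^'n) \<Rightarrow> (real^'n \<Rightarrow> real) \<Rightarrow> (real^'n \<Rightarrow> 'n tensor) \<Rightarrow> real^'n \<Rightarrow> bool" where
  "ricci_identities_at h t S x \<longleftrightarrow>
     (\<forall>m l i j k. covD h (DS_expr h t S) x [m, l, i, j, k] - covD h (DS_expr h t S) x [l, m, i, j, k]
        = (\<Sum>a\<in>UNIV. riemann h x a i l m * S x [a, j, k] + riemann h x a j l m * S x [i, a, k]
                      + riemann h x a k l m * S x [i, j, a])) \<and>
     (\<forall>i j k. covD h (Dt_expr h t S) x [k, j, i] - covD h (Dt_expr h t S) x [j, k, i]
        = (\<Sum>a\<in>UNIV. riemann h x a i j k * grad t x [a]))"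

definition smooth_symmetric_tracefree3_on ::
  "(real^'n \<Rightarrow> real^'n^'n) \<Rightarrow> (real^'n) set \<Rightarrow> (real^'n \<Rightarrow> 'n tensor) \<Rightarrow> bool" where
  "smooth_symmetric_tracefree3_on h W S \<longleftrightarrow>
     (\<forall>i j k. smooth_on W (\<lambda>y. S y [i, j, k])) \<and>
     (\<forall>y\<in>W. totally_symmetric 3 (S y) \<and> totally_tracefree (h y) 3 (S y))"

end

theory Submission
  imports Defs
begin

text \<open>
The equations are solved by a formula.  Two facts make this possible.

A conformally flat metric is induced, near a point, by an immersion \<open>X\<close> into the light cone of the
space \<open>E = \<real> \<times> \<real>\<^sup>n \<times> \<real>\<close> with the form \<open>B\<close> that pairs the outer factors and restricts to the metric
at the base point on the middle one.  The flat metric \<open>\<rho> g\<close> in the conformal class has coordinates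
\<open>y\<close> in which it is constant, and \<open>X = \<rho>\<^bsup>-1/2\<^esup> (\<lambda>, y, - \<beta>(y, y) / 2\<lambda>)\<close> does it.  The second
fundamental form of \<open>X\<close> has the Schouten tensor \<open>P\<close> as its only non-trivial part, by the Gauss
equation (\<open>light_cone_immersion\<close>, \<open>N_pair\<close>, \<open>ricci_eq\<close>).

The condition \<open>(*)\<close> says that the curvature-like tensor quadratic in \<open>\<Psi>\<close> has no Weyl part, that is,
it is the Kulkarni-Nomizu product of the metric with some symmetric form.  This is equivalent to
the middle factor with the product defined by \<open>\<Psi>\<close>, modified by a trace, being part of a commutative
associative algebra on \<open>E\<close> with null unit \<open>(1, 0, 0)\<close> for which \<open>B\<close> is invariant.  The remaining
identities needed for associativity come from the Jacobi identity for the operators of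
multiplication (\<open>star_condition_kulkarni_nomizu\<close>, \<open>K_eq\<close>, \<open>hop_hop\<close>, \<open>mul_assoc\<close>).

At the base point \<open>X\<close> is the unit, so that \<open>V = X\<^bsup>-1\<^esup>\<close> exists nearby.  The cubic form
\<open>T\<^sub>i\<^sub>j\<^sub>k = B(V, \<partial>\<^sub>iX \<partial>\<^sub>jX \<partial>\<^sub>kX)\<close> with trace \<open>\<theta>\<close> then satisfies
\<open>\<nabla>\<^sub>l T\<^sub>i\<^sub>j\<^sub>k = - Q\<^sub>l\<^sub>i\<^sub>j\<^sub>k\<close> modulo terms with the metric as a factor, where
\<open>Q\<^sub>l\<^sub>i\<^sub>j\<^sub>k = B(V \<partial>\<^sub>lX \<partial>\<^sub>iX, V \<partial>\<^sub>jX \<partial>\<^sub>kX)\<close> is totally symmetric by associativity (\<open>pv_T\<close>).  From this it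
follows by algebra at one point that \<open>S = - 3 T\<^sub>\<circ>\<close> and \<open>dt = - 3 \<theta> / (n + 2)\<close> solve the system; the form
\<open>\<theta>\<close> is closed (\<open>equation_a\<close>, \<open>equation_b\<close>, \<open>equation_c\<close>, \<open>solution_exists\<close>).  The trace that modifies
the product is free, and it is used to prescribe the gradient (\<open>system_solvable\<close>).

The Ricci identities follow from the solvability.  Values of \<open>S\<close> and \<open>dt\<close> at a point that satisfy
\<open>(*)\<close> are those of a true solution, for which the identities hold because partial derivatives
commute.  Both sides of the identities, with the derivatives expressed by the system, depend on the
first-order jets at the point only, and these are determined by the values through the system
(\<open>ricci_identities_transfer\<close>).\<close>

section \<open>Partial derivatives and smoothness of vector-valued maps\<close>

text \<open>Partial derivatives, class \<open>C\<^sup>r\<close> and smoothness are needed for maps into normed spaces, so that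
  matrices and elements of an algebra can be differentiated as a whole.  For real functions the
  notions coincide with \<open>pd\<close>, \<open>Ck_on\<close> and \<open>smooth_on\<close>.\<close>

definition pv :: "'n::finite \<Rightarrow> (real^'n \<Rightarrow> 'a::real_normed_vector) \<Rightarrow> real^'n \<Rightarrow> 'a" where
  "pv k f x = frechet_derivative f (at x) (axis k 1)"

primrec Ckv :: "nat \<Rightarrow> (real^'n) set \<Rightarrow> (real^'n::finite \<Rightarrow> 'a::real_normed_vector) \<Rightarrow> bool" where
  "Ckv 0 U f \<longleftrightarrow> continuous_on U f"
| "Ckv (Suc r) U f \<longleftrightarrow> (\<forall>x\<in>U. f differentiable (at x)) \<and> (\<forall>k. Ckv r U (pv k f))"

definition smoothv :: "(real^'n) set \<Rightarrow> (real^'n::finite \<Rightarrow> 'a::real_normed_vector) \<Rightarrow> bool" where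
  "smoothv U f \<longleftrightarrow> (\<forall>r. Ckv r U f)"

lemma pd_eq_pv: "pd = pv"
  by (intro ext) (simp add: pd_def pv_def)

lemma Ck_on_eq_Ckv: "Ck_on r U f \<longleftrightarrow> Ckv r U f"
  by (induction r arbitrary: f) (simp_all add: pd_eq_pv)

lemma smooth_on_eq_smoothv: "smooth_on U f \<longleftrightarrow> smoothv U f"
  by (simp add: smooth_on_def smoothv_def Ck_on_eq_Ckv)

lemma vec_sum_axis: "(v::real^'n::finite) = (\<Sum>k\<in>UNIV. v $ k *\<^sub>R axis k 1)"
  by (metis (no_types, lifting) basis_expansion scalar_mult_eq_scaleR sum.cong)

lemma linear_partials:
  assumes "linear L" shows "L (v::real^'n::finite) = (\<Sum>k\<in>UNIV. v $ k *\<^sub>R L (axis k 1))"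
  using arg_cong[OF vec_sum_axis[of v], of L]
  unfolding linear_sum[OF assms] linear_scale[OF assms] .

lemma has_derivative_pv:
  assumes "f differentiable (at x)"
  shows "(f has_derivative (\<lambda>v. \<Sum>k\<in>UNIV. v $ k *\<^sub>R pv k f x)) (at x)"
proof -
  have d: "(f has_derivative frechet_derivative f (at x)) (at x)"
    using assms frechet_derivative_works by blast
  moreover have "frechet_derivative f (at x) = (\<lambda>v. \<Sum>k\<in>UNIV. v $ k *\<^sub>R pv k f x)"
    unfolding pv_def by (rule ext, rule linear_partials[OF has_derivative_linear[OF d]])
  ultimately show ?thesis by (simp only:)
qed

lemma pv_eqI: "(f has_derivative f') (at x) \<Longrightarrow> pv k f x = f' (axis k 1)"
  unfolding pv_def by (metis frechet_derivative_at)

lemma has_derivative_partials_pv: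
  assumes "(f has_derivative (\<lambda>v. \<Sum>k\<in>UNIV. v $ k *\<^sub>R D k)) (at x)"
  shows "pv k f x = D k"
proof -
  have "(\<Sum>j\<in>UNIV. axis k (1::real) $ j *\<^sub>R D j) = (\<Sum>j\<in>UNIV. if j = k then D j else 0)"
    by (rule sum.cong) (auto simp: axis_def)
  then show ?thesis using pv_eqI[OF assms, of k] by simp
qed

lemma eventually_eq_derivative:
  assumes "open U" "x \<in> U" "\<And>y. y \<in> U \<Longrightarrow> f y = g y"
  shows "(f has_derivative D) (at x) \<longleftrightarrow> (g has_derivative D) (at x)"
  using has_derivative_transform_within_open[of f D x UNIV U g]
    has_derivative_transform_within_open[of g D x UNIV U f] assms by auto

lemma differentiable_cong_open:
  assumes "open U" "x \<in> U" "\<And>y. y \<in> U \<Longrightarrow> f y = g y"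
  shows "f differentiable (at x) \<longleftrightarrow> g differentiable (at x)"
  using eventually_eq_derivative[of U x f g] assms unfolding differentiable_def by blast

lemma pv_cong:
  assumes "open U" "x \<in> U" "\<And>y. y \<in> U \<Longrightarrow> f y = g y"
  shows "pv k f x = pv k g x"
proof -
  have "(f has_derivative D) (at x) \<longleftrightarrow> (g has_derivative D) (at x)" for D
    by (rule eventually_eq_derivative[OF assms])
  then show ?thesis unfolding pv_def frechet_derivative_def by simp
qed

lemma Ckv_cong:
  assumes "open U" "\<And>y. y \<in> U \<Longrightarrow> f y = g y"
  shows "Ckv r U f \<longleftrightarrow> Ckv r U g"
  using assms(2)
proof (induction r arbitrary: f g)
  case 0 then show ?case by (simp cong: continuous_on_cong)
next
  case (Suc r)
  have "Ckv r U (pv k f) \<longleftrightarrow> Ckv r U (pv k g)" for k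
    by (rule Suc.IH, rule pv_cong[OF assms(1)]) (use Suc.prems in auto)
  moreover have "(\<forall>x\<in>U. f differentiable (at x)) \<longleftrightarrow> (\<forall>x\<in>U. g differentiable (at x))"
    using differentiable_cong_open[OF assms(1), of _ f g] Suc.prems by blast
  ultimately show ?case by simp
qed

lemma Ckv_pvI:
  assumes "open U" "\<And>y. y \<in> U \<Longrightarrow> pv k f y = g y" "Ckv r U g"
  shows "Ckv r U (pv k f)"
  using Ckv_cong[of U "pv k f" g r] assms by blast

lemma Ckv_subset: "Ckv r U f \<Longrightarrow> V \<subseteq> U \<Longrightarrow> Ckv r V f"
  by (induction r arbitrary: f) (auto intro: continuous_on_subset)

lemma smoothv_subset: "smoothv U f \<Longrightarrow> V \<subseteq> U \<Longrightarrow> smoothv V f"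
  using Ckv_subset unfolding smoothv_def by blast

lemma Ckv_SucD: "Ckv (Suc r) U f \<Longrightarrow> Ckv r U f"
proof (induction r arbitrary: f)
  case 0
  then show ?case
    by (auto intro!: continuous_at_imp_continuous_on differentiable_imp_continuous_within)
next
  case (Suc r) then show ?case by auto
qed

lemma smoothv_differentiable: "smoothv U f \<Longrightarrow> x \<in> U \<Longrightarrow> f differentiable (at x)"
  unfolding smoothv_def using Ckv.simps(2) by blast

lemma smoothv_pv: "smoothv U f \<Longrightarrow> smoothv U (pv k f)"
  unfolding smoothv_def using Ckv.simps(2) by blast

lemma smoothv_continuous_on: "smoothv U f \<Longrightarrow> continuous_on U f"
  unfolding smoothv_def using Ckv.simps(1) by blast

lemma Ckv_const: "Ckv r U (\<lambda>x. c)"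
proof (induction r arbitrary: c)
  case (Suc r)
  have "pv k (\<lambda>x. c) = (\<lambda>x. 0)" for k :: 'a by (rule ext) (simp add: pv_def)
  then show ?case using Suc by simp
qed simp

lemma smoothv_const [simp]: "smoothv U (\<lambda>x. c)"
  by (simp add: smoothv_def Ckv_const)

lemma pv_const [simp]: "pv k (\<lambda>x. c) x = 0"
  by (simp add: pv_def)

lemma pv_add:
  assumes "f differentiable (at x)" "g differentiable (at x)"
  shows "pv k (\<lambda>x. f x + g x) x = pv k f x + pv k g x"
  using pv_eqI[OF has_derivative_add[OF frechet_derivative_works[THEN iffD1, OF assms(1)]
      frechet_derivative_works[THEN iffD1, OF assms(2)]]] by (simp add: pv_def)

lemma pv_linear:
  assumes "bounded_linear L" "f differentiable (at x)"
  shows "pv k (\<lambda>x. L (f x)) x = L (pv k f x)"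
  using pv_eqI[OF bounded_linear.has_derivative[OF assms(1) frechet_derivative_works[THEN iffD1, OF assms(2)]]]
  by (simp add: pv_def)

lemma differentiable_bilinear:
  assumes "bounded_bilinear m" "f differentiable (at x)" "g differentiable (at x)"
  shows "(\<lambda>x. m (f x) (g x)) differentiable (at x)"
  using bounded_bilinear.FDERIV[OF assms(1) frechet_derivative_works[THEN iffD1, OF assms(2)]
      frechet_derivative_works[THEN iffD1, OF assms(3)]] unfolding differentiable_def by blast

lemma pv_bilinear:
  assumes "bounded_bilinear m" "f differentiable (at x)" "g differentiable (at x)"
  shows "pv k (\<lambda>x. m (f x) (g x)) x = m (pv k f x) (g x) + m (f x) (pv k g x)"
  using pv_eqI[OF bounded_bilinear.FDERIV[OF assms(1) frechet_derivative_works[THEN iffD1, OF assms(2)]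
      frechet_derivative_works[THEN iffD1, OF assms(3)]]] by (simp add: pv_def add.commute)

lemma differentiable_linear:
  "bounded_linear L \<Longrightarrow> f differentiable (at x) \<Longrightarrow> (\<lambda>x. L (f x)) differentiable (at x)"
  unfolding differentiable_def by (metis bounded_linear.has_derivative)

lemma Ckv_linear:
  assumes "bounded_linear L" "open U"
  shows "Ckv r U f \<Longrightarrow> Ckv r U (\<lambda>x. L (f x))"
proof (induction r arbitrary: f)
  case 0
  then show ?case by (simp add: bounded_linear.continuous_on[OF assms(1)])
next
  case (Suc r)
  have "Ckv r U (pv k (\<lambda>x. L (f x)))" for k
    by (rule Ckv_pvI[OF assms(2) pv_linear[OF assms(1)]]) (use Suc in auto)
  moreover have "\<forall>x\<in>U. (\<lambda>x. L (f x)) differentiable (at x)"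
    using Suc.prems by (intro ballI differentiable_linear[OF assms(1)]) simp
  ultimately show ?case by simp
qed

lemma smoothv_linear: "bounded_linear L \<Longrightarrow> open U \<Longrightarrow> smoothv U f \<Longrightarrow> smoothv U (\<lambda>x. L (f x))"
  by (simp add: smoothv_def Ckv_linear)

lemma Ckv_add:
  assumes "open U" shows "Ckv r U f \<Longrightarrow> Ckv r U g \<Longrightarrow> Ckv r U (\<lambda>x. f x + g x)"
proof (induction r arbitrary: f g)
  case 0 then show ?case by (simp add: continuous_on_add)
next
  case (Suc r)
  have "Ckv r U (pv k (\<lambda>x. f x + g x))" for k
    by (rule Ckv_pvI[OF assms pv_add]) (use Suc in auto)
  then show ?case using Suc.prems by (simp add: differentiable_add)
qed

lemma smoothv_add: "open U \<Longrightarrow> smoothv U f \<Longrightarrow> smoothv U g \<Longrightarrow> smoothv U (\<lambda>x. f x + g x)"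
  by (simp add: smoothv_def Ckv_add)

lemma smoothv_sum:
  assumes "open U" "\<And>i. i \<in> I \<Longrightarrow> smoothv U (f i)"
  shows "smoothv U (\<lambda>x. \<Sum>i\<in>I. f i x)"
  using assms(2) by (induction I rule: infinite_finite_induct) (auto intro!: smoothv_add assms(1))

lemma Ckv_bilinear:
  assumes m: "bounded_bilinear m" and U: "open U"
  shows "Ckv r U f \<Longrightarrow> Ckv r U g \<Longrightarrow> Ckv r U (\<lambda>x. m (f x) (g x))"
proof (induction r arbitrary: f g)
  case 0 then show ?case by (simp add: bounded_bilinear.continuous_on[OF m])
next
  case (Suc r)
  have "Ckv r U (pv k (\<lambda>x. m (f x) (g x)))" for k
  proof (rule Ckv_pvI[OF U pv_bilinear[OF m]])
    show "Ckv r U (\<lambda>x. m (pv k f x) (g x) + m (f x) (pv k g x))"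
      using Suc.prems Ckv_SucD[OF Suc.prems(1)] Ckv_SucD[OF Suc.prems(2)]
      by (intro Ckv_add[OF U] Suc.IH) auto
  qed (use Suc.prems in auto)
  moreover have "\<forall>x\<in>U. (\<lambda>x. m (f x) (g x)) differentiable (at x)"
    using Suc.prems by (intro ballI differentiable_bilinear[OF m]) simp_all
  ultimately show ?case by simp
qed

lemma smoothv_bilinear:
  "bounded_bilinear m \<Longrightarrow> open U \<Longrightarrow> smoothv U f \<Longrightarrow> smoothv U g \<Longrightarrow> smoothv U (\<lambda>x. m (f x) (g x))"
  by (simp add: smoothv_def Ckv_bilinear)

lemma smoothv_mult:
  fixes f g :: "real^'n::finite \<Rightarrow> real"
  shows "open U \<Longrightarrow> smoothv U f \<Longrightarrow> smoothv U g \<Longrightarrow> smoothv U (\<lambda>x. f x * g x)"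
  by (rule smoothv_bilinear[OF bounded_bilinear_mult])

lemma smoothv_cmult:
  fixes f :: "real^'n::finite \<Rightarrow> real"
  shows "open U \<Longrightarrow> smoothv U f \<Longrightarrow> smoothv U (\<lambda>x. c * f x)"
  by (intro smoothv_mult smoothv_const)

lemma smoothv_uminus: "open U \<Longrightarrow> smoothv U f \<Longrightarrow> smoothv U (\<lambda>x. - f x)"
  by (rule smoothv_linear[OF bounded_linear_minus[OF bounded_linear_ident]])

lemma smoothv_diff: "open U \<Longrightarrow> smoothv U f \<Longrightarrow> smoothv U g \<Longrightarrow> smoothv U (\<lambda>x. f x - g x)"
  using smoothv_add[of U f "\<lambda>x. - g x"] smoothv_uminus[of U g] by simp

text \<open>Bootstrapping: a solution of a differential equation whose right-hand side gains no
  roughness is smooth.\<close>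

lemma smoothv_bootstrap:
  assumes "open U" "\<And>x. x \<in> U \<Longrightarrow> f differentiable (at x)"
    and "\<And>k r. Ckv r U f \<Longrightarrow> Ckv r U (pv k f)"
  shows "smoothv U f"
proof -
  have "Ckv r U f" for r
  proof (induction r)
    case 0 show ?case
      using assms(2) by (auto intro!: continuous_at_imp_continuous_on differentiable_imp_continuous_within)
  next
    case (Suc r) then show ?case using assms by auto
  qed
  then show ?thesis by (simp add: smoothv_def)
qed

lemma smoothv_bootstrap_bilinear:
  assumes "open U" "bounded_bilinear m" "\<And>x. x \<in> U \<Longrightarrow> f differentiable (at x)"
    and "\<And>k. smoothv U (g k)" "\<And>k x. x \<in> U \<Longrightarrow> pv k f x = m (g k x) (f x)"
  shows "smoothv U f"
proof (rule smoothv_bootstrap[OF assms(1,3)])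
  fix k r assume "Ckv r U f"
  then have "Ckv r U (\<lambda>x. m (g k x) (f x))"
    using assms(4) by (intro Ckv_bilinear[OF assms(2,1)]) (auto simp: smoothv_def)
  then show "Ckv r U (pv k f)"
    by (rule Ckv_pvI[OF assms(1) assms(5), rotated])
qed

text \<open>Inverses in an associative algebra depend smoothly on the element.  This covers reciprocals
  of functions, inverse matrices, and inverses in the Frobenius algebra below.  The resolvent
  identity \<open>V(y) - V(x) = V(y) (F(x) - F(y)) V(x)\<close> first bounds \<open>V\<close> near \<open>x\<close>, hence shows that it is
  continuous, and then yields the derivative.\<close>

lemma has_derivative_algebra_inverse:
  fixes m :: "'a::real_normed_vector \<Rightarrow> 'a \<Rightarrow> 'a" and F V :: "'c::real_normed_vector \<Rightarrow> 'a"
  assumes m: "bounded_bilinear m" and assoc: "\<And>a b c. m (m a b) c = m a (m b c)"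
    and unit: "\<And>a. m e a = a" "\<And>a. m a e = a"
    and U: "open U" "x \<in> U" and inv: "\<And>y. y \<in> U \<Longrightarrow> m (V y) (F y) = e" "\<And>y. y \<in> U \<Longrightarrow> m (F y) (V y) = e"
    and d: "(F has_derivative D) (at x)"
  shows "(V has_derivative (\<lambda>h. - m (m (V x) (D h)) (V x))) (at x)"
proof -
  interpret bounded_bilinear m by fact
  obtain K where K: "K > 0" "\<And>a b. norm (m a b) \<le> norm a * norm b * K"
    using pos_bounded by blast
  have diff: "V y - V x = m (m (V y) (F x - F y)) (V x)" if "y \<in> U" for y
  proof -
    have "m (m (V y) (F x - F y)) (V x) = m (V y) (m (F x) (V x)) - m (m (V y) (F y)) (V x)"
      by (simp add: diff_left diff_right assoc)
    then show ?thesis using inv(1)[OF that] inv(2)[OF U(2)] by (simp add: unit)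
  qed
  have Fc: "(F \<longlongrightarrow> F x) (at x)"
    using has_derivative_continuous[OF d] by (simp add: continuous_within)
  have inU: "eventually (\<lambda>y. y \<in> U) (at x)"
    using U by (rule eventually_at_in_open')
  have Vb: "eventually (\<lambda>y. norm (V y) \<le> 2 * norm (V x)) (at x)"
  proof -
    have "((\<lambda>y. norm (F x - F y) * K * (norm (V x) * K)) \<longlongrightarrow> norm (F x - F x) * K * (norm (V x) * K)) (at x)"
      by (intro tendsto_intros Fc)
    then have "eventually (\<lambda>y. norm (F x - F y) * K * (norm (V x) * K) < 1/2) (at x)"
      by (rule order_tendstoD) simp
    then show ?thesis using inU
    proof eventually_elim
      case (elim y)
      have "norm (V y - V x) \<le> norm (m (V y) (F x - F y)) * norm (V x) * K"
        using diff[OF elim(2)] K(2) by simp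
      also have "\<dots> \<le> (norm (V y) * norm (F x - F y) * K) * norm (V x) * K"
        using K by (intro mult_right_mono) auto
      also have "\<dots> = norm (V y) * (norm (F x - F y) * K * (norm (V x) * K))" by simp
      also have "\<dots> \<le> norm (V y) * (1/2)" using elim(1) by (intro mult_left_mono) auto
      finally show ?case using norm_triangle_ineq2[of "V y" "V x"] by simp
    qed
  qed
  have Vc: "(V \<longlongrightarrow> V x) (at x)"
  proof -
    have "((\<lambda>y. 2 * norm (V x) * norm (F x - F y) * K * norm (V x) * K) \<longlongrightarrow>
        2 * norm (V x) * norm (F x - F x) * K * norm (V x) * K) (at x)"
      by (intro tendsto_intros Fc)
    then have z: "((\<lambda>y. 2 * norm (V x) * norm (F x - F y) * K * norm (V x) * K) \<longlongrightarrow> 0) (at x)" by simp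
    have "eventually (\<lambda>y. norm (V y - V x) \<le> 2 * norm (V x) * norm (F x - F y) * K * norm (V x) * K) (at x)"
      using Vb inU
    proof eventually_elim
      case (elim y)
      have "norm (V y - V x) \<le> norm (m (V y) (F x - F y)) * norm (V x) * K"
        using diff[OF elim(2)] K(2) by simp
      also have "\<dots> \<le> (norm (V y) * norm (F x - F y) * K) * norm (V x) * K"
        using K by (intro mult_right_mono) auto
      also have "\<dots> \<le> (2 * norm (V x) * norm (F x - F y) * K) * norm (V x) * K"
        using K elim(1) by (intro mult_right_mono) auto
      finally show ?case .
    qed
    then have "((\<lambda>y. V y - V x) \<longlongrightarrow> 0) (at x)"
      by (rule Lim_null_comparison[OF _ z])
    then show ?thesis by (simp add: LIM_zero_iff)
  qed
  have blD: "bounded_linear D" using d by (rule has_derivative_bounded_linear)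
  have lim: "((\<lambda>y. norm (F y - F x - D (y - x)) / norm (y - x)) \<longlongrightarrow> 0) (at x)"
    using d unfolding has_derivative_iff_norm by simp
  obtain L where L: "L > 0" "\<And>h. norm (D h) \<le> norm h * L"
    using bounded_linear.pos_bounded[OF blD] by blast
  show ?thesis unfolding has_derivative_iff_norm
  proof
    show "bounded_linear (\<lambda>h. - m (m (V x) (D h)) (V x))"
      by (intro bounded_linear_minus bounded_linear_compose[OF bounded_linear_left]
            bounded_linear_compose[OF bounded_linear_right] blD)
    let ?g = "\<lambda>y. 2 * norm (V x) * K * norm (V x) * K * (norm (F y - F x - D (y - x)) / norm (y - x))
        + norm (V y - V x) * L * K * norm (V x) * K"
    have "(?g \<longlongrightarrow> 2 * norm (V x) * K * norm (V x) * K * 0 + norm (V x - V x) * L * K * norm (V x) * K) (at x)"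
      by (intro tendsto_intros Vc lim)
    then have g: "(?g \<longlongrightarrow> 0) (at x)" by simp
    have "eventually (\<lambda>y. norm (norm (V y - V x - - m (m (V x) (D (y - x))) (V x)) / norm (y - x)) \<le> ?g y) (at x)"
      using Vb inU
    proof eventually_elim
      case (elim y)
      let ?R = "F y - F x - D (y - x)"
      have "V y - V x - - m (m (V x) (D (y - x))) (V x)
          = - m (m (V y) ?R) (V x) - m (m (V y - V x) (D (y - x))) (V x)"
      proof -
        have "F x - F y = - (?R + D (y - x))" by simp
        then have "V y - V x = - m (m (V y) ?R) (V x) - m (m (V y) (D (y - x))) (V x)"
          using diff[OF elim(2)] by (simp only: minus_right minus_left add_right add_left) simp
        moreover have "m (m (V y - V x) (D (y - x))) (V x) = m (m (V y) (D (y - x))) (V x) - m (m (V x) (D (y - x))) (V x)"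
          by (simp only: diff_left)
        ultimately show ?thesis by (simp only:) simp
      qed
      also have "norm \<dots> \<le> norm (m (m (V y) ?R) (V x)) + norm (m (m (V y - V x) (D (y - x))) (V x))"
        using norm_triangle_ineq4[of "- m (m (V y) ?R) (V x)"] by simp
      also have "\<dots> \<le> norm (m (V y) ?R) * norm (V x) * K + norm (m (V y - V x) (D (y - x))) * norm (V x) * K"
        using K by (intro add_mono) auto
      also have "\<dots> \<le> (norm (V y) * norm ?R * K) * norm (V x) * K
          + (norm (V y - V x) * norm (D (y - x)) * K) * norm (V x) * K"
        using K by (intro add_mono mult_right_mono) auto
      also have "\<dots> \<le> (2 * norm (V x) * norm ?R * K) * norm (V x) * K
          + (norm (V y - V x) * (norm (y - x) * L) * K) * norm (V x) * K"
        using K L elim(1) by (intro add_mono mult_right_mono mult_left_mono) auto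
      finally have le: "norm (V y - V x - - m (m (V x) (D (y - x))) (V x)) \<le>
         (2 * norm (V x) * norm ?R * K) * norm (V x) * K
          + (norm (V y - V x) * (norm (y - x) * L) * K) * norm (V x) * K" .
      show ?case
      proof (cases "y = x")
        case True then show ?thesis using K L by simp
      next
        case False
        then show ?thesis using divide_right_mono[OF le, of "norm (y - x)"]
          by (simp add: add_divide_distrib mult_ac)
      qed
    qed
    then show "((\<lambda>y. norm (V y - V x - - m (m (V x) (D (y - x))) (V x)) / norm (y - x)) \<longlongrightarrow> 0) (at x)"
      by (rule Lim_null_comparison[OF _ g])
  qed
qed

lemma smoothv_algebra_inverse:
  fixes m :: "'a::real_normed_vector \<Rightarrow> 'a \<Rightarrow> 'a" and F V :: "real^'n::finite \<Rightarrow> 'a"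
  assumes m: "bounded_bilinear m" and assoc: "\<And>a b c. m (m a b) c = m a (m b c)"
    and unit: "\<And>a. m e a = a" "\<And>a. m a e = a"
    and U: "open U" and inv: "\<And>y. y \<in> U \<Longrightarrow> m (V y) (F y) = e" "\<And>y. y \<in> U \<Longrightarrow> m (F y) (V y) = e"
    and F: "smoothv U F"
  shows "smoothv U V" "\<And>k x. x \<in> U \<Longrightarrow> pv k V x = - m (m (V x) (pv k F x)) (V x)"
proof -
  have d: "(V has_derivative (\<lambda>h. - m (m (V x) (frechet_derivative F (at x) h)) (V x))) (at x)" if "x \<in> U" for x
    by (rule has_derivative_algebra_inverse[OF m assoc unit U that inv
          frechet_derivative_works[THEN iffD1, OF smoothv_differentiable[OF F that]]])
  show p: "pv k V x = - m (m (V x) (pv k F x)) (V x)" if "x \<in> U" for k x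
    using pv_eqI[OF d[OF that]] by (simp add: pv_def)
  show "smoothv U V"
  proof (rule smoothv_bootstrap[OF U])
    show "V differentiable (at x)" if "x \<in> U" for x using d[OF that] differentiable_def by blast
    fix k r assume V: "Ckv r U V"
    have "Ckv r U (\<lambda>x. - m (m (V x) (pv k F x)) (V x))"
      using smoothv_pv[OF F, of k] V unfolding smoothv_def
      by (intro Ckv_linear[OF bounded_linear_minus[OF bounded_linear_ident] U] Ckv_bilinear[OF m U]) auto
    then show "Ckv r U (pv k V)"
      by (rule Ckv_pvI[OF U p, rotated])
  qed
qed

lemma smoothv_inverse:
  fixes f :: "real^'n::finite \<Rightarrow> real"
  assumes "open U" "smoothv U f" "\<And>x. x \<in> U \<Longrightarrow> f x \<noteq> 0"
  shows "smoothv U (\<lambda>x. inverse (f x))"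
  by (rule smoothv_algebra_inverse(1)[OF bounded_bilinear_mult _ _ _ assms(1) _ _ assms(2), of 1])
    (use assms(3) in simp_all)

lemma real_mvt_path:
  fixes f :: "real^'n::finite \<Rightarrow> real"
  assumes "t > 0" "\<And>s. 0 \<le> s \<Longrightarrow> s \<le> t \<Longrightarrow> f differentiable (at (p + s *\<^sub>R axis k 1))"
  shows "\<exists>s. 0 < s \<and> s < t \<and> f (p + t *\<^sub>R axis k 1) - f p = t * pv k f (p + s *\<^sub>R axis k 1)"
proof -
  have der: "((\<lambda>s. f (p + s *\<^sub>R axis k 1)) has_field_derivative pv k f (p + s *\<^sub>R axis k 1)) (at s)"
    if "0 \<le> s" "s \<le> t" for s
  proof -
    have "((\<lambda>s. f (p + s *\<^sub>R axis k 1)) has_derivative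
        (\<lambda>h. frechet_derivative f (at (p + s *\<^sub>R axis k 1)) (h *\<^sub>R axis k 1))) (at s)"
      by (rule has_derivative_compose[of "\<lambda>s. p + s *\<^sub>R axis k 1" "\<lambda>h. h *\<^sub>R axis k 1" s UNIV f, simplified])
        (auto intro!: derivative_eq_intros assms(2)[OF that, THEN frechet_derivative_works[THEN iffD1]])
    moreover have "frechet_derivative f (at (p + s *\<^sub>R axis k 1)) (h *\<^sub>R axis k 1)
        = pv k f (p + s *\<^sub>R axis k 1) * h" for h
      using linear_scale[OF linear_frechet_derivative[OF assms(2)[OF that]], of h "axis k 1"]
      by (simp add: pv_def)
    ultimately show ?thesis by (simp add: has_field_derivative_def)
  qed
  from MVT2[OF assms(1) der] obtain z where "0 < z" "z < t"
    "f (p + t *\<^sub>R axis k 1) - f (p + 0 *\<^sub>R axis k 1) = (t - 0) * pv k f (p + z *\<^sub>R axis k 1)" by auto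
  then show ?thesis by auto
qed

text \<open>By the mean value theorem the second difference over a small parallelogram, divided by its
  area, is a value of either mixed second derivative nearby; it is symmetric in the two directions.\<close>

lemma second_difference_limit:
  fixes f :: "real^'n::finite \<Rightarrow> real"
  assumes U: "open U" "x \<in> U" and f: "smoothv U f"
  shows "((\<lambda>t. (f (x + t *\<^sub>R axis i 1 + t *\<^sub>R axis j 1) - f (x + t *\<^sub>R axis i 1)
      - f (x + t *\<^sub>R axis j 1) + f x) / t^2) \<longlongrightarrow> pv j (pv i f) x) (at_right 0)"
proof (rule tendstoI)
  let ?a = "axis i 1 :: real^'n" and ?b = "axis j 1 :: real^'n" and ?g = "pv j (pv i f)"
  fix e :: real assume e: "e > 0"
  have "isCont ?g x"
    using smoothv_differentiable[OF smoothv_pv[OF smoothv_pv[OF f]] U(2)]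
    by (rule differentiable_imp_continuous_within)
  then obtain d where d: "d > 0" "\<And>y. dist y x < d \<Longrightarrow> dist (?g y) (?g x) < e"
    using e unfolding continuous_at_eps_delta by blast
  obtain d' where d': "d' > 0" "ball x d' \<subseteq> U" using U openE by blast
  let ?d = "min d d' / 2"
  have "dist ((f (x + t *\<^sub>R ?a + t *\<^sub>R ?b) - f (x + t *\<^sub>R ?a) - f (x + t *\<^sub>R ?b) + f x) / t^2) (?g x) < e"
    if t: "0 < t" "t < ?d" for t
  proof -
    have near: "dist (x + s *\<^sub>R ?a + r *\<^sub>R ?b) x < min d d'" if "0 \<le> s" "s \<le> t" "0 \<le> r" "r \<le> t" for s r
    proof -
      have "x + s *\<^sub>R ?a + r *\<^sub>R ?b - x = s *\<^sub>R ?a + r *\<^sub>R ?b" by simp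
      then show ?thesis
        using norm_triangle_ineq[of "s *\<^sub>R ?a" "r *\<^sub>R ?b"] that t by (simp add: dist_norm)
    qed
    have inU: "x + s *\<^sub>R ?a + r *\<^sub>R ?b \<in> U" if "0 \<le> s" "s \<le> t" "0 \<le> r" "r \<le> t" for s r
      using near[OF that] d' by (auto simp: dist_commute)
    define F where "F = (\<lambda>y. f (y + t *\<^sub>R ?b) - f y)"
    have F: "F differentiable (at y)" "pv i F y = pv i f (y + t *\<^sub>R ?b) - pv i f y"
      if y: "y \<in> U" "y + t *\<^sub>R ?b \<in> U" for y
    proof -
      note D = smoothv_differentiable[OF f, THEN frechet_derivative_works[THEN iffD1]]
      have "((\<lambda>y. y + t *\<^sub>R ?b) has_derivative (\<lambda>h. h)) (at y)" by (auto intro!: derivative_eq_intros)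
      from has_derivative_diff[OF has_derivative_compose[OF this D[OF y(2)]] D[OF y(1)]]
      have "(F has_derivative (\<lambda>h. frechet_derivative f (at (y + t *\<^sub>R ?b)) h - frechet_derivative f (at y) h)) (at y)"
        by (simp add: F_def)
      from this pv_eqI[OF this, of i] show "F differentiable (at y)" "pv i F y = pv i f (y + t *\<^sub>R ?b) - pv i f y"
        by (auto simp: pv_def differentiable_def)
    qed
    have F': "F differentiable (at (x + s *\<^sub>R ?a))" if "0 \<le> s" "s \<le> t" for s
      using inU[of s 0] inU[of s t] that t by (intro F) auto
    obtain s where s: "0 < s" "s < t" "F (x + t *\<^sub>R ?a) - F x = t * pv i F (x + s *\<^sub>R ?a)"
      using real_mvt_path[OF t(1) F'] by blast
    have "pv i f differentiable (at (x + s *\<^sub>R ?a + r *\<^sub>R ?b))" if "0 \<le> r" "r \<le> t" for r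
      using inU[of s r] s that by (intro smoothv_differentiable[OF smoothv_pv[OF f]]) auto
    then obtain r where r: "0 < r" "r < t" "pv i f (x + s *\<^sub>R ?a + t *\<^sub>R ?b) - pv i f (x + s *\<^sub>R ?a)
        = t * ?g (x + s *\<^sub>R ?a + r *\<^sub>R ?b)"
      using real_mvt_path[OF t(1), of "pv i f" "x + s *\<^sub>R ?a" j] by blast
    have "pv i F (x + s *\<^sub>R ?a) = t * ?g (x + s *\<^sub>R ?a + r *\<^sub>R ?b)"
      using F(2)[of "x + s *\<^sub>R ?a"] inU[of s 0] inU[of s t] s t r(3) by simp
    then have "F (x + t *\<^sub>R ?a) - F x = ?g (x + s *\<^sub>R ?a + r *\<^sub>R ?b) * t^2"
      unfolding s(3) by (simp add: power2_eq_square)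
    moreover have "F (x + t *\<^sub>R ?a) - F x
        = f (x + t *\<^sub>R ?a + t *\<^sub>R ?b) - f (x + t *\<^sub>R ?a) - f (x + t *\<^sub>R ?b) + f x"
      by (simp add: F_def)
    ultimately have "f (x + t *\<^sub>R ?a + t *\<^sub>R ?b) - f (x + t *\<^sub>R ?a) - f (x + t *\<^sub>R ?b) + f x
        = ?g (x + s *\<^sub>R ?a + r *\<^sub>R ?b) * t^2" by (simp only:)
    then show ?thesis using d(2)[of "x + s *\<^sub>R ?a + r *\<^sub>R ?b"] near[of s r] s r t by simp
  qed
  moreover have "?d > 0" using d d' by simp
  ultimately show "eventually (\<lambda>t. dist ((f (x + t *\<^sub>R ?a + t *\<^sub>R ?b) - f (x + t *\<^sub>R ?a)
      - f (x + t *\<^sub>R ?b) + f x) / t^2) (?g x) < e) (at_right 0)"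
    unfolding eventually_at_right_field by blast
qed

lemma pv_commute_real:
  fixes f :: "real^'n::finite \<Rightarrow> real"
  assumes "open U" "x \<in> U" "smoothv U f"
  shows "pv i (pv j f) x = pv j (pv i f) x"
proof -
  let ?\<Delta> = "\<lambda>i j t. (f (x + t *\<^sub>R axis i 1 + t *\<^sub>R axis j 1) - f (x + t *\<^sub>R axis i 1)
      - f (x + t *\<^sub>R axis j 1) + f x) / t^2"
  have "?\<Delta> i j t = ?\<Delta> j i t" for t
  proof -
    have "x + t *\<^sub>R axis i 1 + t *\<^sub>R axis j 1 = x + t *\<^sub>R axis j 1 + t *\<^sub>R axis i 1" by (simp only: add_ac)
    moreover have "a - f (x + t *\<^sub>R axis i 1) - b = a - b - f (x + t *\<^sub>R axis i 1)" for a b by simp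
    ultimately show ?thesis by (simp only:)
  qed
  then have "?\<Delta> i j = ?\<Delta> j i" by (rule ext)
  then have "(?\<Delta> i j \<longlongrightarrow> pv i (pv j f) x) (at_right 0)"
    using second_difference_limit[OF assms, of j i] by (simp only:)
  then show ?thesis
    using tendsto_unique[OF trivial_limit_at_right_real] second_difference_limit[OF assms, of i j] by blast
qed

lemma pv_commute:
  fixes f :: "real^'n::finite \<Rightarrow> 'a::euclidean_space"
  assumes "open U" "x \<in> U" "smoothv U f"
  shows "pv i (pv j f) x = pv j (pv i f) x"
proof (rule euclidean_eqI)
  fix b :: 'a assume "b \<in> Basis"
  have L: "bounded_linear (\<lambda>v. v \<bullet> b)" by (rule bounded_linear_inner_left)
  have "pv i (pv j f) x \<bullet> b = pv i (pv j (\<lambda>x. f x \<bullet> b)) x" for i j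
  proof -
    have "pv i (pv j (\<lambda>x. f x \<bullet> b)) x = pv i (\<lambda>x. pv j f x \<bullet> b) x"
      using assms by (intro pv_cong[OF assms(1,2)] pv_linear[OF L] smoothv_differentiable)
    also have "\<dots> = pv i (pv j f) x \<bullet> b"
      using assms by (intro pv_linear[OF L] smoothv_differentiable[OF smoothv_pv])
    finally show ?thesis by simp
  qed
  then show "pv i (pv j f) x \<bullet> b = pv j (pv i f) x \<bullet> b"
    using pv_commute_real[OF assms(1,2) smoothv_linear[OF L assms(1,3)], of i j] by simp
qed

section \<open>The Frobenius theorem for flat linear systems\<close>

text \<open>An a priori estimate that replaces Gronwall's inequality: it can be applied to a function of
  several points at once, such as the error of a linear approximation.\<close>

lemma contraction_sup_bound:
  fixes \<phi> :: "'z \<Rightarrow> real"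
  assumes bdd: "\<And>z. z \<in> Z \<Longrightarrow> \<phi> z \<le> B" and c: "c < 1"
    and step: "\<And>\<sigma> z. (\<And>z. z \<in> Z \<Longrightarrow> \<phi> z \<le> \<sigma>) \<Longrightarrow> z \<in> Z \<Longrightarrow> \<phi> z \<le> q + c * \<sigma>"
    and z: "z \<in> Z"
  shows "\<phi> z \<le> q / (1 - c)"
proof -
  let ?\<sigma> = "Sup (\<phi> ` Z)"
  have bd: "bdd_above (\<phi> ` Z)" using bdd by (auto simp: bdd_above_def)
  have le: "\<phi> y \<le> ?\<sigma>" if "y \<in> Z" for y using bd that by (intro cSup_upper) auto
  have "?\<sigma> \<le> q + c * ?\<sigma>" using z step[OF le] by (intro cSup_least) auto
  then have "?\<sigma> \<le> q / (1 - c)" using c by (simp add: field_simps)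
  then show ?thesis using le[OF z] by linarith
qed

lemma continuous_bounded_on_cball:
  fixes h :: "'x::euclidean_space \<Rightarrow> 'z::real_normed_vector"
  assumes "continuous_on U h" "cball p R \<subseteq> U"
  shows "\<exists>M\<ge>0. \<forall>x\<in>cball p R. norm (h x) \<le> M"
proof -
  have "bounded (h ` cball p R)"
    using continuous_on_subset[OF assms] by (intro compact_imp_bounded compact_continuous_image) auto
  then obtain M where "\<forall>x\<in>cball p R. norm (h x) \<le> M" unfolding bounded_iff by auto
  then show ?thesis by (intro exI[of _ "max M 0"]) fastforce
qed

lemma smoothv_partials_bounded:
  assumes "smoothv U f" "cball p R \<subseteq> U"
  obtains M where "M \<ge> 0" "\<And>x. x \<in> cball p R \<Longrightarrow> norm (f x) \<le> M"
    "\<And>x v. x \<in> cball p R \<Longrightarrow> norm (\<Sum>k\<in>UNIV. v $ k *\<^sub>R pv k f x) \<le> M * norm v"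
proof -
  note bdd = continuous_bounded_on_cball[OF smoothv_continuous_on assms(2)]
  obtain M0 where M0: "M0 \<ge> 0" "\<forall>x\<in>cball p R. norm (f x) \<le> M0" using bdd[OF assms(1)] by blast
  have "\<exists>M. \<forall>k. M k \<ge> 0 \<and> (\<forall>x\<in>cball p R. norm (pv k f x) \<le> M k)"
    using bdd[OF smoothv_pv[OF assms(1)]] by (intro choice) blast
  then obtain M where M: "\<And>k. M k \<ge> 0" "\<And>k x. x \<in> cball p R \<Longrightarrow> norm (pv k f x) \<le> M k" by blast
  have "norm (\<Sum>k\<in>UNIV. v $ k *\<^sub>R pv k f x) \<le> (M0 + (\<Sum>k\<in>UNIV. M k)) * norm v" if "x \<in> cball p R" for x v
  proof -
    have "norm (\<Sum>k\<in>UNIV. v $ k *\<^sub>R pv k f x) \<le> (\<Sum>k\<in>UNIV. norm (v $ k *\<^sub>R pv k f x))" by (rule norm_sum)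
    also have "\<dots> \<le> (\<Sum>k\<in>UNIV. norm v * M k)"
      using M[of _ ] that component_le_norm_cart[of v]
      by (intro sum_mono) (auto intro!: mult_mono)
    also have "\<dots> = (\<Sum>k\<in>UNIV. M k) * norm v" by (simp add: sum_distrib_left mult.commute)
    also have "\<dots> \<le> (M0 + (\<Sum>k\<in>UNIV. M k)) * norm v" using M0 by (intro mult_right_mono) auto
    finally show ?thesis .
  qed
  moreover have "norm (f x) \<le> M0 + (\<Sum>k\<in>UNIV. M k)" if "x \<in> cball p R" for x
    using M0 that sum_nonneg[of UNIV M] M(1) by force
  ultimately show ?thesis using that[of "M0 + (\<Sum>k\<in>UNIV. M k)"] M0 M by (simp add: sum_nonneg)
qed

text \<open>One constant for the size, the Lipschitz and the second-order estimate, uniformly on a closed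
  ball.\<close>

lemma smoothv_taylor_bounds:
  assumes "smoothv U f" "cball p R \<subseteq> U"
  obtains L where "L \<ge> 0" "\<And>x. x \<in> cball p R \<Longrightarrow> norm (f x) \<le> L"
    "\<And>x y. x \<in> cball p R \<Longrightarrow> y \<in> cball p R \<Longrightarrow> norm (f y - f x) \<le> L * norm (y - x)"
    "\<And>x y. x \<in> cball p R \<Longrightarrow> y \<in> cball p R \<Longrightarrow>
       norm (f y - f x - (\<Sum>k\<in>UNIV. (y - x) $ k *\<^sub>R pv k f x)) \<le> L * (norm (y - x))^2"
proof -
  have lip: "\<exists>M\<ge>0. (\<forall>x\<in>cball p R. norm (h x) \<le> M) \<and>
      (\<forall>x\<in>cball p R. \<forall>y\<in>cball p R. norm (h y - h x) \<le> M * norm (y - x))"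
    if h: "smoothv U h" for h :: "real^'a \<Rightarrow> 'b"
  proof -
    obtain M where M: "M \<ge> 0" "\<And>x. x \<in> cball p R \<Longrightarrow> norm (h x) \<le> M"
      "\<And>x v. x \<in> cball p R \<Longrightarrow> norm (\<Sum>k\<in>UNIV. v $ k *\<^sub>R pv k h x) \<le> M * norm v"
      using smoothv_partials_bounded[OF h assms(2)] by blast
    have "norm (h y - h x) \<le> M * norm (y - x)" if "x \<in> cball p R" "y \<in> cball p R" for x y
    proof (rule differentiable_bound[OF convex_cball _ _ that(2,1)])
      fix z assume z: "z \<in> cball p R"
      show "(h has_derivative (\<lambda>v. \<Sum>k\<in>UNIV. v $ k *\<^sub>R pv k h z)) (at z within cball p R)"
        using has_derivative_pv[OF smoothv_differentiable[OF h]] z assms(2) has_derivative_at_withinI by blast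
      show "onorm (\<lambda>v. \<Sum>k\<in>UNIV. v $ k *\<^sub>R pv k h z) \<le> M"
        using M z by (intro onorm_le) auto
    qed
    then show ?thesis using M by blast
  qed
  obtain L0 where L0: "L0 \<ge> 0" "\<And>x. x\<in>cball p R \<Longrightarrow> norm (f x) \<le> L0"
      "\<And>x y. x\<in>cball p R \<Longrightarrow> y\<in>cball p R \<Longrightarrow> norm (f y - f x) \<le> L0 * norm (y - x)"
    using lip[OF assms(1)] by blast
  have "\<exists>L. \<forall>k. L k \<ge> 0 \<and> (\<forall>x\<in>cball p R. \<forall>y\<in>cball p R. norm (pv k f y - pv k f x) \<le> L k * norm (y - x))"
    using lip[OF smoothv_pv[OF assms(1)]] by (intro choice) blast
  then obtain L where L: "\<And>k. L k \<ge> 0"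
     "\<And>k x y. x\<in>cball p R \<Longrightarrow> y\<in>cball p R \<Longrightarrow> norm (pv k f y - pv k f x) \<le> L k * norm (y - x)" by blast
  let ?D = "\<lambda>z v. \<Sum>k\<in>UNIV. v $ k *\<^sub>R pv k f z"
  let ?L = "\<Sum>k\<in>UNIV. L k"
  have L': "?L \<ge> 0" using L by (simp add: sum_nonneg)
  have rem: "norm (f y - f x - ?D x (y - x)) \<le> ?L * (norm (y - x))^2"
    if xy: "x \<in> cball p R" "y \<in> cball p R" for x y
  proof -
    have seg: "x + t *\<^sub>R (y - x) \<in> cball p R" if "t \<in> {0..1}" for t
      using convexD_alt[OF convex_cball xy, of t] that by (simp add: algebra_simps)
    let ?S = "closed_segment x y"
    have sub: "?S \<subseteq> cball p R" using xy by (meson convex_cball convex_contains_segment)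
    have "norm (f y - f x - ?D x (y - x)) \<le> norm (y - x) * (?L * norm (y - x))"
    proof (rule differentiable_bound_linearization[where S="?S" and f' = ?D])
      show "x + t *\<^sub>R (y - x) \<in> ?S" if "t \<in> {0..1}" for t
        using that by (auto simp: in_segment algebra_simps intro!: exI[of _ t])
      show "(f has_derivative ?D z) (at z within ?S)" if "z \<in> ?S" for z
        using has_derivative_pv[OF smoothv_differentiable[OF assms(1)]] that sub assms(2)
          has_derivative_at_withinI by blast
      show "onorm (?D z - ?D x) \<le> ?L * norm (y - x)" if z: "z \<in> ?S" for z
      proof (rule onorm_le)
        fix v
        have zx: "norm (z - x) \<le> norm (y - x)" using segment_bound(1)[OF z] .
        have zc: "z \<in> cball p R" using z sub by blast
        have "norm ((?D z - ?D x) v) = norm (\<Sum>k\<in>UNIV. v $ k *\<^sub>R (pv k f z - pv k f x))"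
          by (simp add: sum_subtractf scaleR_diff_right)
        also have "\<dots> \<le> (\<Sum>k\<in>UNIV. norm (v $ k *\<^sub>R (pv k f z - pv k f x)))" by (rule norm_sum)
        also have "\<dots> \<le> (\<Sum>k\<in>UNIV. norm v * (L k * norm (y - x)))"
        proof (rule sum_mono)
          fix k
          have "norm (pv k f z - pv k f x) \<le> L k * norm (z - x)" using L(2)[OF xy(1) zc] .
          also have "\<dots> \<le> L k * norm (y - x)" using zx L(1) by (rule mult_left_mono)
          finally show "norm (v $ k *\<^sub>R (pv k f z - pv k f x)) \<le> norm v * (L k * norm (y - x))"
            using component_le_norm_cart[of v k] by (auto intro!: mult_mono)
        qed
        also have "\<dots> = ?L * norm (y - x) * norm v"
          by (simp add: sum_distrib_left sum_distrib_right mult_ac)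
        finally show "norm ((?D z - ?D x) v) \<le> ?L * norm (y - x) * norm v" .
      qed
      show "x \<in> ?S" by simp
    qed
    then show ?thesis by (simp add: power2_eq_square mult_ac)
  qed
  show ?thesis
  proof (rule that[of "L0 + ?L"])
    show "L0 + ?L \<ge> 0" using L0 L' by simp
    show "norm (f x) \<le> L0 + ?L" if "x \<in> cball p R" for x using L0(2)[OF that] L' by simp
    show "norm (f y - f x) \<le> (L0 + ?L) * norm (y - x)" if "x \<in> cball p R" "y \<in> cball p R" for x y
      using L0(3)[OF that] L' by (simp add: distrib_right add_increasing2)
    show "norm (f y - f x - ?D x (y - x)) \<le> (L0 + ?L) * (norm (y - x))^2"
      if "x \<in> cball p R" "y \<in> cball p R" for x y
      using rem[OF that] L0(1) by (simp add: distrib_right add_increasing)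
  qed
qed

text \<open>Uniqueness for homogeneous linear systems: on a small ball the derivative of the solution is
  so small compared with its supremum that a solution vanishing at the centre is bounded by half its
  supremum.\<close>

lemma linear_system_unique:
  fixes D :: "real^'n::finite \<Rightarrow> 'a::euclidean_space"
  assumes U: "open U" "p \<in> U" and d: "\<And>x. x \<in> U \<Longrightarrow> D differentiable (at x)"
    and m: "bounded_bilinear m" and A: "\<And>k. continuous_on U (A k)"
    and eq: "\<And>k x. x \<in> U \<Longrightarrow> pv k D x = m (A k x) (D x)" and D0: "D p = 0"
  shows "\<exists>r>0. ball p r \<subseteq> U \<and> (\<forall>x\<in>ball p r. D x = 0)"
proof -
  interpret bounded_bilinear m by fact
  obtain K where K: "K > 0" "\<And>a b. norm (m a b) \<le> norm a * norm b * K" using pos_bounded by blast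
  obtain R where R: "R > 0" "cball p R \<subseteq> U" using U open_contains_cball by blast
  note bdd = continuous_bounded_on_cball[OF _ R(2)]
  have "\<exists>M. \<forall>k. M k \<ge> 0 \<and> (\<forall>x\<in>cball p R. norm (A k x) \<le> M k)"
    using bdd[OF A] by (intro choice) blast
  then obtain M where M: "\<And>k. M k \<ge> 0" "\<And>k x. x \<in> cball p R \<Longrightarrow> norm (A k x) \<le> M k" by blast
  have "continuous_on U D"
    using d by (auto intro!: continuous_at_imp_continuous_on differentiable_imp_continuous_within)
  then obtain B where B: "\<forall>x\<in>cball p R. norm (D x) \<le> B" using bdd by blast
  define C where "C = (\<Sum>k\<in>UNIV. M k) * K + 1"
  have C: "C > 0" using M K by (auto simp: C_def sum_nonneg intro!: add_nonneg_pos)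
  define r where "r = min R (1 / (2 * C))"
  have r: "r > 0" "r \<le> R" "C * r \<le> 1/2"
    using R C unfolding r_def by (auto simp: min_def field_simps)
  have "norm (D x) \<le> 0 / (1 - 1/2)" if "x \<in> cball p r" for x
  proof (rule contraction_sup_bound[where Z = "cball p r" and B = B])
    show "norm (D x) \<le> B" if "x \<in> cball p r" for x using B r that by auto
    fix \<sigma> x assume le: "\<And>z. z \<in> cball p r \<Longrightarrow> norm (D z) \<le> \<sigma>" and x: "x \<in> cball p r"
    have \<sigma>: "\<sigma> \<ge> 0" using le[of p] r by (simp add: D0)
    have "norm (D x - D p) \<le> (C * \<sigma>) * norm (x - p)"
    proof (rule differentiable_bound[OF convex_cball _ _ x])
      fix z assume z: "z \<in> cball p r"
      then have z': "z \<in> cball p R" "z \<in> U" using r R by auto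
      show "(D has_derivative (\<lambda>v. \<Sum>k\<in>UNIV. v $ k *\<^sub>R pv k D z)) (at z within cball p r)"
        using has_derivative_pv[OF d[OF z'(2)]] has_derivative_at_withinI by blast
      show "onorm (\<lambda>v. \<Sum>k\<in>UNIV. v $ k *\<^sub>R pv k D z) \<le> C * \<sigma>"
      proof (rule onorm_le)
        fix v
        have "norm (\<Sum>k\<in>UNIV. v $ k *\<^sub>R pv k D z) \<le> (\<Sum>k\<in>UNIV. norm (v $ k *\<^sub>R pv k D z))" by (rule norm_sum)
        also have "\<dots> \<le> (\<Sum>k\<in>UNIV. norm v * (M k * \<sigma> * K))"
        proof (rule sum_mono)
          fix k
          have "norm (pv k D z) \<le> norm (A k z) * norm (D z) * K" using eq[OF z'(2)] K by simp
          also have "\<dots> \<le> M k * \<sigma> * K"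
            using M(1)[of k] M(2)[of z k] le[OF z] z' K \<sigma> by (intro mult_right_mono mult_mono) auto
          finally show "norm (v $ k *\<^sub>R pv k D z) \<le> norm v * (M k * \<sigma> * K)"
            using component_le_norm_cart[of v k] by (auto intro!: mult_mono)
        qed
        also have "\<dots> = (C - 1) * \<sigma> * norm v"
          by (simp add: C_def sum_distrib_left sum_distrib_right mult_ac)
        also have "\<dots> \<le> C * \<sigma> * norm v" using \<sigma> by (intro mult_right_mono) auto
        finally show "norm (\<Sum>k\<in>UNIV. v $ k *\<^sub>R pv k D z) \<le> C * \<sigma> * norm v" .
      qed
    qed (use r in simp)
    also have "\<dots> \<le> (C * \<sigma>) * r" using x C \<sigma> by (intro mult_left_mono) (auto simp: dist_norm norm_minus_commute)
    also have "\<dots> = (C * r) * \<sigma>" by simp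
    also have "\<dots> \<le> 1/2 * \<sigma>" using r \<sigma> by (intro mult_right_mono) auto
    finally show "norm (D x) \<le> 0 + 1/2 * \<sigma>" by (simp add: D0)
  qed (use that in simp_all)
  then have "\<forall>x\<in>ball p r. D x = 0" by (simp add: less_imp_le)
  moreover have "ball p r \<subseteq> U" using r R by auto
  ultimately show ?thesis using r by blast
qed

text \<open>A flat linear system \<open>\<partial>\<^sub>k u = A\<^sub>k u\<close> is first solved along the rays from \<open>p\<close>, as the fixed
  point of an integral operator that is a contraction on a small ball.  The solution is then shown
  to be differentiable with the right derivative at once: the error
  \<open>u(y) - u(x) - \<Sum>\<^sub>k (y - x)\<^sub>k A\<^sub>k(x) u(x)\<close> satisfies, by flatness, an integral inequality along
  the two rays to \<open>x\<close> and \<open>y\<close>, which bounds it by three quarters of its supremum plus a multiple of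
  \<open>|y - x|\<^sup>2\<close>.  In the following \<open>b x v w\<close> is the coefficient at \<open>x\<close> in direction \<open>v\<close> applied to \<open>w\<close>,
  \<open>c x e v w\<close> its derivative in direction \<open>e\<close>, and \<open>d N\<close> are the terms of the Picard series.\<close>

locale ray_system =
  fixes m :: "'b::euclidean_space \<Rightarrow> 'a::euclidean_space \<Rightarrow> 'a"
    and A :: "'n::finite \<Rightarrow> real^'n \<Rightarrow> 'b" and p :: "real^'n" and r C :: real and u0 :: 'a
  assumes m: "bounded_bilinear m" and r: "r > 0" and C: "C \<ge> 0" "C * r \<le> 1/2"
    and A: "\<And>k. continuous_on (cball p r) (A k)"
    and bound: "\<And>x v w. x \<in> cball p r \<Longrightarrow> norm (m (\<Sum>k\<in>UNIV. v $ k *\<^sub>R A k x) w) \<le> C * norm v * norm w"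
begin

definition b :: "real^'n \<Rightarrow> real^'n \<Rightarrow> 'a \<Rightarrow> 'a" where
  "b x v w = m (\<Sum>k\<in>UNIV. v $ k *\<^sub>R A k x) w"

definition ray :: "real^'n \<Rightarrow> real \<Rightarrow> real^'n" where
  "ray x s = p + s *\<^sub>R (x - p)"

primrec d :: "nat \<Rightarrow> real^'n \<Rightarrow> 'a" where
  "d 0 x = u0"
| "d (Suc N) x = integral (cbox 0 1) (\<lambda>s. b (ray x s) (x - p) (d N (ray x s)))"

definition u :: "real^'n \<Rightarrow> 'a" where
  "u x = (\<Sum>N. d N x)"

lemma ray_in: "x \<in> cball p r \<Longrightarrow> s \<in> cbox 0 1 \<Longrightarrow> ray x s \<in> cball p r"
proof -
  assume x: "x \<in> cball p r" and s: "s \<in> cbox 0 1"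
  have "\<bar>s\<bar> * norm (x - p) \<le> 1 * r"
    using x s r by (intro mult_mono) (auto simp: dist_norm norm_minus_commute)
  then show ?thesis by (simp add: ray_def dist_norm)
qed

lemma b_bound: "x \<in> cball p r \<Longrightarrow> norm (b x v w) \<le> C * norm v * norm w"
  using bound by (simp add: b_def)

lemma b_diff: "b x v (w - w') = b x v w - b x v w'"
  by (simp add: b_def bounded_bilinear.diff_right[OF m])

lemma b_scale: "b x (s *\<^sub>R v) w = s *\<^sub>R b x v w"
proof -
  have "(\<Sum>k\<in>UNIV. (s *\<^sub>R v) $ k *\<^sub>R A k x) = s *\<^sub>R (\<Sum>k\<in>UNIV. v $ k *\<^sub>R A k x)"
    by (simp add: scaleR_sum_right)
  then show ?thesis by (simp add: b_def bounded_bilinear.scaleR_left[OF m])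
qed

lemma b_add_dir: "b x (v + v') w = b x v w + b x v' w"
proof -
  have "(\<Sum>k\<in>UNIV. (v + v') $ k *\<^sub>R A k x) = (\<Sum>k\<in>UNIV. v $ k *\<^sub>R A k x) + (\<Sum>k\<in>UNIV. v' $ k *\<^sub>R A k x)"
    by (simp add: sum.distrib scaleR_left_distrib)
  then show ?thesis by (simp add: b_def bounded_bilinear.add_left[OF m])
qed

lemma b_sum: "b x v (\<Sum>i\<in>I. f i) = (\<Sum>i\<in>I. b x v (f i))"
  by (simp add: b_def bounded_bilinear.sum_right[OF m])

lemma continuous_integrand:
  assumes "continuous_on (cball p r) f"
  shows "continuous_on (cball p r \<times> cbox 0 1) (\<lambda>(x, s). b (ray x s) (x - p) (f (ray x s)))"
proof -
  have ray: "continuous_on (cball p r \<times> cbox 0 1) (\<lambda>z. ray (fst z) (snd z))"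
    unfolding ray_def by (intro continuous_intros)
  have im: "(\<lambda>z. ray (fst z) (snd z)) ` (cball p r \<times> cbox 0 1) \<subseteq> cball p r"
    using ray_in by fastforce
  have "continuous_on (cball p r \<times> cbox 0 1) (\<lambda>z. b (ray (fst z) (snd z)) (fst z - p) (f (ray (fst z) (snd z))))"
    unfolding b_def
    by (intro bounded_bilinear.continuous_on[OF m] continuous_on_sum continuous_on_scaleR
          continuous_on_component continuous_intros continuous_on_compose2[OF A ray im]
          continuous_on_compose2[OF assms ray im])
  then show ?thesis by (simp add: case_prod_beta)
qed

lemma continuous_integrand_ray:
  assumes "continuous_on (cball p r) f" "x \<in> cball p r"
  shows "continuous_on (cbox 0 1) (\<lambda>s. b (ray x s) v (f (ray x s)))"
proof -
  have ray: "continuous_on (cbox 0 1) (ray x)"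
    unfolding ray_def by (intro continuous_intros)
  have im: "ray x ` cbox 0 1 \<subseteq> cball p r"
    using ray_in assms(2) by fastforce
  show ?thesis unfolding b_def
    by (intro bounded_bilinear.continuous_on[OF m] continuous_on_sum continuous_on_scaleR
          continuous_intros continuous_on_compose2[OF A ray im]
          continuous_on_compose2[OF assms(1) ray im])
qed

lemma dist_p: "x \<in> cball p r \<Longrightarrow> norm (x - p) \<le> r"
  by (simp add: dist_norm norm_minus_commute)

lemma b_half: "x \<in> cball p r \<Longrightarrow> y \<in> cball p r \<Longrightarrow> norm (b y (x - p) w) \<le> norm w / 2"
proof -
  assume x: "x \<in> cball p r" and y: "y \<in> cball p r"
  have "norm (b y (x - p) w) \<le> C * norm (x - p) * norm w" by (rule b_bound[OF y])
  also have "\<dots> \<le> C * r * norm w" using dist_p[OF x] C by (intro mult_right_mono mult_left_mono) auto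
  also have "\<dots> \<le> 1/2 * norm w" using C by (intro mult_right_mono) auto
  finally show ?thesis by simp
qed

lemma d_continuous: "continuous_on (cball p r) (d N)"
proof (induction N)
  case 0 then show ?case by (simp add: continuous_on_const)
next
  case (Suc N)
  show ?case unfolding d.simps
    by (rule integral_continuous_on_param[OF continuous_integrand[OF Suc]])
qed

lemma d_bound: "x \<in> cball p r \<Longrightarrow> norm (d N x) \<le> norm u0 * (1/2)^N"
proof (induction N arbitrary: x)
  case (Suc N)
  have "norm (integral (cbox 0 1) (\<lambda>s. b (ray x s) (x - p) (d N (ray x s))))
      \<le> (norm u0 * (1/2)^N / 2) * measure lborel (cbox 0 (1::real))"
  proof (rule integrable_bound[OF _ integrable_continuous[OF continuous_integrand_ray[OF d_continuous Suc.prems]]])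
    show "norm (b (ray x s) (x - p) (d N (ray x s))) \<le> norm u0 * (1/2)^N / 2" if "s \<in> cbox 0 1" for s
      using order_trans[OF b_half[OF Suc.prems ray_in[OF Suc.prems that]]] Suc.IH[OF ray_in[OF Suc.prems that]]
      by (meson divide_right_mono zero_le_numeral)
  qed simp
  then show ?case by simp
qed simp

lemma u_uniform: "uniform_limit (cball p r) (\<lambda>N x. \<Sum>i<N. d i x) u sequentially"
  unfolding u_def
  by (rule Weierstrass_m_test[where M="\<lambda>N. norm u0 * (1/2)^N"])
    (auto intro!: summable_mult summable_geometric d_bound)

lemma u_continuous: "continuous_on (cball p r) u"
  by (rule uniform_limit_theorem[OF _ u_uniform])
    (auto intro!: always_eventually continuous_on_sum d_continuous)

lemma u_eq:
  assumes x: "x \<in> cball p r"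
  shows "u x = u0 + integral (cbox 0 1) (\<lambda>s. b (ray x s) (x - p) (u (ray x s)))"
proof -
  let ?S = "\<lambda>N x. \<Sum>i<N. d i x"
  let ?I = "integral (cbox 0 1) (\<lambda>s. b (ray x s) (x - p) (u (ray x s)))"
  have S: "?S (Suc N) x = u0 + integral (cbox 0 1) (\<lambda>s. b (ray x s) (x - p) (?S N (ray x s)))" for N
  proof -
    have "integral (cbox 0 1) (\<lambda>s. b (ray x s) (x - p) (?S N (ray x s)))
        = (\<Sum>i<N. integral (cbox 0 1) (\<lambda>s. b (ray x s) (x - p) (d i (ray x s))))"
      unfolding b_sum
      by (rule integral_sum) (auto intro!: integrable_continuous continuous_integrand_ray d_continuous x simp del: box_real cbox_interval)
    also have "\<dots> = (\<Sum>i<N. d (Suc i) x)" by simp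
    finally show ?thesis by (simp only: sum.lessThan_Suc_shift d.simps(1))
  qed
  have lim1: "(\<lambda>N. ?S (Suc N) x) \<longlonglongrightarrow> u x"
    using tendsto_uniform_limitI[OF u_uniform x] by (rule LIMSEQ_Suc)
  have lim2: "(\<lambda>N. u0 + integral (cbox 0 1) (\<lambda>s. b (ray x s) (x - p) (?S N (ray x s)))) \<longlonglongrightarrow> u0 + ?I"
  proof (intro tendsto_add tendsto_const LIMSEQ_I)
    fix e :: real assume e: "e > 0"
    from uniform_limitD[OF u_uniform e] obtain N0 where
      N0: "\<And>N y. N \<ge> N0 \<Longrightarrow> y \<in> cball p r \<Longrightarrow> dist (?S N y) (u y) < e"
      unfolding eventually_sequentially by blast
    show "\<exists>no. \<forall>N\<ge>no. norm (integral (cbox 0 1) (\<lambda>s. b (ray x s) (x - p) (?S N (ray x s))) - ?I) < e"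
    proof (intro exI[of _ N0] allI impI)
      fix N assume N: "N0 \<le> N"
      have Sc: "continuous_on (cball p r) (?S N)" by (intro continuous_on_sum d_continuous)
      have "norm (integral (cbox 0 1) (\<lambda>s. b (ray x s) (x - p) (?S N (ray x s)) - b (ray x s) (x - p) (u (ray x s))))
          \<le> (e / 2) * measure lborel (cbox 0 (1::real))"
      proof (rule integrable_bound)
        show "(\<lambda>s. b (ray x s) (x - p) (?S N (ray x s)) - b (ray x s) (x - p) (u (ray x s))) integrable_on cbox 0 1"
          by (intro integrable_diff integrable_continuous continuous_integrand_ray Sc u_continuous x)
        fix s :: real assume s: "s \<in> cbox 0 1"
        have "norm (b (ray x s) (x - p) (?S N (ray x s) - u (ray x s))) \<le> norm (?S N (ray x s) - u (ray x s)) / 2"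
          by (rule b_half[OF x ray_in[OF x s]])
        then show "norm (b (ray x s) (x - p) (?S N (ray x s)) - b (ray x s) (x - p) (u (ray x s))) \<le> e / 2"
          using N0[OF N ray_in[OF x s]] by (simp add: b_diff dist_norm)
      qed (use e in simp)
      moreover have "integral (cbox 0 1) (\<lambda>s. b (ray x s) (x - p) (?S N (ray x s)) - b (ray x s) (x - p) (u (ray x s)))
        = integral (cbox 0 1) (\<lambda>s. b (ray x s) (x - p) (?S N (ray x s))) - ?I"
        by (intro integral_diff integrable_continuous continuous_integrand_ray Sc u_continuous x)
      ultimately show "norm (integral (cbox 0 1) (\<lambda>s. b (ray x s) (x - p) (?S N (ray x s))) - ?I) < e"
        using e by simp
    qed
  qed
  show ?thesis
    by (rule LIMSEQ_unique[OF lim1]) (use lim2 S in simp)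
qed

lemma u_bound: "x \<in> cball p r \<Longrightarrow> norm (u x) \<le> 2 * norm u0"
proof -
  assume x: "x \<in> cball p r"
  have "norm (u x) \<le> (\<Sum>N. norm u0 * (1/2)^N)"
    unfolding u_def using d_bound[OF x] by (intro norm_suminf_le) (auto intro!: summable_mult summable_geometric)
  then show ?thesis by (simp add: suminf_mult suminf_geometric)
qed

lemma u_at_p: "u p = u0"
proof -
  have "b x 0 w = 0" for x w using b_scale[of x 0 0 w] by simp
  then show ?thesis using u_eq[of p] r by simp
qed

end

locale flat_ray_system = ray_system m A p r C u0
  for m :: "'b::euclidean_space \<Rightarrow> 'a::euclidean_space \<Rightarrow> 'a"
    and A :: "'n::finite \<Rightarrow> real^'n \<Rightarrow> 'b" and p :: "real^'n" and r C :: real and u0 :: 'a +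
  fixes U :: "(real^'n) set" and L :: real and c :: "real^'n \<Rightarrow> real^'n \<Rightarrow> real^'n \<Rightarrow> 'a \<Rightarrow> 'a"
  assumes U: "open U" "cball p r \<subseteq> U" and smooth: "\<And>k. smoothv U (A k)" and L: "L \<ge> 0"
    and c_def: "\<And>x e v w. c x e v w = m (\<Sum>k\<in>UNIV. v $ k *\<^sub>R (\<Sum>j\<in>UNIV. e $ j *\<^sub>R pv j (A k) x)) w"
    and lip: "\<And>x y v w. x \<in> cball p r \<Longrightarrow> y \<in> cball p r \<Longrightarrow>
      norm (b y v w - b x v w) \<le> L * norm (y - x) * norm v * norm w"
    and rem: "\<And>x y v w. x \<in> cball p r \<Longrightarrow> y \<in> cball p r \<Longrightarrow>
      norm (b y v w - b x v w - c x (y - x) v w) \<le> L * (norm (y - x))\<^sup>2 * norm v * norm w"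
    and flat: "\<And>x e v w. x \<in> cball p r \<Longrightarrow>
      c x e v w + b x v (b x e w) = c x v e w + b x e (b x v w)"
begin

lemma b_scale_arg: "b x v (s *\<^sub>R w) = s *\<^sub>R b x v w"
  by (simp add: b_def bounded_bilinear.scaleR_right[OF m])

lemma c_scale: "c x (s *\<^sub>R e) v w = s *\<^sub>R c x e v w"
proof -
  have "(\<Sum>k\<in>UNIV. v $ k *\<^sub>R (\<Sum>j\<in>UNIV. (s *\<^sub>R e) $ j *\<^sub>R pv j (A k) x))
     = s *\<^sub>R (\<Sum>k\<in>UNIV. v $ k *\<^sub>R (\<Sum>j\<in>UNIV. e $ j *\<^sub>R pv j (A k) x))"
    by (simp add: scaleR_sum_right mult_ac)
  then show ?thesis by (simp add: c_def bounded_bilinear.scaleR_left[OF m])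
qed

text \<open>The integral equation at the points of a ray says that \<open>u\<close> satisfies the system in the radial
  direction, because an initial piece of a ray is a ray.\<close>

lemma u_ray_derivative:
  assumes x: "x \<in> cball p r" and s: "s \<in> {0..1}"
  shows "((\<lambda>s. u (ray x s)) has_vector_derivative b (ray x s) (x - p) (u (ray x s))) (at s within {0..1})"
proof -
  define f where "f = (\<lambda>s. b (ray x s) (x - p) (u (ray x s)))"
  define F where "F = (\<lambda>s. integral {0..s} f)"
  have fc: "continuous_on {0..1} f"
    using continuous_integrand_ray[OF u_continuous x, of "x - p"] by (simp add: f_def)
  have F: "(F has_vector_derivative f s) (at s within {0..1})" if "s \<in> {0..1}" for s
    unfolding F_def by (rule integral_has_vector_derivative[OF fc that])
  have eq: "u (ray x s) = u0 + F s" if s: "s \<in> {0..1}" for s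
  proof -
    have y: "ray x s \<in> cball p r" using ray_in[OF x] s by simp
    have "((\<lambda>\<sigma>. s *\<^sub>R f (s * \<sigma>)) has_integral F (s * 1) - F (s * 0)) {0..1}"
    proof (rule fundamental_theorem_of_calculus)
      fix \<sigma> :: real assume sg: "\<sigma> \<in> {0..1}"
      have s\<sigma>: "s * \<sigma> \<in> {0..1}" using s sg by (auto intro: mult_le_one)
      have "((\<lambda>\<sigma>. s * \<sigma>) has_vector_derivative s) (at \<sigma> within {0..1})"
        by (auto intro!: derivative_eq_intros)
      moreover have "(F has_vector_derivative f (s * \<sigma>)) (at (s * \<sigma>) within (\<lambda>\<sigma>. s * \<sigma>) ` {0..1})"
        by (rule has_vector_derivative_within_subset[OF F[OF s\<sigma>]]) (use s in \<open>auto intro: mult_le_one\<close>)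
      ultimately show "((\<lambda>\<sigma>. F (s * \<sigma>)) has_vector_derivative s *\<^sub>R f (s * \<sigma>)) (at \<sigma> within {0..1})"
        using vector_diff_chain_within[of "\<lambda>\<sigma>. s * \<sigma>" s \<sigma> "{0..1}" F "f (s * \<sigma>)"] by (simp add: o_def)
    qed simp
    moreover have "s *\<^sub>R f (s * \<sigma>) = b (ray (ray x s) \<sigma>) (ray x s - p) (u (ray (ray x s) \<sigma>))" for \<sigma>
    proof -
      have "ray (ray x s) \<sigma> = ray x (s * \<sigma>)" by (simp add: ray_def mult.commute)
      moreover have "ray x s - p = s *\<^sub>R (x - p)" by (simp add: ray_def)
      ultimately show ?thesis by (simp add: f_def b_scale)
    qed
    ultimately have "((\<lambda>\<sigma>. b (ray (ray x s) \<sigma>) (ray x s - p) (u (ray (ray x s) \<sigma>))) has_integral F s) {0..1}"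
      by (simp add: F_def)
    then have "integral (cbox 0 1) (\<lambda>\<sigma>. b (ray (ray x s) \<sigma>) (ray x s - p) (u (ray (ray x s) \<sigma>))) = F s"
      by (simp add: integral_unique)
    then show ?thesis using u_eq[OF y] by simp
  qed
  have "((\<lambda>s. u0 + F s) has_vector_derivative f s) (at s within {0..1})"
    using F[OF s] by (auto intro!: derivative_eq_intros)
  then show ?thesis
    unfolding f_def[symmetric] using eq s
    by (rule_tac has_vector_derivative_transform[of s "{0..1}" _ "\<lambda>s. u0 + F s"]) (auto simp: f_def)
qed

text \<open>The expected derivative of \<open>u\<close> in any direction \<open>e\<close> as an integral along the ray, namely of the
  derivative of \<open>s b(ray\<^sub>s, e) u(ray\<^sub>s)\<close>.  It can thus be compared with the increment of \<open>u\<close>.\<close>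

lemma direction_as_ray_integral:
  assumes x: "x \<in> cball p r"
  shows "((\<lambda>s. b (ray x s) e (u (ray x s)) + s *\<^sub>R (c (ray x s) (x - p) e (u (ray x s))
     + b (ray x s) e (b (ray x s) (x - p) (u (ray x s))))) has_integral b x e (u x)) {0..1}"
proof -
  let ?a = "\<lambda>s. \<Sum>k\<in>UNIV. e $ k *\<^sub>R A k (ray x s)"
  let ?a' = "\<lambda>s. \<Sum>k\<in>UNIV. e $ k *\<^sub>R (\<Sum>j\<in>UNIV. (x - p) $ j *\<^sub>R pv j (A k) (ray x s))"
  have "((\<lambda>s. s *\<^sub>R m (?a s) (u (ray x s))) has_vector_derivative
      (s *\<^sub>R (m (?a s) (b (ray x s) (x - p) (u (ray x s))) + m (?a' s) (u (ray x s))) + 1 *\<^sub>R m (?a s) (u (ray x s)))) (at s within {0..1})"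
    if s: "s \<in> {0..1}" for s
  proof -
    have y: "ray x s \<in> U" using ray_in[OF x] s U by auto
    have "((\<lambda>s. A k (ray x s)) has_vector_derivative (\<Sum>j\<in>UNIV. (x - p) $ j *\<^sub>R pv j (A k) (ray x s))) (at s within {0..1})" for k
    proof -
      have "(ray x has_vector_derivative (x - p)) (at s within {0..1})"
        unfolding ray_def by (auto intro!: derivative_eq_intros)
      then have 1: "(ray x has_derivative (\<lambda>h. h *\<^sub>R (x - p))) (at s within {0..1})"
        by (simp add: has_vector_derivative_def)
      have "((\<lambda>s. A k (ray x s)) has_derivative (\<lambda>h. \<Sum>j\<in>UNIV. (h *\<^sub>R (x - p)) $ j *\<^sub>R pv j (A k) (ray x s))) (at s within {0..1})"
        by (rule has_derivative_compose[OF 1 has_derivative_pv[OF smoothv_differentiable[OF smooth y]]])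
      moreover have "(\<Sum>j\<in>UNIV. (h *\<^sub>R (x - p)) $ j *\<^sub>R pv j (A k) (ray x s)) = h *\<^sub>R (\<Sum>j\<in>UNIV. (x - p) $ j *\<^sub>R pv j (A k) (ray x s))" for h
        by (simp add: scaleR_sum_right)
      ultimately show ?thesis by (simp add: has_vector_derivative_def)
    qed
    then have "(?a has_vector_derivative ?a' s) (at s within {0..1})"
      by (intro has_vector_derivative_sum bounded_linear.has_vector_derivative[OF bounded_linear_scaleR_right])
    then have "((\<lambda>s. m (?a s) (u (ray x s))) has_vector_derivative
      (m (?a s) (b (ray x s) (x - p) (u (ray x s))) + m (?a' s) (u (ray x s)))) (at s within {0..1})"
      by (rule bounded_bilinear.has_vector_derivative[OF m _ u_ray_derivative[OF x s]])
    then show ?thesis by (rule has_vector_derivative_scaleR[OF DERIV_ident])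
  qed
  then have "((\<lambda>s. s *\<^sub>R (m (?a s) (b (ray x s) (x - p) (u (ray x s))) + m (?a' s) (u (ray x s))) + 1 *\<^sub>R m (?a s) (u (ray x s)))
     has_integral 1 *\<^sub>R m (?a 1) (u (ray x 1)) - 0 *\<^sub>R m (?a 0) (u (ray x 0))) {0..1}"
    by (intro fundamental_theorem_of_calculus) simp_all
  then have "((\<lambda>s. s *\<^sub>R (m (?a s) (b (ray x s) (x - p) (u (ray x s))) + m (?a' s) (u (ray x s))) + m (?a s) (u (ray x s)))
     has_integral m (?a 1) (u (ray x 1))) {0..1}" by simp
  moreover have "ray x 1 = x" by (simp add: ray_def)
  ultimately show ?thesis by (simp add: b_def c_def add_ac)
qed

lemma u_increment:
  assumes x: "x \<in> cball p r" and y: "y \<in> cball p r"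
  shows "((\<lambda>s. b (ray y s) (y - p) (u (ray y s)) - b (ray x s) (x - p) (u (ray x s))) has_integral u y - u x) {0..1}"
proof -
  have "((\<lambda>s. b (ray x s) (x - p) (u (ray x s))) has_integral u x - u0) {0..1}" if x: "x \<in> cball p r" for x
  proof -
    have "((\<lambda>s. b (ray x s) (x - p) (u (ray x s))) has_integral
       integral (cbox 0 1) (\<lambda>s. b (ray x s) (x - p) (u (ray x s)))) (cbox 0 1)"
      by (intro integrable_integral integrable_continuous continuous_integrand_ray u_continuous x)
    then show ?thesis using u_eq[OF x] by simp
  qed
  from has_integral_diff[OF this[OF y] this[OF x]] show ?thesis by simp
qed

lemma ray_diff: "ray y s - ray x s = s *\<^sub>R (y - x)"
  by (simp add: ray_def algebra_simps)

lemma norm_scale_le: "s \<in> {0..1} \<Longrightarrow> norm (v :: 'z::real_normed_vector) \<le> \<delta> \<Longrightarrow> norm (s *\<^sub>R v) \<le> \<delta>"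
proof -
  assume s: "s \<in> {0..1::real}" and v: "norm v \<le> \<delta>"
  have "\<bar>s\<bar> * norm v \<le> 1 * norm v" using s by (intro mult_right_mono) auto
  then show ?thesis using v by simp
qed

text \<open>The integrand of the error has five terms.  One of them is the error at the points of the two
  rays, with a factor at most one half; it is flatness that makes the terms of first order in
  \<open>y - x\<close> combine to it.  The others are of second order, once the increment of \<open>u\<close> is itself estimated
  by the error, which is possible for \<open>|y - x| \<le> \<epsilon>\<close> at the cost of another quarter.\<close>

lemma u_second_order:
  obtains K \<epsilon> where "\<epsilon> > 0" "\<And>x y. x \<in> cball p r \<Longrightarrow> y \<in> cball p r \<Longrightarrow> norm (y - x) \<le> \<epsilon> \<Longrightarrow>
    norm (u y - u x - b x (y - x) (u x)) \<le> K * (norm (y - x))\<^sup>2"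
proof -
  let ?B = "2 * norm u0"
  define \<epsilon> where "\<epsilon> = 1 / (4 * (C + L * r + 1))"
  have Lr: "C + L * r \<ge> 0" using C L r by simp
  then have \<epsilon>: "\<epsilon> > 0" "(C + L * r) * \<epsilon> \<le> 1/4" by (auto simp: \<epsilon>_def field_simps)
  define Q where "Q = C * C * ?B + L * ?B + L * r * ?B + L * r * C * ?B"
  have Q: "Q \<ge> 0" using C L r by (simp add: Q_def)
  have "norm (u y - u x - b x (y - x) (u x)) \<le> 4 * Q * (norm (y - x))\<^sup>2"
    if x: "x \<in> cball p r" and y: "y \<in> cball p r" and near: "norm (y - x) \<le> \<epsilon>" for x y
  proof -
    define \<delta> where "\<delta> = norm (y - x)"
    have \<delta>: "\<delta> \<ge> 0" "(C + L * r) * \<delta> \<le> 1/4"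
      using near \<epsilon>(2) mult_left_mono[OF near Lr] by (simp_all add: \<delta>_def)
    let ?Z = "{(x, y). x \<in> cball p r \<and> y \<in> cball p r \<and> norm (y - x) \<le> \<delta>}"
    let ?f = "\<lambda>(x, y). norm (u y - u x - b x (y - x) (u x))"
    have bx: "norm (b x (y - x) (u x)) \<le> C * \<delta> * ?B"
      if x: "x \<in> cball p r" and xy: "norm (y - x) \<le> \<delta>" for x y
      by (rule order_trans[OF b_bound[OF x]]) (use xy u_bound[OF x] C \<delta> in \<open>auto intro!: mult_mono\<close>)
    have "?f (x, y) \<le> Q * \<delta>\<^sup>2 / (1 - 3/4)"
    proof (rule contraction_sup_bound[where Z = ?Z and B = "?B + ?B + C * \<delta> * ?B" and \<phi> = ?f])
      show "?f z \<le> ?B + ?B + C * \<delta> * ?B" if "z \<in> ?Z" for z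
      proof -
        obtain x y where z_eq: "z = (x, y)" by (cases z)
        with that have x: "x \<in> cball p r" and y: "y \<in> cball p r" and xy: "norm (y - x) \<le> \<delta>" by auto
        show ?thesis
          using norm_triangle_ineq4[of "u y - u x" "b x (y - x) (u x)"] norm_triangle_ineq4[of "u y" "u x"]
            u_bound[OF x] u_bound[OF y] bx[OF x xy] by (simp add: z_eq)
      qed
      fix \<sigma> z assume le: "\<And>z. z \<in> ?Z \<Longrightarrow> ?f z \<le> \<sigma>" and z: "z \<in> ?Z"
      obtain x y where z_eq: "z = (x, y)" by (cases z)
      with z have x: "x \<in> cball p r" and y: "y \<in> cball p r" and xy: "norm (y - x) \<le> \<delta>" by auto
      let ?e = "y - x" and ?v = "x - p"
      have z0: "b x 0 w = 0" for x w using b_scale[of x 0 0 w] by simp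
      have \<sigma>: "\<sigma> \<ge> 0" using le[of "(x, x)"] x \<delta> by (simp add: z0)
      have "norm (u y - u x - b x ?e (u x)) \<le> (Q * \<delta>\<^sup>2 + 3/4 * \<sigma>) * measure lborel (cbox 0 (1::real))"
      proof (rule has_integral_bound[OF _ has_integral_diff[OF u_increment[OF x y]
              direction_as_ray_integral[OF x, of ?e], folded box_real(2)]])
        show "0 \<le> Q * \<delta>\<^sup>2 + 3/4 * \<sigma>" using Q \<sigma> by simp
        fix s :: real assume s': "s \<in> cbox 0 1"
        then have s: "s \<in> {0..1}" by simp
        let ?X = "ray x s" and ?Y = "ray y s"
        have X: "?X \<in> cball p r" and Y: "?Y \<in> cball p r" using ray_in x y s' by blast+
        have XY: "norm (?Y - ?X) \<le> \<delta>" unfolding ray_diff by (rule norm_scale_le[OF s xy])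
        have uXY: "norm (u ?Y - u ?X - b ?X (?Y - ?X) (u ?X)) \<le> \<sigma>" using le[of "(?X, ?Y)"] X Y XY by simp
        have ul: "norm (u ?Y - u ?X) \<le> \<sigma> + C * \<delta> * ?B"
          using norm_triangle_sub[of "u ?Y - u ?X" "b ?X (?Y - ?X) (u ?X)"] uXY bx[OF X XY] by linarith
        have e: "b ?Y (y - p) (u ?Y) = b ?Y ?v (u ?Y) + b ?Y ?e (u ?Y)"
          using b_add_dir[of ?Y ?v ?e] by simp
        have fl: "s *\<^sub>R (c ?X ?v ?e (u ?X) + b ?X ?e (b ?X ?v (u ?X)))
            = c ?X (?Y - ?X) ?v (u ?X) + b ?X ?v (b ?X (?Y - ?X) (u ?X))"
          unfolding ray_diff c_scale b_scale b_scale_arg scaleR_add_right[symmetric]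
          by (simp only: flat[OF X, of ?v ?e])
        have split: "b ?Y (y - p) (u ?Y) - b ?X ?v (u ?X) - (b ?X ?e (u ?X) +
             s *\<^sub>R (c ?X ?v ?e (u ?X) + b ?X ?e (b ?X ?v (u ?X))))
          = b ?Y ?e (u ?Y - u ?X) + (b ?Y ?e (u ?X) - b ?X ?e (u ?X))
            + b ?X ?v (u ?Y - u ?X - b ?X (?Y - ?X) (u ?X))
            + (b ?Y ?v (u ?X) - b ?X ?v (u ?X) - c ?X (?Y - ?X) ?v (u ?X))
            + (b ?Y ?v (u ?Y - u ?X) - b ?X ?v (u ?Y - u ?X))" (is "?l = _")
          unfolding e fl b_diff by simp
        have "norm ?l \<le> norm (b ?Y ?e (u ?Y - u ?X)) + norm (b ?Y ?e (u ?X) - b ?X ?e (u ?X))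
            + norm (b ?X ?v (u ?Y - u ?X - b ?X (?Y - ?X) (u ?X)))
            + norm (b ?Y ?v (u ?X) - b ?X ?v (u ?X) - c ?X (?Y - ?X) ?v (u ?X))
            + norm (b ?Y ?v (u ?Y - u ?X) - b ?X ?v (u ?Y - u ?X))"
          unfolding split by (rule order_trans[OF norm_triangle_ineq add_right_mono])+ (rule order_refl)
        also have "\<dots> \<le> C * \<delta> * (\<sigma> + C * \<delta> * ?B) + L * \<delta> * \<delta> * ?B + \<sigma> / 2 + L * \<delta>\<^sup>2 * r * ?B
            + L * \<delta> * r * (\<sigma> + C * \<delta> * ?B)"
        proof -
          have 1: "norm (b ?Y ?e (u ?Y - u ?X)) \<le> C * \<delta> * (\<sigma> + C * \<delta> * ?B)"
            by (rule order_trans[OF b_bound[OF Y]]) (use xy ul C \<delta> in \<open>auto intro!: mult_mono\<close>)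
          have 2: "norm (b ?Y ?e (u ?X) - b ?X ?e (u ?X)) \<le> L * \<delta> * \<delta> * ?B"
            by (rule order_trans[OF lip[OF X Y]]) (use XY xy u_bound[OF X] L \<delta> in \<open>auto intro!: mult_mono\<close>)
          have 3: "norm (b ?X ?v (u ?Y - u ?X - b ?X (?Y - ?X) (u ?X))) \<le> \<sigma> / 2"
            using b_half[OF x X, of "u ?Y - u ?X - b ?X (?Y - ?X) (u ?X)"] uXY by linarith
          have 4: "norm (b ?Y ?v (u ?X) - b ?X ?v (u ?X) - c ?X (?Y - ?X) ?v (u ?X)) \<le> L * \<delta>\<^sup>2 * r * ?B"
            by (rule order_trans[OF rem[OF X Y]])
              (use power_mono[OF XY, of 2] dist_p[OF x] u_bound[OF X] L \<delta> r in \<open>auto intro!: mult_mono\<close>)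
          have 5: "norm (b ?Y ?v (u ?Y - u ?X) - b ?X ?v (u ?Y - u ?X)) \<le> L * \<delta> * r * (\<sigma> + C * \<delta> * ?B)"
            by (rule order_trans[OF lip[OF X Y]]) (use XY ul dist_p[OF x] L \<delta> r in \<open>auto intro!: mult_mono\<close>)
          show ?thesis using 1 2 3 4 5 by (intro add_mono)
        qed
        also have "\<dots> = Q * \<delta>\<^sup>2 + \<sigma> / 2 + (C + L * r) * \<delta> * \<sigma>" by (simp add: Q_def algebra_simps power2_eq_square)
        also have "\<dots> \<le> Q * \<delta>\<^sup>2 + 3/4 * \<sigma>" using mult_right_mono[OF \<delta>(2) \<sigma>] by linarith
        finally show "norm ?l \<le> Q * \<delta>\<^sup>2 + 3/4 * \<sigma>" .
      qed
      then show "?f z \<le> Q * \<delta>\<^sup>2 + 3/4 * \<sigma>" by (simp add: z_eq)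
    qed (use x y in \<open>simp_all add: \<delta>_def\<close>)
    then show ?thesis by (simp add: \<delta>_def)
  qed
  then show ?thesis using that \<epsilon>(1) by blast
qed

lemma b_linear: "linear (\<lambda>v. b x v w)"
  by (rule linearI) (simp_all add: b_add_dir b_scale)

lemma u_has_derivative:
  assumes x: "x \<in> ball p r"
  shows "(u has_derivative (\<lambda>v. b x v (u x))) (at x)"
proof -
  obtain K \<epsilon> where K: "\<epsilon> > 0" "\<And>x y. x \<in> cball p r \<Longrightarrow> y \<in> cball p r \<Longrightarrow> norm (y - x) \<le> \<epsilon> \<Longrightarrow>
    norm (u y - u x - b x (y - x) (u x)) \<le> K * (norm (y - x))\<^sup>2"
    by (rule u_second_order) (rule that)
  have "((\<lambda>y. K * norm (y - x)) \<longlongrightarrow> K * norm (x - x)) (at x)" by (intro tendsto_intros)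
  then have lim: "((\<lambda>y. K * norm (y - x)) \<longlongrightarrow> 0) (at x)" by simp
  have "eventually (\<lambda>y. y \<in> ball p r \<inter> ball x \<epsilon>) (at x)"
    using x K(1) by (intro eventually_at_in_open') auto
  then have "eventually (\<lambda>y. norm (norm (u y - u x - b x (y - x) (u x)) / norm (y - x)) \<le> K * norm (y - x)) (at x)"
  proof eventually_elim
    case (elim y)
    then have "norm (y - x) \<le> \<epsilon>" by (simp add: dist_norm norm_minus_commute)
    then show ?case using K(2)[of x y] x elim
      by (cases "y = x") (auto simp: divide_le_eq power2_eq_square mult_ac)
  qed
  from Lim_null_comparison[OF this lim]
  show ?thesis unfolding has_derivative_iff_norm
    using b_linear by (simp add: linear_conv_bounded_linear)
qed

end

text \<open>The general statement.  The bilinear map \<open>m\<close> lets the coefficients act on the unknown in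
  whatever form they come: as matrices, or as plain factors.\<close>

theorem flat_linear_system_solvable:
  fixes m :: "'b::euclidean_space \<Rightarrow> 'a::euclidean_space \<Rightarrow> 'a" and A :: "'n::finite \<Rightarrow> real^'n \<Rightarrow> 'b"
  assumes m: "bounded_bilinear m" and U: "open U" "p \<in> U" and smooth: "\<And>k. smoothv U (A k)"
    and flat: "\<And>x j k w. x \<in> U \<Longrightarrow> m (pv j (A k) x) w + m (A k x) (m (A j x) w)
         = m (pv k (A j) x) w + m (A j x) (m (A k x) w)"
  shows "\<exists>r u. r > 0 \<and> ball p r \<subseteq> U \<and> u p = u0 \<and> smoothv (ball p r) u \<and>
     (\<forall>x\<in>ball p r. \<forall>k. pv k u x = m (A k x) (u x))"
proof -
  interpret m: bounded_bilinear m by fact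
  obtain K where K: "K > 0" "\<And>a b. norm (m a b) \<le> norm a * norm b * K" using m.pos_bounded by blast
  obtain R where R: "R > 0" "cball p R \<subseteq> U" using U open_contains_cball by blast
  define P where "P = (\<lambda>k l. l \<ge> 0 \<and> (\<forall>x\<in>cball p R. norm (A k x) \<le> l) \<and>
    (\<forall>x\<in>cball p R. \<forall>y\<in>cball p R. norm (A k y - A k x) \<le> l * norm (y - x)) \<and>
    (\<forall>x\<in>cball p R. \<forall>y\<in>cball p R.
       norm (A k y - A k x - (\<Sum>j\<in>UNIV. (y - x) $ j *\<^sub>R pv j (A k) x)) \<le> l * (norm (y - x))^2))"
  have "\<forall>k. \<exists>l. P k l"
  proof
    fix k
    obtain l where "l \<ge> 0" "\<And>x. x \<in> cball p R \<Longrightarrow> norm (A k x) \<le> l"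
    "\<And>x y. x \<in> cball p R \<Longrightarrow> y \<in> cball p R \<Longrightarrow> norm (A k y - A k x) \<le> l * norm (y - x)"
    "\<And>x y. x \<in> cball p R \<Longrightarrow> y \<in> cball p R \<Longrightarrow>
       norm (A k y - A k x - (\<Sum>j\<in>UNIV. (y - x) $ j *\<^sub>R pv j (A k) x)) \<le> l * (norm (y - x))^2"
      by (rule smoothv_taylor_bounds[OF smooth R(2)]) blast
    then have "P k l" unfolding P_def by blast
    then show "\<exists>l. P k l" ..
  qed
  from choice[OF this] obtain L where PL: "\<forall>k. P k (L k)" ..
  have L: "L k \<ge> 0" "x \<in> cball p R \<Longrightarrow> norm (A k x) \<le> L k"
    "x \<in> cball p R \<Longrightarrow> y \<in> cball p R \<Longrightarrow> norm (A k y - A k x) \<le> L k * norm (y - x)"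
    "x \<in> cball p R \<Longrightarrow> y \<in> cball p R \<Longrightarrow>
       norm (A k y - A k x - (\<Sum>j\<in>UNIV. (y - x) $ j *\<^sub>R pv j (A k) x)) \<le> L k * (norm (y - x))^2" for k x y
    using spec[OF PL, of k] unfolding P_def by blast+
  define C where "C = (\<Sum>k\<in>UNIV. L k) * K"
  have CC: "C \<ge> 0" using L K by (simp add: C_def sum_nonneg)
  have combine: "norm (m (\<Sum>k\<in>UNIV. v $ k *\<^sub>R f k) w) \<le> C * q * norm v * norm w"
    if f: "\<And>k. norm (f k) \<le> L k * q" and q: "q \<ge> 0" for f :: "'n \<Rightarrow> 'b" and v :: "real^'n" and w q
  proof -
    have "norm (\<Sum>k\<in>UNIV. v $ k *\<^sub>R f k) \<le> (\<Sum>k\<in>UNIV. norm (v $ k *\<^sub>R f k))" by (rule norm_sum)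
    also have "\<dots> \<le> (\<Sum>k\<in>UNIV. norm v * (L k * q))"
      using f component_le_norm_cart[of v] by (intro sum_mono) (auto intro!: mult_mono)
    also have "\<dots> = (\<Sum>k\<in>UNIV. L k) * q * norm v" by (simp add: sum_distrib_left sum_distrib_right mult_ac)
    finally have "norm (\<Sum>k\<in>UNIV. v $ k *\<^sub>R f k) * norm w * K \<le> (\<Sum>k\<in>UNIV. L k) * q * norm v * norm w * K"
      using K by (intro mult_right_mono) auto
    then show ?thesis using K(2)[of "\<Sum>k\<in>UNIV. v $ k *\<^sub>R f k" w] by (simp add: C_def mult_ac)
  qed
  define r where "r = min R (1 / (2 * (C + 1)))"
  have rr: "r > 0" "r \<le> R" using R CC unfolding r_def by auto
  have "C * r \<le> C * (1 / (2 * (C + 1)))" using CC by (intro mult_left_mono) (auto simp: r_def)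
  also have "\<dots> \<le> 1/2" using CC by (simp add: field_simps)
  finally have rC: "C * r \<le> 1/2" .
  have rU: "cball p r \<subseteq> U" using rr R by auto
  interpret ray_system m A p r C u0
  proof
    show "continuous_on (cball p r) (A k)" for k
      using smoothv_continuous_on[OF smooth] rU continuous_on_subset by blast
    show "norm (m (\<Sum>k\<in>UNIV. v $ k *\<^sub>R A k x) w) \<le> C * norm v * norm w" if "x \<in> cball p r" for x v w
      using combine[of "\<lambda>k. A k x" 1 v w] L(2)[of x] that rr by simp
  qed (use rr CC rC in auto)
  let ?c = "\<lambda>x e v w. m (\<Sum>k\<in>UNIV. v $ k *\<^sub>R (\<Sum>j\<in>UNIV. e $ j *\<^sub>R pv j (A k) x)) w"
  interpret flat_ray_system m A p r C u0 U C ?c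
  proof
    show "norm (b y v w - b x v w) \<le> C * norm (y - x) * norm v * norm w"
      if "x \<in> cball p r" "y \<in> cball p r" for x y v w
      using combine[of "\<lambda>k. A k y - A k x" "norm (y - x)" v w] L(3)[of x y] that rr
      by (simp add: b_def m.diff_left[symmetric] sum_subtractf[symmetric] scaleR_diff_right[symmetric]
          del: scaleR_diff_right)
    show "norm (b y v w - b x v w - ?c x (y - x) v w) \<le> C * (norm (y - x))\<^sup>2 * norm v * norm w"
      if "x \<in> cball p r" "y \<in> cball p r" for x y v w
      using combine[of "\<lambda>k. A k y - A k x - (\<Sum>j\<in>UNIV. (y - x) $ j *\<^sub>R pv j (A k) x)" "(norm (y - x))^2" v w]
        L(4)[of x y] that rr
      by (simp add: b_def m.diff_left[symmetric] sum_subtractf[symmetric] scaleR_diff_right[symmetric]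
          del: scaleR_diff_right)
    fix x e v w assume x: "x \<in> cball p r"
    have expand: "?c x e v w + b x v (b x e w)
        = (\<Sum>k\<in>UNIV. \<Sum>j\<in>UNIV. (v $ k * e $ j) *\<^sub>R (m (pv j (A k) x) w + m (A k x) (m (A j x) w)))" for e v
    proof -
      have "?c x e v w = (\<Sum>k\<in>UNIV. \<Sum>j\<in>UNIV. (v $ k * e $ j) *\<^sub>R m (pv j (A k) x) w)"
        by (simp add: m.sum_left m.scaleR_left scaleR_sum_right)
      moreover have "b x v (b x e w) = (\<Sum>k\<in>UNIV. v $ k *\<^sub>R m (A k x) (\<Sum>j\<in>UNIV. e $ j *\<^sub>R m (A j x) w))"
        by (simp only: b_def m.sum_left m.scaleR_left)
      ultimately show ?thesis
        by (simp add: m.sum_right m.scaleR_right scaleR_sum_right sum.distrib scaleR_add_right)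
    qed
    have "?c x e v w + b x v (b x e w)
       = (\<Sum>j\<in>UNIV. \<Sum>k\<in>UNIV. (v $ k * e $ j) *\<^sub>R (m (pv j (A k) x) w + m (A k x) (m (A j x) w)))"
      unfolding expand by (rule sum.swap)
    also have "\<dots> = (\<Sum>j\<in>UNIV. \<Sum>k\<in>UNIV. (e $ j * v $ k) *\<^sub>R (m (pv k (A j) x) w + m (A j x) (m (A k x) w)))"
      using flat[of x] x rU by (intro sum.cong refl) (auto simp: mult.commute)
    also have "\<dots> = ?c x v e w + b x e (b x v w)" unfolding expand ..
    finally show "?c x e v w + b x v (b x e w) = ?c x v e w + b x e (b x v w)" .
  qed (use U rU smooth CC in auto)
  have d: "(u has_derivative (\<lambda>v. \<Sum>k\<in>UNIV. v $ k *\<^sub>R m (A k x) (u x))) (at x)" if "x \<in> ball p r" for x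
    using u_has_derivative[OF that] by (simp add: b_def m.sum_left m.scaleR_left)
  have p: "pv k u x = m (A k x) (u x)" if "x \<in> ball p r" for x k
    by (rule has_derivative_partials_pv[OF d[OF that]])
  have sub: "ball p r \<subseteq> U" using rU by auto
  have "smoothv (ball p r) u"
    by (rule smoothv_bootstrap_bilinear[OF open_ball m])
      (use d p differentiable_def smoothv_subset[OF smooth sub] in blast)+
  then show ?thesis using rr sub p u_at_p by blast
qed

text \<open>The Poincare lemma: a second factor \<open>real\<close> that stays constant makes the equation
  \<open>\<partial>\<^sub>k t = \<theta>\<^sub>k\<close> homogeneous.\<close>

lemma poincare:
  fixes \<theta> :: "'n::finite \<Rightarrow> real^'n \<Rightarrow> 'b::euclidean_space"
  assumes U: "open U" "p \<in> U" and smooth: "\<And>k. smoothv U (\<theta> k)"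
    and closed: "\<And>x j k. x \<in> U \<Longrightarrow> pv j (\<theta> k) x = pv k (\<theta> j) x"
  shows "\<exists>r t. r > 0 \<and> ball p r \<subseteq> U \<and> t p = t0 \<and> smoothv (ball p r) t \<and>
     (\<forall>x\<in>ball p r. \<forall>k. pv k t x = \<theta> k x)"
proof -
  define m :: "'b \<Rightarrow> 'b \<times> real \<Rightarrow> 'b \<times> real" where "m = (\<lambda>a z. (snd z *\<^sub>R a, 0))"
  have bil: "bounded_bilinear m"
    unfolding m_def bilinear_conv_bounded_bilinear[symmetric] bilinear_def
    by (auto intro!: linearI simp: scaleR_left_distrib scaleR_right_distrib)
  obtain r u where ru: "r > 0" "ball p r \<subseteq> U" "u p = (t0, 1)" "smoothv (ball p r) u"
     "\<And>x k. x \<in> ball p r \<Longrightarrow> pv k u x = m (\<theta> k x) (u x)"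
    using flat_linear_system_solvable[OF bil U, where A = \<theta> and ?u0.0 = "(t0, 1)"] smooth closed
    by (auto simp: m_def)
  have diff: "u differentiable (at x)" if "x \<in> ball p r" for x using ru(4) that smoothv_differentiable by blast
  have diff1: "(\<lambda>x. snd (u x) - 1) differentiable (at x)" if "x \<in> ball p r" for x
    using diff[OF that] by (intro differentiable_diff differentiable_linear[OF bounded_linear_snd] differentiable_const)
  have s0: "pv k (\<lambda>x. snd (u x) - 1) x = (0::real) * (snd (u x) - 1)" if "x \<in> ball p r" for x k
  proof -
    have "pv k (\<lambda>x. snd (u x)) x = snd (pv k u x)"
      by (rule pv_linear[OF bounded_linear_snd diff[OF that]])
    then have "pv k (\<lambda>x. snd (u x)) x = 0" using ru(5)[OF that] by (simp add: m_def)
    moreover have "(\<lambda>x. snd (u x)) differentiable (at x)" by (rule differentiable_linear[OF bounded_linear_snd diff[OF that]])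
    ultimately show ?thesis using pv_add[of "\<lambda>x. snd (u x)" x "\<lambda>x. -1" k] by simp
  qed
  obtain r' where r': "r' > 0" "ball p r' \<subseteq> ball p r" "\<And>x. x \<in> ball p r' \<Longrightarrow> snd (u x) - 1 = 0"
  proof -
    have "p \<in> ball p r" "snd (u p) - 1 = 0" using ru by auto
    from linear_system_unique[OF open_ball this(1) diff1 bounded_bilinear_mult continuous_on_const s0 this(2)]
    show ?thesis using that by blast
  qed
  have "pv k (\<lambda>x. fst (u x)) x = \<theta> k x" if "x \<in> ball p r'" for x k
  proof -
    have x: "x \<in> ball p r" using that r' by blast
    have "pv k (\<lambda>x. fst (u x)) x = fst (pv k u x)"
      by (rule pv_linear[OF bounded_linear_fst diff[OF x]])
    then show ?thesis using ru(5)[OF x] r'(3)[OF that] by (simp add: m_def)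
  qed
  moreover have "smoothv (ball p r') (\<lambda>x. fst (u x))"
    by (rule smoothv_linear[OF bounded_linear_fst open_ball smoothv_subset[OF ru(4) r'(2)]])
  ultimately show ?thesis using r' ru by (intro exI[of _ r'] exI[of _ "\<lambda>x. fst (u x)"]) auto
qed

section \<open>Levi-Civita calculus in a chart\<close>

lemma smoothv_axis:
  fixes f :: "real^'m::finite \<Rightarrow> ('a::euclidean_space)^'n::finite"
  assumes "open U" "\<And>i. smoothv U (\<lambda>x. f x $ i)"
  shows "smoothv U f"
proof -
  have "f x = (\<Sum>i\<in>UNIV. axis i (f x $ i))" for x
    by (simp add: vec_eq_iff axis_def if_distrib [of "\<lambda>z. z $ _"] cong: if_cong)
  moreover have "linear (axis i :: 'a \<Rightarrow> 'a^'n)" for i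
    by (rule linearI) (simp_all add: axis_def vec_eq_iff)
  then have "smoothv U (\<lambda>x. \<Sum>i\<in>UNIV. axis i (f x $ i))"
    by (intro smoothv_sum assms(1) smoothv_linear[where L="axis _"] assms(2)) (simp add: linear_conv_bounded_linear)
  ultimately show ?thesis by simp
qed

lemma smoothv_component: "open U \<Longrightarrow> smoothv U f \<Longrightarrow> smoothv U (\<lambda>x. f x $ i)"
  by (rule smoothv_linear[OF bounded_linear_vec_nth])

lemma pv_component: "f differentiable (at x) \<Longrightarrow> pv k (\<lambda>x. f x $ i) x = pv k f x $ i"
  by (rule pv_linear[OF bounded_linear_vec_nth])

lemma matrix_mult_bilinear: "bounded_bilinear ((**) :: real^'n^'n::finite \<Rightarrow> real^'n^'n \<Rightarrow> real^'n^'n)"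
  unfolding bilinear_conv_bounded_bilinear[symmetric] bilinear_def
  by (auto intro!: linearI simp: matrix_matrix_mult_def vec_eq_iff sum_distrib_left sum.distrib algebra_simps)

lemma pv_mult:
  fixes f g :: "real^'n::finite \<Rightarrow> real"
  shows "f differentiable (at x) \<Longrightarrow> g differentiable (at x) \<Longrightarrow>
    pv k (\<lambda>x. f x * g x) x = pv k f x * g x + f x * pv k g x"
  by (rule pv_bilinear[OF bounded_bilinear_mult])

lemma pv_minus: "f differentiable (at x) \<Longrightarrow> pv k (\<lambda>x. - f x) x = - pv k f x"
  by (rule pv_linear[OF bounded_linear_minus[OF bounded_linear_ident]])

lemma pv_diff: "f differentiable (at x) \<Longrightarrow> g differentiable (at x) \<Longrightarrow>
   pv k (\<lambda>x. f x - g x) x = pv k f x - pv k g x"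
  using pv_add[of f x "\<lambda>x. - g x" k] by (simp add: pv_minus)

lemma differentiable_sum_UNIV:
  fixes f :: "'i::finite \<Rightarrow> 'x::real_normed_vector \<Rightarrow> 'a::real_normed_vector"
  shows "(\<And>i. f i differentiable (at x)) \<Longrightarrow> (\<lambda>x. \<Sum>i\<in>UNIV. f i x) differentiable (at x)"
  by (rule differentiable_sum) auto

lemma pv_sum:
  fixes f :: "'i::finite \<Rightarrow> real^'n::finite \<Rightarrow> 'a::real_normed_vector"
  assumes "\<And>i. f i differentiable (at x)"
  shows "pv k (\<lambda>x. \<Sum>i\<in>UNIV. f i x) x = (\<Sum>i\<in>UNIV. pv k (f i) x)"
proof -
  have "((\<lambda>x. \<Sum>i\<in>UNIV. f i x) has_derivative (\<lambda>h. \<Sum>i\<in>UNIV. frechet_derivative (f i) (at x) h)) (at x)"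
    using assms by (intro has_derivative_sum) (simp add: frechet_derivative_works[symmetric])
  from pv_eqI[OF this] show ?thesis by (simp add: pv_def)
qed

lemma smoothv_sum_UNIV:
  fixes f :: "'i::finite \<Rightarrow> real^'n::finite \<Rightarrow> 'a::real_normed_vector"
  assumes "open U" "\<And>i. smoothv U (f i)" shows "smoothv U (\<lambda>x. \<Sum>i\<in>UNIV. f i x)"
  using assms by (intro smoothv_sum) auto

lemma covD_1: "covD h T x [l, i] = pv l (\<lambda>y. T y [i]) x - (\<Sum>a\<in>UNIV. christoffel h x a l i * T x [a])"
  by (simp add: covD_def pd_eq_pv)

lemma covD_2: "covD h T x [l, i, j] = pv l (\<lambda>y. T y [i, j]) x
    - (\<Sum>a\<in>UNIV. christoffel h x a l i * T x [a, j]) - (\<Sum>a\<in>UNIV. christoffel h x a l j * T x [i, a])"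
  by (simp add: covD_def pd_eq_pv lessThan_Suc numeral_2_eq_2)

lemma covD_3: "covD h T x [l, i, j, k] = pv l (\<lambda>y. T y [i, j, k]) x
    - (\<Sum>a\<in>UNIV. christoffel h x a l i * T x [a, j, k]) - (\<Sum>a\<in>UNIV. christoffel h x a l j * T x [i, a, k])
    - (\<Sum>a\<in>UNIV. christoffel h x a l k * T x [i, j, a])"
  by (simp add: covD_def pd_eq_pv lessThan_Suc eval_nat_numeral)

lemma covD_4: "covD h T x [m, l, i, j, k] = pv m (\<lambda>y. T y [l, i, j, k]) x
    - (\<Sum>a\<in>UNIV. christoffel h x a m l * T x [a, i, j, k])
    - (\<Sum>a\<in>UNIV. christoffel h x a m i * T x [l, a, j, k]) - (\<Sum>a\<in>UNIV. christoffel h x a m j * T x [l, i, a, k])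
    - (\<Sum>a\<in>UNIV. christoffel h x a m k * T x [l, i, j, a])"
  by (simp add: covD_def pd_eq_pv lessThan_Suc eval_nat_numeral)

lemma sum_delta:
  fixes i :: "'n::finite" and f :: "'n \<Rightarrow> real"
  shows "(\<Sum>a\<in>UNIV. (if i = a then 1 else 0) * f a) = f i" "(\<Sum>a\<in>UNIV. (if a = i then 1 else 0) * f a) = f i"
    "(\<Sum>a\<in>UNIV. f a * (if i = a then 1 else 0)) = f i" "(\<Sum>a\<in>UNIV. f a * (if a = i then 1 else 0)) = f i"
  by (simp_all add: if_distrib[of "\<lambda>z. z * _"] if_distrib[of "\<lambda>z. _ * z"] cong: if_cong)

locale nondegenerate_form =
  fixes \<gamma> :: "real^'n::finite^'n"
  assumes \<gamma>_transpose: "transpose \<gamma> = \<gamma>" and \<gamma>_invertible: "invertible \<gamma>"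
begin

lemma \<gamma>_sym: "\<gamma> $ i $ j = \<gamma> $ j $ i"
  using arg_cong[OF \<gamma>_transpose, of "\<lambda>M. M $ j $ i"] by (simp add: transpose_def)

lemma ginv_mult: "\<gamma> ** matrix_inv \<gamma> = mat 1" "matrix_inv \<gamma> ** \<gamma> = mat 1"
proof -
  have "\<exists>B. \<gamma> ** B = mat 1 \<and> B ** \<gamma> = mat 1" using \<gamma>_invertible by (simp add: invertible_def)
  from someI_ex[OF this] show "\<gamma> ** matrix_inv \<gamma> = mat 1" "matrix_inv \<gamma> ** \<gamma> = mat 1"
    by (auto simp: matrix_inv_def)
qed

lemma ginv_transpose: "transpose (matrix_inv \<gamma>) = matrix_inv \<gamma>"
proof -
  have "transpose (matrix_inv \<gamma>) ** \<gamma> = mat 1"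
    using arg_cong[OF ginv_mult(1), of transpose] by (simp add: matrix_transpose_mul \<gamma>_transpose transpose_mat)
  then have "transpose (matrix_inv \<gamma>) ** (\<gamma> ** matrix_inv \<gamma>) = matrix_inv \<gamma>"
    by (simp add: matrix_mul_assoc)
  then show ?thesis by (simp add: ginv_mult)
qed

lemma ginv_sym: "ginv \<gamma> i j = ginv \<gamma> j i"
  using arg_cong[OF ginv_transpose, of "\<lambda>M. M $ j $ i"] by (simp add: transpose_def)

lemma ginv_right: "(\<Sum>a\<in>UNIV. \<gamma> $ i $ a * ginv \<gamma> a j) = (if i = j then 1 else 0)"
  using arg_cong[OF ginv_mult(1), of "\<lambda>M. M $ i $ j"] by (simp add: matrix_matrix_mult_def mat_def)

lemma ginv_left: "(\<Sum>a\<in>UNIV. ginv \<gamma> i a * \<gamma> $ a $ j) = (if i = j then 1 else 0)"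
  using arg_cong[OF ginv_mult(2), of "\<lambda>M. M $ i $ j"] by (simp add: matrix_matrix_mult_def mat_def)

end

locale chart_metric =
  fixes h :: "real^'n::finite \<Rightarrow> real^'n^'n" and U :: "(real^'n) set"
  assumes U: "open U" and h_smooth: "\<And>i j. smoothv U (\<lambda>x. h x $ i $ j)"
    and h_form: "\<And>x. x \<in> U \<Longrightarrow> nondegenerate_form (h x)"
begin

abbreviation "\<Gamma> x \<equiv> christoffel h x"

lemma h_sym: "x \<in> U \<Longrightarrow> h x $ i $ j = h x $ j $ i"
  using nondegenerate_form.\<gamma>_sym[OF h_form] .

lemma h_matrix_smooth: "smoothv U h"
  by (intro smoothv_axis U h_smooth)

lemma ginv_matrix:
  shows "smoothv U (\<lambda>x. matrix_inv (h x))"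
    and "x \<in> U \<Longrightarrow> pv k (\<lambda>x. matrix_inv (h x)) x = - (matrix_inv (h x) ** pv k h x ** matrix_inv (h x))"
  using smoothv_algebra_inverse[OF matrix_mult_bilinear _ _ _ U _ _ h_matrix_smooth, of "mat 1" "\<lambda>x. matrix_inv (h x)"]
    nondegenerate_form.ginv_mult[OF h_form] by (auto simp: matrix_mul_assoc)

lemma ginv_smooth: "smoothv U (\<lambda>x. ginv (h x) i j)"
  by (intro smoothv_component U ginv_matrix)

lemma pd_h_smooth: "smoothv U (\<lambda>x. pd k (\<lambda>y. h y $ i $ j) x)"
  unfolding pd_eq_pv by (rule smoothv_pv[OF h_smooth])

lemma christoffel_smooth: "smoothv U (\<lambda>x. \<Gamma> x m i j)"
proof -
  have "smoothv U (\<lambda>x. 1/2 * (\<Sum>a\<in>UNIV. ginv (h x) m a *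
     (pd i (\<lambda>y. h y $ a $ j) x + pd j (\<lambda>y. h y $ a $ i) x - pd a (\<lambda>y. h y $ i $ j) x)))"
    by (intro smoothv_cmult smoothv_sum_UNIV smoothv_mult smoothv_diff smoothv_add pd_h_smooth ginv_smooth U)
  then show ?thesis by (simp add: christoffel_def)
qed

lemma pd_h_sym: "x \<in> U \<Longrightarrow> pd k (\<lambda>y. h y $ i $ j) x = pd k (\<lambda>y. h y $ j $ i) x"
  unfolding pd_eq_pv by (rule pv_cong[OF U _ h_sym])

lemma christoffel_sym: "x \<in> U \<Longrightarrow> \<Gamma> x m i j = \<Gamma> x m j i"
  unfolding christoffel_def using pd_h_sym[of x _ i j] by (simp add: add.commute)

lemma christoffel_lower:
  assumes "x \<in> U"
  shows "(\<Sum>m\<in>UNIV. h x $ a $ m * \<Gamma> x m i j) =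
    (pv i (\<lambda>y. h y $ a $ j) x + pv j (\<lambda>y. h y $ a $ i) x - pv a (\<lambda>y. h y $ i $ j) x) / 2"
proof -
  interpret nondegenerate_form "h x" by (rule h_form[OF assms])
  define f where "f = (\<lambda>a. pv i (\<lambda>y. h y $ a $ j) x + pv j (\<lambda>y. h y $ a $ i) x - pv a (\<lambda>y. h y $ i $ j) x)"
  have "(\<Sum>m\<in>UNIV. h x $ a $ m * \<Gamma> x m i j) = (\<Sum>m\<in>UNIV. \<Sum>b\<in>UNIV. h x $ a $ m * ginv (h x) m b * f b) / 2"
    by (simp add: christoffel_def pd_eq_pv f_def sum_distrib_left sum_divide_distrib mult.assoc)
  also have "(\<Sum>m\<in>UNIV. \<Sum>b\<in>UNIV. h x $ a $ m * ginv (h x) m b * f b) =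
      (\<Sum>b\<in>UNIV. (\<Sum>m\<in>UNIV. h x $ a $ m * ginv (h x) m b) * f b)"
    by (subst sum.swap) (simp add: sum_distrib_right)
  also have "\<dots> = f a" by (simp add: ginv_right sum_delta)
  finally show ?thesis by (simp add: f_def)
qed

text \<open>The Levi-Civita connection preserves the metric and hence, by the formula for the derivative of
  an inverse matrix, its inverse.\<close>

lemma metric_compatible:
  assumes "x \<in> U"
  shows "pv k (\<lambda>y. h y $ i $ j) x = (\<Sum>a\<in>UNIV. \<Gamma> x a k i * h x $ a $ j) + (\<Sum>a\<in>UNIV. \<Gamma> x a k j * h x $ i $ a)"
proof -
  have "(\<Sum>a\<in>UNIV. \<Gamma> x a k i * h x $ a $ j) = (\<Sum>a\<in>UNIV. h x $ j $ a * \<Gamma> x a k i)"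
    using h_sym[OF assms] by (simp add: mult.commute)
  moreover have "(\<Sum>a\<in>UNIV. \<Gamma> x a k j * h x $ i $ a) = (\<Sum>a\<in>UNIV. h x $ i $ a * \<Gamma> x a k j)"
    by (simp add: mult.commute)
  ultimately show ?thesis
    using pd_h_sym[OF assms, of k i j] pd_h_sym[OF assms, of i k j] pd_h_sym[OF assms, of j k i]
    by (simp add: christoffel_lower[OF assms] pd_eq_pv)
qed

lemma inverse_metric_compatible:
  assumes "x \<in> U"
  shows "pv k (\<lambda>y. ginv (h y) i j) x =
    - (\<Sum>a\<in>UNIV. \<Gamma> x i k a * ginv (h x) a j) - (\<Sum>a\<in>UNIV. \<Gamma> x j k a * ginv (h x) i a)"
proof -
  interpret nondegenerate_form "h x" by (rule h_form[OF assms])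
  have dh: "pv k h x $ b $ c = pv k (\<lambda>y. h y $ b $ c) x" for b c
  proof -
    have "h differentiable (at x)" by (rule smoothv_differentiable[OF h_matrix_smooth assms])
    then show ?thesis
      using pv_component[of h x k b] pv_component[of "\<lambda>x. h x $ b" x k c]
        differentiable_linear[OF bounded_linear_vec_nth, of h x b] by simp
  qed
  have "pv k (\<lambda>y. ginv (h y) i j) x = pv k (\<lambda>y. matrix_inv (h y)) x $ i $ j"
    using pv_component[of "\<lambda>y. matrix_inv (h y)" x k i] pv_component[of "\<lambda>y. matrix_inv (h y) $ i" x k j]
      differentiable_linear[OF bounded_linear_vec_nth, of "\<lambda>y. matrix_inv (h y)" x i]
      smoothv_differentiable[OF ginv_matrix(1) assms] by simp
  also have "\<dots> = - (\<Sum>c\<in>UNIV. (\<Sum>b\<in>UNIV. ginv (h x) i b * pv k (\<lambda>y. h y $ b $ c) x) * ginv (h x) c j)"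
    unfolding ginv_matrix(2)[OF assms] by (simp add: matrix_matrix_mult_def dh)
  also have "\<dots> = - ((\<Sum>c\<in>UNIV. \<Sum>b\<in>UNIV. \<Sum>a\<in>UNIV. ginv (h x) i b * \<Gamma> x a k b * (h x $ a $ c * ginv (h x) c j))
     + (\<Sum>c\<in>UNIV. \<Sum>b\<in>UNIV. \<Sum>a\<in>UNIV. (ginv (h x) i b * h x $ b $ a) * \<Gamma> x a k c * ginv (h x) c j))"
    by (simp add: metric_compatible[OF assms] sum_distrib_left sum_distrib_right sum.distrib distrib_left distrib_right mult_ac)
  also have "(\<Sum>c\<in>UNIV. \<Sum>b\<in>UNIV. \<Sum>a\<in>UNIV. ginv (h x) i b * \<Gamma> x a k b * (h x $ a $ c * ginv (h x) c j))
     = (\<Sum>b\<in>UNIV. \<Sum>a\<in>UNIV. ginv (h x) i b * \<Gamma> x a k b * (\<Sum>c\<in>UNIV. h x $ a $ c * ginv (h x) c j))"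
    by (subst sum.swap, rule sum.cong[OF refl], subst sum.swap) (simp add: sum_distrib_left)
  also have "\<dots> = (\<Sum>a\<in>UNIV. \<Gamma> x j k a * ginv (h x) i a)"
    by (simp add: ginv_right sum_delta mult.commute)
  also have "(\<Sum>c\<in>UNIV. \<Sum>b\<in>UNIV. \<Sum>a\<in>UNIV. (ginv (h x) i b * h x $ b $ a) * \<Gamma> x a k c * ginv (h x) c j)
     = (\<Sum>c\<in>UNIV. \<Sum>a\<in>UNIV. (\<Sum>b\<in>UNIV. ginv (h x) i b * h x $ b $ a) * \<Gamma> x a k c * ginv (h x) c j)"
    by (rule sum.cong[OF refl], subst sum.swap) (simp add: sum_distrib_right)
  also have "\<dots> = (\<Sum>a\<in>UNIV. \<Gamma> x i k a * ginv (h x) a j)"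
    by (simp add: ginv_left sum_delta mult.assoc)
  finally show ?thesis by simp
qed

lemma riemann_smooth: "smoothv U (\<lambda>x. riemann h x m i j k)"
  unfolding riemann_def pd_eq_pv
  by (intro smoothv_add smoothv_diff smoothv_pv christoffel_smooth smoothv_sum_UNIV smoothv_mult U)

lemma ricci_smooth: "smoothv U (\<lambda>x. ricci h x i j)"
  unfolding ricci_def by (intro smoothv_sum_UNIV riemann_smooth U)

lemma scalar_curv_smooth: "smoothv U (\<lambda>x. scalar_curv h x)"
  unfolding scalar_curv_def by (intro smoothv_sum_UNIV smoothv_mult ricci_smooth ginv_smooth U)

text \<open>Since partial derivatives commute and the connection is symmetric, only curvature terms remain in
  the commutator of two covariant derivatives.  For tensors of rank three the terms in which the
  connection acts on two different slots cancel in pairs.\<close>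

lemma ricci_identity_covector:
  assumes x: "x \<in> U" and V: "open V" "x \<in> V" "V \<subseteq> U" and T: "\<And>i. smoothv V (\<lambda>y. T y [i])"
  shows "covD h (covD h T) x [k, j, i] - covD h (covD h T) x [j, k, i]
    = (\<Sum>a\<in>UNIV. riemann h x a i j k * T x [a])"
proof -
  define \<tau> where "\<tau> = (\<lambda>i y. T y [i])"
  have \<tau>: "smoothv V (\<tau> i)" for i using T by (simp add: \<tau>_def)
  have G: "smoothv V (\<lambda>x. \<Gamma> x m i j)" for m i j using smoothv_subset[OF christoffel_smooth V(3)] .
  have d\<tau>: "\<tau> i differentiable (at x)" "pv j (\<tau> i) differentiable (at x)" for i j
    using smoothv_differentiable[OF \<tau> V(2)] smoothv_differentiable[OF smoothv_pv[OF \<tau>] V(2)] by auto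
  have dG: "(\<lambda>x. \<Gamma> x m i j) differentiable (at x)" for m i j using smoothv_differentiable[OF G V(2)] .
  have D: "covD h T y [j, i] = pv j (\<tau> i) y - (\<Sum>m\<in>UNIV. \<Gamma> y m j i * \<tau> m y)" for y j i
    by (simp add: covD_1 \<tau>_def)
  have pD: "pv k (\<lambda>y. covD h T y [j, i]) x = pv k (pv j (\<tau> i)) x
    - (\<Sum>m\<in>UNIV. pv k (\<lambda>y. \<Gamma> y m j i) x * \<tau> m x + \<Gamma> x m j i * pv k (\<tau> m) x)" for k j i
    unfolding D using d\<tau> dG
    by (subst pv_diff) (auto intro!: differentiable_sum_UNIV differentiable_mult simp: pv_sum pv_mult differentiable_mult)
  have comm: "pv k (pv j (\<tau> i)) x = pv j (pv k (\<tau> i)) x" by (rule pv_commute[OF V(1,2) \<tau>])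
  have conn: "(\<Sum>a\<in>UNIV. \<Gamma> x a k i * covD h T x [j, a]) = (\<Sum>a\<in>UNIV. \<Gamma> x a k i * pv j (\<tau> a) x)
      - (\<Sum>m\<in>UNIV. (\<Sum>a\<in>UNIV. \<Gamma> x m j a * \<Gamma> x a k i) * \<tau> m x)" for k j
  proof -
    have "(\<Sum>a\<in>UNIV. \<Gamma> x a k i * covD h T x [j, a]) = (\<Sum>a\<in>UNIV. \<Gamma> x a k i * pv j (\<tau> a) x)
      - (\<Sum>a\<in>UNIV. \<Sum>m\<in>UNIV. \<Gamma> x m j a * \<Gamma> x a k i * \<tau> m x)"
      by (simp add: D right_diff_distrib sum_subtractf sum_distrib_left mult_ac)
    then show ?thesis by (subst (asm) sum.swap) (simp add: sum_distrib_right)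
  qed
  have sy: "(\<Sum>a\<in>UNIV. \<Gamma> x a k j * covD h T x [a, i]) = (\<Sum>a\<in>UNIV. \<Gamma> x a j k * covD h T x [a, i])"
    using christoffel_sym[OF x] by simp
  have Tt: "T x [a] = \<tau> a x" for a by (simp add: \<tau>_def)
  show ?thesis unfolding covD_2 pD conn sy comm
    by (simp add: riemann_def pd_eq_pv Tt sum.distrib sum_subtractf left_diff_distrib distrib_right
        sum_distrib_right)
qed

lemma ricci_identity_rank3:
  assumes x: "x \<in> U" and V: "open V" "x \<in> V" "V \<subseteq> U" and T: "\<And>i j k. smoothv V (\<lambda>y. T y [i, j, k])"
  shows "covD h (covD h T) x [m, l, i, j, k] - covD h (covD h T) x [l, m, i, j, k]
    = (\<Sum>a\<in>UNIV. riemann h x a i l m * T x [a, j, k] + riemann h x a j l m * T x [i, a, k]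
        + riemann h x a k l m * T x [i, j, a])"
proof -
  define S where "S = (\<lambda>i j k y. T y [i, j, k])"
  have S: "smoothv V (S i j k)" for i j k using T by (simp add: S_def)
  have G: "smoothv V (\<lambda>x. \<Gamma> x m i j)" for m i j using smoothv_subset[OF christoffel_smooth V(3)] .
  have dS: "S i j k differentiable (at x)" "pv l (S i j k) differentiable (at x)" for i j k l
    using smoothv_differentiable[OF S V(2)] smoothv_differentiable[OF smoothv_pv[OF S] V(2)] by auto
  have dG: "(\<lambda>x. \<Gamma> x m i j) differentiable (at x)" for m i j using smoothv_differentiable[OF G V(2)] .
  have D: "covD h T y [l, i, j, k] = pv l (S i j k) y - (\<Sum>a\<in>UNIV. \<Gamma> y a l i * S a j k y)
     - (\<Sum>a\<in>UNIV. \<Gamma> y a l j * S i a k y) - (\<Sum>a\<in>UNIV. \<Gamma> y a l k * S i j a y)" for y l i j k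
    by (simp add: covD_3 S_def)
  have pD: "pv m (\<lambda>y. covD h T y [l, i, j, k]) x = pv m (pv l (S i j k)) x
    - (\<Sum>a\<in>UNIV. pv m (\<lambda>y. \<Gamma> y a l i) x * S a j k x) - (\<Sum>a\<in>UNIV. \<Gamma> x a l i * pv m (S a j k) x)
    - (\<Sum>a\<in>UNIV. pv m (\<lambda>y. \<Gamma> y a l j) x * S i a k x) - (\<Sum>a\<in>UNIV. \<Gamma> x a l j * pv m (S i a k) x)
    - (\<Sum>a\<in>UNIV. pv m (\<lambda>y. \<Gamma> y a l k) x * S i j a x) - (\<Sum>a\<in>UNIV. \<Gamma> x a l k * pv m (S i j a) x)" for m l
  proof -
    have dd: "(\<lambda>y. \<Sum>a\<in>UNIV. \<Gamma> y a l i * S a j k y) differentiable (at x)"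
      "(\<lambda>y. \<Sum>a\<in>UNIV. \<Gamma> y a l j * S i a k y) differentiable (at x)"
      "(\<lambda>y. \<Sum>a\<in>UNIV. \<Gamma> y a l k * S i j a y) differentiable (at x)"
      by (intro differentiable_sum_UNIV differentiable_mult dG dS)+
    show ?thesis unfolding D
      by (simp add: pv_diff dd dS differentiable_diff)
         (simp add: pv_sum pv_mult dG dS differentiable_mult sum.distrib)
  qed
  have comm: "pv m (pv l (S i j k)) x = pv l (pv m (S i j k)) x" by (rule pv_commute[OF V(1,2) S])
  have 1: "(\<Sum>a\<in>UNIV. \<Gamma> x a m i * covD h T x [l, a, j, k]) = (\<Sum>a\<in>UNIV. \<Gamma> x a m i * pv l (S a j k) x)
      - (\<Sum>b\<in>UNIV. (\<Sum>a\<in>UNIV. \<Gamma> x b l a * \<Gamma> x a m i) * S b j k x)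
      - (\<Sum>a\<in>UNIV. \<Sum>b\<in>UNIV. \<Gamma> x a m i * \<Gamma> x b l j * S a b k x)
      - (\<Sum>a\<in>UNIV. \<Sum>b\<in>UNIV. \<Gamma> x a m i * \<Gamma> x b l k * S a j b x)" for m l
  proof -
    have "(\<Sum>b\<in>UNIV. (\<Sum>a\<in>UNIV. \<Gamma> x b l a * \<Gamma> x a m i) * S b j k x) = (\<Sum>a\<in>UNIV. \<Sum>b\<in>UNIV. \<Gamma> x b l a * \<Gamma> x a m i * S b j k x)"
      by (subst sum.swap) (simp add: sum_distrib_right)
    then show ?thesis by (simp add: D right_diff_distrib sum_subtractf sum_distrib_left mult_ac)
  qed
  have 2: "(\<Sum>a\<in>UNIV. \<Gamma> x a m j * covD h T x [l, i, a, k]) = (\<Sum>a\<in>UNIV. \<Gamma> x a m j * pv l (S i a k) x)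
      - (\<Sum>b\<in>UNIV. (\<Sum>a\<in>UNIV. \<Gamma> x b l a * \<Gamma> x a m j) * S i b k x)
      - (\<Sum>a\<in>UNIV. \<Sum>b\<in>UNIV. \<Gamma> x a l i * \<Gamma> x b m j * S a b k x)
      - (\<Sum>a\<in>UNIV. \<Sum>b\<in>UNIV. \<Gamma> x a m j * \<Gamma> x b l k * S i a b x)" for m l
  proof -
    have "(\<Sum>b\<in>UNIV. (\<Sum>a\<in>UNIV. \<Gamma> x b l a * \<Gamma> x a m j) * S i b k x) = (\<Sum>a\<in>UNIV. \<Sum>b\<in>UNIV. \<Gamma> x b l a * \<Gamma> x a m j * S i b k x)"
      by (subst sum.swap) (simp add: sum_distrib_right)
    moreover have "(\<Sum>a\<in>UNIV. \<Sum>b\<in>UNIV. \<Gamma> x a l i * \<Gamma> x b m j * S a b k x) = (\<Sum>b\<in>UNIV. \<Sum>a\<in>UNIV. \<Gamma> x a l i * \<Gamma> x b m j * S a b k x)"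
      by (rule sum.swap)
    ultimately show ?thesis by (simp add: D right_diff_distrib sum_subtractf sum_distrib_left mult_ac)
  qed
  have 3: "(\<Sum>a\<in>UNIV. \<Gamma> x a m k * covD h T x [l, i, j, a]) = (\<Sum>a\<in>UNIV. \<Gamma> x a m k * pv l (S i j a) x)
      - (\<Sum>b\<in>UNIV. (\<Sum>a\<in>UNIV. \<Gamma> x b l a * \<Gamma> x a m k) * S i j b x)
      - (\<Sum>a\<in>UNIV. \<Sum>b\<in>UNIV. \<Gamma> x a l i * \<Gamma> x b m k * S a j b x)
      - (\<Sum>a\<in>UNIV. \<Sum>b\<in>UNIV. \<Gamma> x a l j * \<Gamma> x b m k * S i a b x)" for m l
  proof -
    have "(\<Sum>b\<in>UNIV. (\<Sum>a\<in>UNIV. \<Gamma> x b l a * \<Gamma> x a m k) * S i j b x) = (\<Sum>a\<in>UNIV. \<Sum>b\<in>UNIV. \<Gamma> x b l a * \<Gamma> x a m k * S i j b x)"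
      by (subst sum.swap) (simp add: sum_distrib_right)
    moreover have "(\<Sum>a\<in>UNIV. \<Sum>b\<in>UNIV. \<Gamma> x a l i * \<Gamma> x b m k * S a j b x) = (\<Sum>b\<in>UNIV. \<Sum>a\<in>UNIV. \<Gamma> x a l i * \<Gamma> x b m k * S a j b x)"
      by (rule sum.swap)
    moreover have "(\<Sum>a\<in>UNIV. \<Sum>b\<in>UNIV. \<Gamma> x a l j * \<Gamma> x b m k * S i a b x) = (\<Sum>b\<in>UNIV. \<Sum>a\<in>UNIV. \<Gamma> x a l j * \<Gamma> x b m k * S i a b x)"
      by (rule sum.swap)
    ultimately show ?thesis by (simp add: D right_diff_distrib sum_subtractf sum_distrib_left mult_ac)
  qed
  have sy: "(\<Sum>a\<in>UNIV. \<Gamma> x a m l * covD h T x [a, i, j, k]) = (\<Sum>a\<in>UNIV. \<Gamma> x a l m * covD h T x [a, i, j, k])"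
    using christoffel_sym[OF x] by simp
  have R: "(\<Sum>a\<in>UNIV. riemann h x a i l m * f a) = (\<Sum>a\<in>UNIV. pv l (\<lambda>y. \<Gamma> y a m i) x * f a)
      - (\<Sum>a\<in>UNIV. pv m (\<lambda>y. \<Gamma> y a l i) x * f a)
      + (\<Sum>b\<in>UNIV. (\<Sum>a\<in>UNIV. \<Gamma> x b l a * \<Gamma> x a m i) * f b) - (\<Sum>b\<in>UNIV. (\<Sum>a\<in>UNIV. \<Gamma> x b m a * \<Gamma> x a l i) * f b)"
    for f :: "'n \<Rightarrow> real" and i
    by (simp add: riemann_def pd_eq_pv sum.distrib sum_subtractf left_diff_distrib distrib_right sum_distrib_right)
  show ?thesis unfolding covD_4 pD 1 2 3 sy comm sum.distrib R
    by (simp add: S_def)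
qed

end

section \<open>Trace-free parts\<close>

lemma length_2E: "length I = 2 \<Longrightarrow> (\<And>i j. I = [i, j] \<Longrightarrow> P) \<Longrightarrow> P"
  by (auto simp: length_Suc_conv numeral_2_eq_2)

lemma length_3E: "length I = 3 \<Longrightarrow> (\<And>i j k. I = [i, j, k] \<Longrightarrow> P) \<Longrightarrow> P"
  by (auto simp: length_Suc_conv numeral_3_eq_3)

lemma length_4E: "length I = 4 \<Longrightarrow> (\<And>i j k l. I = [i, j, k, l] \<Longrightarrow> P) \<Longrightarrow> P"
  by (auto simp: length_Suc_conv eval_nat_numeral)

lemma all_length_2: "(\<forall>I. length I = 2 \<longrightarrow> P I) \<longleftrightarrow> (\<forall>i j. P [i, j])"
  by (auto elim!: length_2E)

lemma all_length_3: "(\<forall>I. length I = 3 \<longrightarrow> P I) \<longleftrightarrow> (\<forall>i j k. P [i, j, k])"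
  by (auto elim!: length_3E)

lemma all_length_4: "(\<forall>I. length I = 4 \<longrightarrow> P I) \<longleftrightarrow> (\<forall>i j k l. P [i, j, k, l])"
  by (auto elim!: length_4E)

definition trace_form :: "real^'n::finite^'n \<Rightarrow> ('n \<Rightarrow> 'n \<Rightarrow> real) \<Rightarrow> real" where
  "trace_form \<gamma> f = (\<Sum>a\<in>UNIV. \<Sum>b\<in>UNIV. ginv \<gamma> a b * f a b)"

lemma pair_cases_2: "(\<forall>p q. p < q \<longrightarrow> q < 2 \<longrightarrow> P p q) \<longleftrightarrow> P 0 (1::nat)"
  by (auto simp: less_Suc_eq numeral_2_eq_2)

lemma pair_cases_3: "(\<forall>p q. p < q \<longrightarrow> q < 3 \<longrightarrow> P p q) \<longleftrightarrow> P 0 1 \<and> P 0 2 \<and> P 1 (2::nat)"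
  by (auto simp: less_Suc_eq eval_nat_numeral)

lemma pair_cases_4: "(\<forall>p q. p < q \<longrightarrow> q < 4 \<longrightarrow> P p q) \<longleftrightarrow> P 0 1 \<and> P 0 2 \<and> P 0 3 \<and> P 1 2 \<and> P 1 3 \<and> P 2 (3::nat)"
  by (auto simp: less_Suc_eq eval_nat_numeral)

lemma totally_tracefree_alt: "totally_tracefree \<gamma> r T \<longleftrightarrow>
   (\<forall>I. length I = r \<longrightarrow> (\<forall>p q. p < q \<longrightarrow> q < r \<longrightarrow> trace_form \<gamma> (\<lambda>a b. T (I[p := a, q := b])) = 0))"
  unfolding totally_tracefree_def trace_form_def by blast

lemma totally_tracefree_2: "totally_tracefree \<gamma> 2 T \<longleftrightarrow> trace_form \<gamma> (\<lambda>a b. T [a, b]) = 0"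
  unfolding totally_tracefree_alt pair_cases_2 all_length_2 by simp

lemma totally_tracefree_3: "totally_tracefree \<gamma> 3 T \<longleftrightarrow>
    (\<forall>k. trace_form \<gamma> (\<lambda>a b. T [a, b, k]) = 0) \<and> (\<forall>j. trace_form \<gamma> (\<lambda>a b. T [a, j, b]) = 0)
    \<and> (\<forall>i. trace_form \<gamma> (\<lambda>a b. T [i, a, b]) = 0)"
  unfolding totally_tracefree_alt pair_cases_3 all_length_3 by (auto simp: eval_nat_numeral)

lemma totally_tracefree_4: "totally_tracefree \<gamma> 4 T \<longleftrightarrow>
    (\<forall>k l. trace_form \<gamma> (\<lambda>a b. T [a, b, k, l]) = 0) \<and> (\<forall>j l. trace_form \<gamma> (\<lambda>a b. T [a, j, b, l]) = 0)
    \<and> (\<forall>j k. trace_form \<gamma> (\<lambda>a b. T [a, j, k, b]) = 0) \<and> (\<forall>i l. trace_form \<gamma> (\<lambda>a b. T [i, a, b, l]) = 0)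
    \<and> (\<forall>i k. trace_form \<gamma> (\<lambda>a b. T [i, a, k, b]) = 0) \<and> (\<forall>i j. trace_form \<gamma> (\<lambda>a b. T [i, j, a, b]) = 0)"
  unfolding totally_tracefree_alt pair_cases_4 all_length_4 by (auto simp: eval_nat_numeral)

text \<open>In low ranks a pure trace is written with one coefficient for each pair of slots.\<close>

lemma pure_trace_2: "pure_trace \<gamma> 2 T \<longleftrightarrow> (\<exists>c. \<forall>i j. T [i, j] = \<gamma> $ i $ j * c)"
proof -
  have "pure_trace \<gamma> 2 T \<longleftrightarrow> (\<exists>U :: nat \<Rightarrow> nat \<Rightarrow> 'a tensor. \<forall>i j. T [i, j] = \<gamma> $ i $ j * U 0 1 [])"
    unfolding pure_trace_def all_length_2 by (simp add: numeral_2_eq_2 lessThan_Suc nths_Cons)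
  also have "\<dots> \<longleftrightarrow> (\<exists>c. \<forall>i j. T [i, j] = \<gamma> $ i $ j * c)"
  proof
    assume "\<exists>c. \<forall>i j. T [i, j] = \<gamma> $ i $ j * c"
    then obtain c where "\<forall>i j. T [i, j] = \<gamma> $ i $ j * c" ..
    then show "\<exists>U :: nat \<Rightarrow> nat \<Rightarrow> 'a tensor. \<forall>i j. T [i, j] = \<gamma> $ i $ j * U 0 1 []"
      by (intro exI[of _ "\<lambda>_ _ _. c"])
  qed blast
  finally show ?thesis .
qed

lemma pure_trace_3: "pure_trace \<gamma> 3 T \<longleftrightarrow>
   (\<exists>A B C. \<forall>i j k. T [i, j, k] = \<gamma> $ i $ j * A k + \<gamma> $ i $ k * B j + \<gamma> $ j $ k * C i)"
proof -
  have "pure_trace \<gamma> 3 T \<longleftrightarrow> (\<exists>U :: nat \<Rightarrow> nat \<Rightarrow> 'a tensor. \<forall>i j k. T [i, j, k] =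
     \<gamma> $ i $ j * U 0 1 [k] + \<gamma> $ i $ k * U 0 2 [j] + \<gamma> $ j $ k * U 1 2 [i])"
    unfolding pure_trace_def all_length_3 by (simp add: eval_nat_numeral lessThan_Suc nths_Cons add_ac)
  also have "\<dots> \<longleftrightarrow> (\<exists>A B C. \<forall>i j k. T [i, j, k] = \<gamma> $ i $ j * A k + \<gamma> $ i $ k * B j + \<gamma> $ j $ k * C i)"
    (is "?l \<longleftrightarrow> ?r")
  proof
    assume ?r
    then obtain A B C where "\<forall>i j k. T [i, j, k] = \<gamma> $ i $ j * A k + \<gamma> $ i $ k * B j + \<gamma> $ j $ k * C i" by blast
    then show ?l
      by (intro exI[of _ "\<lambda>p q I. if q = 1 then A (hd I) else if p = 0 then B (hd I) else C (hd I)"]) simp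
  next
    assume ?l
    then obtain U where "\<forall>i j k. T [i, j, k] = \<gamma> $ i $ j * U 0 (1::nat) [k] + \<gamma> $ i $ k * U (0::nat) 2 [j] + \<gamma> $ j $ k * U 1 2 [i]" by blast
    then show ?r
      by (intro exI[of _ "\<lambda>k. U 0 1 [k]"] exI[of _ "\<lambda>k. U 0 2 [k]"] exI[of _ "\<lambda>k. U 1 2 [k]"])
  qed
  finally show ?thesis .
qed

lemma pure_trace_4: "pure_trace \<gamma> 4 T \<longleftrightarrow>
   (\<exists>A B C D E F. \<forall>i j k l. T [i, j, k, l] = \<gamma> $ i $ j * A k l + \<gamma> $ i $ k * B j l + \<gamma> $ i $ l * C j k
      + \<gamma> $ j $ k * D i l + \<gamma> $ j $ l * E i k + \<gamma> $ k $ l * F i j)"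
proof -
  have "pure_trace \<gamma> 4 T \<longleftrightarrow> (\<exists>U :: nat \<Rightarrow> nat \<Rightarrow> 'a tensor. \<forall>i j k l. T [i, j, k, l] =
     \<gamma> $ i $ j * U 0 1 [k, l] + \<gamma> $ i $ k * U 0 2 [j, l] + \<gamma> $ i $ l * U 0 3 [j, k]
      + \<gamma> $ j $ k * U 1 2 [i, l] + \<gamma> $ j $ l * U 1 3 [i, k] + \<gamma> $ k $ l * U 2 3 [i, j])"
    unfolding pure_trace_def all_length_4 by (simp add: eval_nat_numeral lessThan_Suc nths_Cons add_ac)
  also have "\<dots> \<longleftrightarrow> (\<exists>A B C D E F. \<forall>i j k l. T [i, j, k, l] = \<gamma> $ i $ j * A k l + \<gamma> $ i $ k * B j l + \<gamma> $ i $ l * C j k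
      + \<gamma> $ j $ k * D i l + \<gamma> $ j $ l * E i k + \<gamma> $ k $ l * F i j)"
    (is "?l \<longleftrightarrow> ?r")
  proof
    assume ?r
    then obtain A B C D E F where *: "\<forall>i j k l. T [i, j, k, l] = \<gamma> $ i $ j * A k l + \<gamma> $ i $ k * B j l + \<gamma> $ i $ l * C j k
      + \<gamma> $ j $ k * D i l + \<gamma> $ j $ l * E i k + \<gamma> $ k $ l * F i j" by blast
    show ?l
      by (rule exI[of _ "\<lambda>p q I. if q = 1 then A (I!0) (I!1) else if p = 0 \<and> q = 2 then B (I!0) (I!1)
         else if p = 0 then C (I!0) (I!1) else if q = 2 then D (I!0) (I!1) else if p = 1 then E (I!0) (I!1) else F (I!0) (I!1)"])
        (simp add: *)
  next
    assume ?l
    then obtain U where "\<forall>i j k l. T [i, j, k, l] =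
     \<gamma> $ i $ j * U 0 (1::nat) [k, l] + \<gamma> $ i $ k * U (0::nat) 2 [j, l] + \<gamma> $ i $ l * U 0 3 [j, k]
      + \<gamma> $ j $ k * U 1 2 [i, l] + \<gamma> $ j $ l * U 1 3 [i, k] + \<gamma> $ k $ l * U 2 3 [i, j]" by blast
    then show ?r
      by (intro exI[of _ "\<lambda>k l. U 0 1 [k, l]"] exI[of _ "\<lambda>k l. U 0 2 [k, l]"] exI[of _ "\<lambda>k l. U 0 3 [k, l]"]
          exI[of _ "\<lambda>k l. U 1 2 [k, l]"] exI[of _ "\<lambda>k l. U 1 3 [k, l]"] exI[of _ "\<lambda>k l. U 2 3 [k, l]"])
  qed
  finally show ?thesis .
qed

lemma trace_form_add: "trace_form \<gamma> (\<lambda>a b. f a b + g a b) = trace_form \<gamma> f + trace_form \<gamma> g"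
  by (simp add: trace_form_def distrib_left sum.distrib)

lemma trace_form_diff: "trace_form \<gamma> (\<lambda>a b. f a b - g a b) = trace_form \<gamma> f - trace_form \<gamma> g"
  by (simp add: trace_form_def right_diff_distrib sum_subtractf)

lemma trace_form_minus: "trace_form \<gamma> (\<lambda>a b. - f a b) = - trace_form \<gamma> f"
  by (simp add: trace_form_def sum_negf)

lemma trace_form_cmult: "trace_form \<gamma> (\<lambda>a b. c * f a b) = c * trace_form \<gamma> f"
  by (simp add: trace_form_def sum_distrib_left mult_ac)

lemma trace_form_multc: "trace_form \<gamma> (\<lambda>a b. f a b * c) = trace_form \<gamma> f * c"
  by (simp add: trace_form_def sum_distrib_right mult.assoc)

lemma trace_form_divide: "trace_form \<gamma> (\<lambda>a b. f a b / c) = trace_form \<gamma> f / c"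
  by (simp add: trace_form_def sum_divide_distrib)

lemma trace_form_zero: "trace_form \<gamma> (\<lambda>a b. 0) = 0"
  by (simp add: trace_form_def)

lemma trace_form_sum: "trace_form \<gamma> (\<lambda>a b. \<Sum>i\<in>I. f i a b) = (\<Sum>i\<in>I. trace_form \<gamma> (f i))"
proof -
  have "trace_form \<gamma> (\<lambda>a b. \<Sum>i\<in>I. f i a b) = (\<Sum>a\<in>UNIV. \<Sum>i\<in>I. \<Sum>b\<in>UNIV. ginv \<gamma> a b * f i a b)"
    unfolding trace_form_def by (rule sum.cong[OF refl], subst sum.swap) (simp add: sum_distrib_left)
  also have "\<dots> = (\<Sum>i\<in>I. trace_form \<gamma> (f i))" unfolding trace_form_def by (rule sum.swap)
  finally show ?thesis .
qed

lemmas trace_form_linear = trace_form_add trace_form_diff trace_form_minus trace_form_cmult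
  trace_form_multc trace_form_divide trace_form_zero

lemma tf_part_props:
  assumes "totally_tracefree \<gamma> r T0" "pure_trace \<gamma> r (\<lambda>I. T I - T0 I)"
  shows "totally_tracefree \<gamma> r (tf_part \<gamma> r T)" "pure_trace \<gamma> r (\<lambda>I. T I - tf_part \<gamma> r T I)"
proof -
  have "\<exists>T0. totally_tracefree \<gamma> r T0 \<and> pure_trace \<gamma> r (\<lambda>I. T I - T0 I)" using assms by blast
  from someI_ex[OF this] show "totally_tracefree \<gamma> r (tf_part \<gamma> r T)" "pure_trace \<gamma> r (\<lambda>I. T I - tf_part \<gamma> r T I)"
    unfolding tf_part_def by auto
qed

lemma totally_tracefree_diff:
  "totally_tracefree \<gamma> r T \<Longrightarrow> totally_tracefree \<gamma> r T' \<Longrightarrow> totally_tracefree \<gamma> r (\<lambda>I. T I - T' I)"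
  unfolding totally_tracefree_alt by (simp add: trace_form_diff)

lemma pure_trace_diff:
  assumes "pure_trace \<gamma> r T" "pure_trace \<gamma> r T'" shows "pure_trace \<gamma> r (\<lambda>I. T I - T' I)"
proof -
  obtain U U' where U: "\<And>I. length I = r \<Longrightarrow> T I = (\<Sum>q<r. \<Sum>p<q. \<gamma> $ (I!p) $ (I!q) * U p q (nths I (- {p, q})))"
    "\<And>I. length I = r \<Longrightarrow> T' I = (\<Sum>q<r. \<Sum>p<q. \<gamma> $ (I!p) $ (I!q) * U' p q (nths I (- {p, q})))"
    using assms unfolding pure_trace_def by blast
  show ?thesis unfolding pure_trace_def
    by (rule exI[of _ "\<lambda>p q I. U p q I - U' p q I"])
      (simp add: U sum_subtractf right_diff_distrib)
qed

text \<open>The trace-free part is chosen among all tensors with the two defining properties; its entry at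
  \<open>I\<close> is determined as soon as trace-free pure traces vanish there.\<close>

lemma tf_part_eqI:
  assumes T0: "totally_tracefree \<gamma> r T0" "pure_trace \<gamma> r (\<lambda>I. T I - T0 I)" and I: "length I = r"
    and unique: "\<And>D. totally_tracefree \<gamma> r D \<Longrightarrow> pure_trace \<gamma> r D \<Longrightarrow> D I = 0"
  shows "tf_part \<gamma> r T I = T0 I"
proof -
  note p = tf_part_props[OF T0]
  have "(\<lambda>I. tf_part \<gamma> r T I - T0 I) I = 0"
  proof (rule unique)
    show "totally_tracefree \<gamma> r (\<lambda>I. tf_part \<gamma> r T I - T0 I)" by (rule totally_tracefree_diff[OF p(1) T0(1)])
    have "pure_trace \<gamma> r (\<lambda>I. (T I - T0 I) - (T I - tf_part \<gamma> r T I))" by (rule pure_trace_diff[OF T0(2) p(2)])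
    then show "pure_trace \<gamma> r (\<lambda>I. tf_part \<gamma> r T I - T0 I)" by simp
  qed
  then show ?thesis by simp
qed

context nondegenerate_form
begin

lemma trace_form_\<gamma>: "trace_form \<gamma> (\<lambda>a b. \<gamma> $ a $ b) = real CARD('n)"
proof -
  have "trace_form \<gamma> (\<lambda>a b. \<gamma> $ a $ b) = (\<Sum>a\<in>UNIV. \<Sum>b\<in>UNIV. ginv \<gamma> a b * \<gamma> $ b $ a)"
    unfolding trace_form_def using \<gamma>_sym by (intro sum.cong refl) auto
  also have "\<dots> = real CARD('n)" by (simp add: ginv_left)
  finally show ?thesis .
qed

lemma trace_form_flip: "trace_form \<gamma> (\<lambda>a b. f b a) = trace_form \<gamma> f"
  unfolding trace_form_def by (subst sum.swap) (simp add: ginv_sym[of _ ])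

lemma trace_form_contract:
  "trace_form \<gamma> (\<lambda>a b. \<gamma> $ a $ i * f b) = f i" "trace_form \<gamma> (\<lambda>a b. \<gamma> $ i $ a * f b) = f i"
  "trace_form \<gamma> (\<lambda>a b. \<gamma> $ b $ i * f a) = f i" "trace_form \<gamma> (\<lambda>a b. \<gamma> $ i $ b * f a) = f i"
  "trace_form \<gamma> (\<lambda>a b. f b * \<gamma> $ a $ i) = f i" "trace_form \<gamma> (\<lambda>a b. f b * \<gamma> $ i $ a) = f i"
  "trace_form \<gamma> (\<lambda>a b. f a * \<gamma> $ b $ i) = f i" "trace_form \<gamma> (\<lambda>a b. f a * \<gamma> $ i $ b) = f i"
proof -
  have 1: "trace_form \<gamma> (\<lambda>a b. \<gamma> $ b $ i * f a) = f i" for f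
  proof -
    have "trace_form \<gamma> (\<lambda>a b. \<gamma> $ b $ i * f a) = (\<Sum>a\<in>UNIV. (\<Sum>b\<in>UNIV. ginv \<gamma> a b * \<gamma> $ b $ i) * f a)"
      by (simp add: trace_form_def sum_distrib_right mult.assoc)
    then show ?thesis by (simp add: ginv_left sum_delta)
  qed
  have 2: "trace_form \<gamma> (\<lambda>a b. \<gamma> $ a $ i * f b) = f i" for f
    using trace_form_flip[of "\<lambda>a b. \<gamma> $ b $ i * f a"] 1 by simp
  note s = \<gamma>_sym[of i]
  show "trace_form \<gamma> (\<lambda>a b. \<gamma> $ a $ i * f b) = f i" "trace_form \<gamma> (\<lambda>a b. \<gamma> $ i $ a * f b) = f i"
  "trace_form \<gamma> (\<lambda>a b. \<gamma> $ b $ i * f a) = f i" "trace_form \<gamma> (\<lambda>a b. \<gamma> $ i $ b * f a) = f i"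
  "trace_form \<gamma> (\<lambda>a b. f b * \<gamma> $ a $ i) = f i" "trace_form \<gamma> (\<lambda>a b. f b * \<gamma> $ i $ a) = f i"
  "trace_form \<gamma> (\<lambda>a b. f a * \<gamma> $ b $ i) = f i" "trace_form \<gamma> (\<lambda>a b. f a * \<gamma> $ i $ b) = f i"
    using 1 2 unfolding s by (simp_all add: mult.commute)
qed

lemma trace_form_contract_\<gamma>:
  "trace_form \<gamma> (\<lambda>a b. \<gamma> $ a $ i * \<gamma> $ b $ j) = \<gamma> $ i $ j" "trace_form \<gamma> (\<lambda>a b. \<gamma> $ a $ i * \<gamma> $ j $ b) = \<gamma> $ i $ j"
  "trace_form \<gamma> (\<lambda>a b. \<gamma> $ i $ a * \<gamma> $ b $ j) = \<gamma> $ i $ j" "trace_form \<gamma> (\<lambda>a b. \<gamma> $ i $ a * \<gamma> $ j $ b) = \<gamma> $ i $ j"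
  by (simp_all add: trace_form_contract \<gamma>_sym[of j i])

lemma tracefree_pure_trace_2:
  assumes "totally_tracefree \<gamma> 2 D" "pure_trace \<gamma> 2 D" shows "D [i, j] = 0"
proof -
  obtain c where c: "\<And>i j. D [i, j] = \<gamma> $ i $ j * c" using assms(2) unfolding pure_trace_2 by blast
  have "real CARD('n) * c = 0"
    using assms(1) unfolding totally_tracefree_2 by (simp add: c trace_form_multc trace_form_\<gamma>)
  then show ?thesis by (simp add: c)
qed

lemma tracefree_pure_trace_3:
  assumes "totally_tracefree \<gamma> 3 D" "pure_trace \<gamma> 3 D" and n: "CARD('n) \<ge> 3" shows "D [i, j, k] = 0"
proof -
  obtain A B C where D: "\<And>i j k. D [i, j, k] = \<gamma> $ i $ j * A k + \<gamma> $ i $ k * B j + \<gamma> $ j $ k * C i"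
    using assms(2) unfolding pure_trace_3 by blast
  let ?n = "real CARD('n)"
  have tr: "?n * A m + B m + C m = 0" "A m + ?n * B m + C m = 0" "A m + B m + ?n * C m = 0" for m
    using assms(1) unfolding totally_tracefree_3
    by (simp_all add: D trace_form_linear trace_form_\<gamma> trace_form_contract)
  have n': "?n - 1 \<noteq> 0" "?n + 2 \<noteq> 0" using n by auto
  have zero: "A m = 0 \<and> B m = 0 \<and> C m = 0" for m
  proof -
    have "(?n - 1) * (A m - B m) = 0" "(?n - 1) * (A m - C m) = 0" using tr[of m] by (simp_all add: algebra_simps)
    then have e: "B m = A m" "C m = A m" using n' by auto
    have "(?n + 2) * A m = 0" using tr(1)[of m] unfolding e by (simp add: algebra_simps)
    then show ?thesis using e n' by auto
  qed
  then show ?thesis by (simp add: D)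
qed

lemma tf_part_2: "tf_part \<gamma> 2 (tens2 f) [i, j] = f i j - \<gamma> $ i $ j * (trace_form \<gamma> f / real CARD('n))"
proof -
  let ?T0 = "tens2 (\<lambda>i j. f i j - \<gamma> $ i $ j * (trace_form \<gamma> f / real CARD('n)))"
  have "tf_part \<gamma> 2 (tens2 f) [i, j] = ?T0 [i, j]"
  proof (rule tf_part_eqI)
    show "totally_tracefree \<gamma> 2 ?T0"
      unfolding totally_tracefree_2 by (simp add: tens2_def trace_form_diff trace_form_multc trace_form_divide trace_form_\<gamma>)
    show "pure_trace \<gamma> 2 (\<lambda>I. tens2 f I - ?T0 I)"
      unfolding pure_trace_2
      by (rule exI[of _ "trace_form \<gamma> f / real CARD('n)"]) (simp add: tens2_def)
  qed (auto intro: tracefree_pure_trace_2)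
  then show ?thesis by (simp add: tens2_def)
qed

lemma tf_part_3:
  assumes n: "CARD('n) \<ge> 3" and sym: "\<And>i j k. f i j k = f j i k" "\<And>i j k. f i j k = f i k j"
  shows "tf_part \<gamma> 3 (tens3 f) [i, j, k] = f i j k - (\<gamma> $ i $ j * trace_form \<gamma> (\<lambda>a b. f a b k)
     + \<gamma> $ i $ k * trace_form \<gamma> (\<lambda>a b. f a b j) + \<gamma> $ j $ k * trace_form \<gamma> (\<lambda>a b. f a b i)) / (real CARD('n) + 2)"
proof -
  define t where "t = (\<lambda>k. trace_form \<gamma> (\<lambda>a b. f a b k) / (real CARD('n) + 2))"
  let ?T0 = "tens3 (\<lambda>i j k. f i j k - (\<gamma> $ i $ j * t k + \<gamma> $ i $ k * t j + \<gamma> $ j $ k * t i))"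
  have t: "trace_form \<gamma> (\<lambda>a b. f a b k) = (real CARD('n) + 2) * t k" for k
    unfolding t_def by (simp add: add_pos_pos order.strict_implies_not_eq[symmetric])
  have t': "trace_form \<gamma> (\<lambda>a b. f a j b) = trace_form \<gamma> (\<lambda>a b. f a b j)"
    "trace_form \<gamma> (\<lambda>a b. f i a b) = trace_form \<gamma> (\<lambda>a b. f a b i)" for i j
    using sym by metis+
  have "tf_part \<gamma> 3 (tens3 f) [i, j, k] = ?T0 [i, j, k]"
  proof (rule tf_part_eqI)
    show "totally_tracefree \<gamma> 3 ?T0"
      unfolding totally_tracefree_3
      by (simp add: tens3_def trace_form_linear trace_form_\<gamma> trace_form_contract t' t algebra_simps)
    show "pure_trace \<gamma> 3 (\<lambda>I. tens3 f I - ?T0 I)"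
      unfolding pure_trace_3 by (rule exI[of _ t], rule exI[of _ t], rule exI[of _ t]) (simp add: tens3_def)
  qed (auto intro: tracefree_pure_trace_3 n)
  then show ?thesis by (simp add: tens3_def t_def add_divide_distrib)
qed

text \<open>For symmetric tensors it is enough to know a trace-free candidate up to trace terms.\<close>

lemma tf_part_3_eqI:
  assumes n: "CARD('n) \<ge> 3" and tf: "\<And>k. trace_form \<gamma> (\<lambda>a b. d a b k) = 0" 
    and sym: "\<And>i j k. d i j k = d j i k" "\<And>i j k. d i j k = d i k j"
    and eq: "\<And>i j k. f i j k - d i j k = \<gamma> $ i $ j * t k + \<gamma> $ i $ k * t j + \<gamma> $ j $ k * t i"
  shows "tf_part \<gamma> 3 (tens3 f) [i, j, k] = d i j k"
proof -
  have t': "trace_form \<gamma> (\<lambda>a b. d a j b) = trace_form \<gamma> (\<lambda>a b. d a b j)"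
    "trace_form \<gamma> (\<lambda>a b. d i a b) = trace_form \<gamma> (\<lambda>a b. d a b i)" for i j
    using sym by metis+
  have "tf_part \<gamma> 3 (tens3 f) [i, j, k] = tens3 d [i, j, k]"
  proof (rule tf_part_eqI)
    show "totally_tracefree \<gamma> 3 (tens3 d)"
      unfolding totally_tracefree_3 by (simp add: tens3_def tf t')
    show "pure_trace \<gamma> 3 (\<lambda>I. tens3 f I - tens3 d I)"
      unfolding pure_trace_3 by (rule exI[of _ t], rule exI[of _ t], rule exI[of _ t]) (simp add: tens3_def eq)
  qed (auto intro: tracefree_pure_trace_3 n)
  then show ?thesis by (simp add: tens3_def)
qed

lemma contr1_trace: "contr1 \<gamma> S i j k l = trace_form \<gamma> (\<lambda>a b. S [i, j, a] * S [k, l, b])"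
  unfolding contr1_def trace_form_def by (subst sum.swap) (simp add: ginv_sym[of _ ] mult.assoc)

lemma contr2_trace: "contr2 \<gamma> S i j = trace_form \<gamma> (\<lambda>a c. trace_form \<gamma> (\<lambda>b d. S [i, c, d] * S [j, a, b]))"
proof -
  have "contr2 \<gamma> S i j = (\<Sum>a\<in>UNIV. \<Sum>c\<in>UNIV. \<Sum>b\<in>UNIV. \<Sum>d\<in>UNIV.
     ginv \<gamma> a c * ginv \<gamma> b d * S [i, c, d] * S [j, a, b])"
    unfolding contr2_def by (rule sum.cong[OF refl], rule sum.swap)
  then show ?thesis unfolding trace_form_def by (simp add: sum_distrib_left mult.assoc)
qed

text \<open>The condition (\<open>*\<close>) says that the curvature-like tensor built from \<open>S\<close> has no Weyl part, so
  that it is a Kulkarni-Nomizu product of the metric with a symmetric form.  That the trace-free part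
  is meaningful at all follows from the explicit Weyl decomposition; the pure-trace form obtained
  from it is brought into the required shape by averaging over the symmetries of the tensor.\<close>

lemma star_condition_kulkarni_nomizu:
  assumes n: "CARD('n) \<ge> 3" and S: "totally_symmetric 3 S" "totally_tracefree \<gamma> 3 S"
    and star: "star_condition \<gamma> S"
  shows "\<exists>g. (\<forall>i j. g i j = g j i) \<and> (\<forall>i j k l. contr1 \<gamma> S i j k l - contr1 \<gamma> S i k j l =
    \<gamma> $ i $ j * g k l + \<gamma> $ k $ l * g i j - \<gamma> $ i $ k * g j l - \<gamma> $ j $ l * g i k)"
proof -
  have sym: "S [i, j, k] = S [j, i, k]" "S [i, j, k] = S [i, k, j]" for i j k
    using S(1)[unfolded totally_symmetric_def all_length_3] by (auto simp: add_mset_commute)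
  let ?C = "contr1 \<gamma> S"
  have Cs: "?C i j k l = ?C j i k l" "?C i j k l = ?C i j l k" "?C i j k l = ?C k l i j" for i j k l
  proof -
    show "?C i j k l = ?C j i k l" "?C i j k l = ?C i j l k"
      unfolding contr1_trace using sym by metis+
    show "?C i j k l = ?C k l i j"
      unfolding contr1_trace by (subst trace_form_flip[symmetric]) (simp add: mult.commute)
  qed
  define s where "s = (\<lambda>j l. trace_form \<gamma> (\<lambda>a b. ?C a j b l))"
  have s_sym: "s j l = s l j" for j l
    unfolding s_def by (subst trace_form_flip[symmetric]) (metis Cs)
  have tr0: "trace_form \<gamma> (\<lambda>a b. ?C a b k l) = 0" for k l
  proof -
    have "trace_form \<gamma> (\<lambda>a b. trace_form \<gamma> (\<lambda>c d. S [a, b, c] * S [k, l, d])) =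
       trace_form \<gamma> (\<lambda>c d. trace_form \<gamma> (\<lambda>a b. S [a, b, c]) * S [k, l, d])"
      unfolding trace_form_multc[symmetric] unfolding trace_form_def sum_distrib_left
      by (subst (2) sum.swap, subst sum.swap, subst (4) sum.swap, subst (3) sum.swap) (simp add: mult_ac)
    then show ?thesis using S(2) unfolding totally_tracefree_3 contr1_trace by (simp add: trace_form_zero)
  qed
  let ?n = "real CARD('n)"
  have n': "?n - 1 \<noteq> 0" "?n - 2 \<noteq> 0" using n by auto
  \<comment> \<open>\<open>g\<close> is the multiple of the Schouten tensor of the curvature-like tensor \<open>?K\<close>, and \<open>H\<close> its trace,
    so that \<open>?K\<close> minus the product with \<open>g\<close> is trace-free.\<close>
  define H where "H = - trace_form \<gamma> s / (2 * (?n - 1))"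
  define g where "g = (\<lambda>k l. (- s k l - H * \<gamma> $ k $ l) / (?n - 2))"
  have g_sym: "g k l = g l k" for k l using s_sym \<gamma>_sym unfolding g_def by metis
  have trg: "trace_form \<gamma> g = H"
  proof -
    have "trace_form \<gamma> g = (2 * (?n - 1) * H - H * ?n) / (?n - 2)"
      using n' unfolding g_def by (simp add: trace_form_linear trace_form_\<gamma> H_def)
    also have "2 * (?n - 1) * H - H * ?n = (?n - 2) * H" by (simp add: algebra_simps)
    finally show ?thesis using n'(2) by simp
  qed
  have gs: "s k l = - (?n - 2) * g k l - H * \<gamma> $ k $ l" for k l
  proof -
    have "(?n - 2) * g k l = - s k l - H * \<gamma> $ k $ l" using n' by (simp add: g_def)
    then show ?thesis by (simp only: mult_minus_left)
  qed
  let ?K = "\<lambda>i j k l. ?C i j k l - ?C i k j l"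
  let ?N = "\<lambda>g i j k l. \<gamma> $ i $ j * g k l + \<gamma> $ k $ l * g i j - \<gamma> $ i $ k * g j l - \<gamma> $ j $ l * g i k"
  let ?T0 = "tens4 (\<lambda>i j k l. ?K i j k l - ?N g i j k l)"
  have trs: "trace_form \<gamma> (\<lambda>a b. ?C a j b l) = s j l" "trace_form \<gamma> (\<lambda>a b. ?C a j l b) = s j l"
    "trace_form \<gamma> (\<lambda>a b. ?C j a b l) = s j l" "trace_form \<gamma> (\<lambda>a b. ?C j a l b) = s j l"
    "trace_form \<gamma> (\<lambda>a b. ?C j l a b) = 0" for j l
    using tr0[of j l]
    by (simp_all only: s_def Cs(1)[of j _ _ l] Cs(1)[of j _ l] Cs(2)[of _ j l] Cs(3)[of j l])
  have trs': "trace_form \<gamma> (\<lambda>a b. ?C j b a l) = s j l" for j l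
    by (subst trace_form_flip) (rule trs(3))
  have tf: "totally_tracefree \<gamma> 4 ?T0"
    unfolding totally_tracefree_4
    by (simp add: tens4_def trace_form_linear trace_form_\<gamma> trace_form_contract trg trs trs' tr0 gs
        g_sym[of _ ] \<gamma>_sym algebra_simps)
  have pt: "pure_trace \<gamma> 4 (\<lambda>I. tens4 ?K I - ?T0 I)"
    unfolding pure_trace_4
    by (rule exI[of _ g], rule exI[of _ "\<lambda>j l. - g j l"], rule exI[of _ "\<lambda>_ _. 0"], rule exI[of _ "\<lambda>_ _. 0"],
       rule exI[of _ "\<lambda>j l. - g j l"], rule exI[of _ g]) (simp add: tens4_def)
  have "pure_trace \<gamma> 4 (\<lambda>I. tens4 ?K I - tf_part \<gamma> 4 (tens4 ?K) I)"
    by (rule tf_part_props[OF tf pt])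
  then obtain A B C D E F where K: "\<And>i j k l. ?K i j k l = \<gamma> $ i $ j * A k l + \<gamma> $ i $ k * B j l + \<gamma> $ i $ l * C j k
      + \<gamma> $ j $ k * D i l + \<gamma> $ j $ l * E i k + \<gamma> $ k $ l * F i j"
    using star unfolding star_condition_def pure_trace_4 by (auto simp: tens4_def)
  \<comment> \<open>Averaging over the symmetries of \<open>?K\<close> collects the six coefficients in a single one.\<close>
  define G where "G = (\<lambda>k l. A k l - B k l - E l k + F l k)"
  have G4: "4 * ?K i j k l = \<gamma> $ i $ j * G k l - \<gamma> $ i $ k * G j l + \<gamma> $ k $ l * G j i - \<gamma> $ j $ l * G k i" for i j k l
  proof -
    have "?C l j k i = ?C i k j l" "?C l k j i = ?C i j k l"
      using Cs(1)[of i k j l] Cs(2)[of k i j l] Cs(3)[of k i l j] Cs(1)[of l j k i]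
        Cs(1)[of i j k l] Cs(2)[of j i k l] Cs(3)[of j i l k] Cs(1)[of l k j i] by simp_all
    then have "?K i j k l = - ?K i k j l" "?K i j k l = - ?K l j k i" "?K i j k l = ?K l k j i" by simp_all
    then have "4 * ?K i j k l = ?K i j k l - ?K i k j l - ?K l j k i + ?K l k j i" by simp
    also have "\<dots> = \<gamma> $ i $ j * G k l - \<gamma> $ i $ k * G j l + \<gamma> $ k $ l * G j i - \<gamma> $ j $ l * G k i"
      unfolding K G_def \<gamma>_sym[of l k] \<gamma>_sym[of l j] \<gamma>_sym[of l i] \<gamma>_sym[of k j] \<gamma>_sym[of k i] \<gamma>_sym[of j i]
      by (simp add: algebra_simps)
    finally show ?thesis .
  qed
  have "?K i j k l = ?N (\<lambda>k l. (G k l + G l k) / 8) i j k l" for i j k l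
  proof -
    have "?C j i l k = ?C i j k l" "?C j l i k = ?C i k j l"
      using Cs(1)[of j i l k] Cs(2)[of i j l k] Cs(3)[of j l i k] by simp_all
    then have "?K j i l k = ?K i j k l" by simp
    then have "8 * ?K i j k l = 4 * ?K i j k l + 4 * ?K j i l k" by simp
    also have "\<dots> = 8 * ?N (\<lambda>k l. (G k l + G l k) / 8) i j k l"
      unfolding G4 \<gamma>_sym[of l k] \<gamma>_sym[of l j] \<gamma>_sym[of k i] \<gamma>_sym[of j i]
      by (simp add: field_simps)
    finally show ?thesis by simp
  qed
  then show ?thesis by (intro exI[of _ "\<lambda>k l. (G k l + G l k) / 8"]) (simp add: add.commute)
qed

end

section \<open>The Frobenius algebra of a tensor satisfying the star condition\<close>

text \<open>The condition \<open>(*)\<close> in invariant form.  The product \<open>\<odot>\<close> is the cubic tensor with one index raised,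
  \<open>hop\<close> the symmetric operator in the Kulkarni-Nomizu product, and \<open>e\<close>, \<open>f\<close> are dual bases of a space of
  dimension \<open>N\<close>.\<close>

locale star_algebra =
  fixes \<beta> :: "'v::euclidean_space \<Rightarrow> 'v \<Rightarrow> real" and star :: "'v \<Rightarrow> 'v \<Rightarrow> 'v" (infixl "\<odot>" 70)
    and hop :: "'v \<Rightarrow> 'v" and e f :: "'i::finite \<Rightarrow> 'v" and N :: real
  assumes \<beta>_bilinear: "bilinear \<beta>" and \<beta>_sym: "\<beta> u v = \<beta> v u"
    and star_bilinear: "bilinear star" and star_comm: "u \<odot> v = v \<odot> u"
    and star_adj: "\<beta> (u \<odot> v) w = \<beta> u (v \<odot> w)"
    and hop_linear: "linear hop" and hop_adj: "\<beta> (hop u) v = \<beta> u (hop v)"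
    and curvature: "x \<odot> v \<odot> w + \<beta> x v *\<^sub>R hop w + \<beta> (hop x) v *\<^sub>R w
        = x \<odot> w \<odot> v + \<beta> x w *\<^sub>R hop v + \<beta> (hop x) w *\<^sub>R v"
    and expand: "(\<Sum>a\<in>UNIV. \<beta> v (f a) *\<^sub>R e a) = v" and expand': "(\<Sum>a\<in>UNIV. \<beta> v (e a) *\<^sub>R f a) = v"
    and dimension: "(\<Sum>a\<in>UNIV. \<beta> (e a) (f a)) = N" "N \<ge> 2"
begin

lemma \<beta>_simps [simp]: "\<beta> (u + u') v = \<beta> u v + \<beta> u' v" "\<beta> u (v + v') = \<beta> u v + \<beta> u v'"
  "\<beta> (u - u') v = \<beta> u v - \<beta> u' v" "\<beta> u (v - v') = \<beta> u v - \<beta> u v'"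
  "\<beta> (c *\<^sub>R u) v = c * \<beta> u v" "\<beta> u (c *\<^sub>R v) = c * \<beta> u v" "\<beta> 0 v = 0" "\<beta> u 0 = 0"
  using \<beta>_bilinear by (simp_all add: bilinear_ladd bilinear_radd bilinear_lsub bilinear_rsub bilinear_lmul
      bilinear_rmul bilinear_lzero bilinear_rzero)

lemma star_simps [simp]: "(u + u') \<odot> v = u \<odot> v + u' \<odot> v" "u \<odot> (v + v') = u \<odot> v + u \<odot> v'"
  "(u - u') \<odot> v = u \<odot> v - u' \<odot> v" "u \<odot> (v - v') = u \<odot> v - u \<odot> v'"
  "(c *\<^sub>R u) \<odot> v = c *\<^sub>R (u \<odot> v)" "u \<odot> (c *\<^sub>R v) = c *\<^sub>R (u \<odot> v)" "0 \<odot> v = 0" "u \<odot> 0 = 0"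
  using star_bilinear by (simp_all add: bilinear_ladd bilinear_radd bilinear_lsub bilinear_rsub bilinear_lmul
      bilinear_rmul bilinear_lzero bilinear_rzero)

lemma hop_simps [simp]: "hop (u + v) = hop u + hop v" "hop (u - v) = hop u - hop v" "hop (c *\<^sub>R u) = c *\<^sub>R hop u" "hop 0 = 0"
  using hop_linear by (simp_all add: linear_add linear_diff linear_scale linear_0)

lemma \<beta>_sum: "\<beta> (\<Sum>a\<in>A. g a) v = (\<Sum>a\<in>A. \<beta> (g a) v)" "\<beta> v (\<Sum>a\<in>A. g a) = (\<Sum>a\<in>A. \<beta> v (g a))"
  by (induction A rule: infinite_finite_induct) auto

lemma expand_linear:
  assumes "linear \<phi>" shows "(\<Sum>a\<in>UNIV. \<beta> v (f a) *\<^sub>R \<phi> (e a)) = \<phi> v"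
  using arg_cong[OF expand[of v], of \<phi>] by (simp add: linear_sum[OF assms] linear_scale[OF assms])

lemma \<beta>_nondegenerate:
  assumes "\<And>w. \<beta> u w = \<beta> v w" shows "u = v"
proof -
  have "(\<Sum>a\<in>UNIV. \<beta> u (f a) *\<^sub>R e a) = (\<Sum>a\<in>UNIV. \<beta> v (f a) *\<^sub>R e a)" by (simp only: assms)
  then show ?thesis by (simp only: expand)
qed

definition K :: "'v \<Rightarrow> 'v \<Rightarrow> 'v" where "K p i = p \<odot> hop i - i \<odot> hop p"

lemma K_linear: "linear (\<lambda>i. K p i)" "linear (\<lambda>p. K p i)"
  by (auto intro!: linearI simp: K_def algebra_simps)

lemma K_anti: "K i p = - K p i"
  by (simp add: K_def)

text \<open>The curvature condition computes the commutators of the multiplication operators.\<close>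

lemma commutator: "i \<odot> (j \<odot> x) - j \<odot> (i \<odot> x) =
   \<beta> x i *\<^sub>R hop j + \<beta> x (hop i) *\<^sub>R j - \<beta> x j *\<^sub>R hop i - \<beta> x (hop j) *\<^sub>R i"
proof -
  have "j \<odot> x = x \<odot> j" "i \<odot> x = x \<odot> i" "i \<odot> (x \<odot> j) = x \<odot> j \<odot> i" "j \<odot> (x \<odot> i) = x \<odot> i \<odot> j"
    by (rule star_comm)+
  then show ?thesis using curvature[of x j i] by (simp add: hop_adj algebra_simps)
qed

text \<open>Inserting the commutators in the Jacobi identity for three multiplication operators leaves an
  identity linear in \<open>K\<close>, twice the antisymmetric part of \<open>p \<odot> hop i\<close>.\<close>

lemma K_cyclic: "\<beta> x j *\<^sub>R K p i + \<beta> x (K p i) *\<^sub>R j + \<beta> x p *\<^sub>R K i j + \<beta> x (K i j) *\<^sub>R p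
   + \<beta> x i *\<^sub>R K j p + \<beta> x (K j p) *\<^sub>R i = 0"
proof -
  define R where "R = (\<lambda>i j x. i \<odot> (j \<odot> x) - j \<odot> (i \<odot> x))"
  have R: "R i j x = \<beta> x i *\<^sub>R hop j + \<beta> x (hop i) *\<^sub>R j - \<beta> x j *\<^sub>R hop i - \<beta> x (hop j) *\<^sub>R i" for i j x
    unfolding R_def by (rule commutator)
  have "(p \<odot> R i j x - R i j (p \<odot> x)) + (i \<odot> R j p x - R j p (i \<odot> x)) + (j \<odot> R p i x - R p i (j \<odot> x)) = 0"
    unfolding R_def by (simp add: algebra_simps)
  moreover have adj: "\<beta> (u \<odot> x) v = \<beta> x (u \<odot> v)" for u v
    by (metis star_comm star_adj)
  ultimately show ?thesis
    unfolding R adj K_def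
    by (simp add: star_comm[of i p] star_comm[of j p] star_comm[of j i] algebra_simps)
qed

text \<open>The trace of \<open>K\<close>, normalised, and the vector dual to it.\<close>

definition \<kappa> :: "'v \<Rightarrow> real" where "\<kappa> i = (\<Sum>a\<in>UNIV. \<beta> (f a) (K i (e a)))"
definition \<omega> :: "'v \<Rightarrow> real" where "\<omega> i = \<kappa> i / (N - 1)"
definition wv :: 'v where "wv = (\<Sum>a\<in>UNIV. \<omega> (e a) *\<^sub>R f a)"

lemma \<kappa>_linear: "linear \<kappa>"
proof -
  have "\<kappa> (u + v) = \<kappa> u + \<kappa> v" "\<kappa> (c *\<^sub>R u) = c * \<kappa> u" for u v c
    using linear_add[OF K_linear(2)] linear_scale[OF K_linear(2)]
    by (simp_all add: \<kappa>_def sum.distrib sum_distrib_left)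
  then show ?thesis by (auto intro!: linearI)
qed

lemma \<omega>_wv: "\<beta> v wv = \<omega> v"
proof -
  have l: "linear \<omega>" using \<kappa>_linear unfolding \<omega>_def
    by (auto intro!: linearI simp: linear_add linear_scale add_divide_distrib)
  have "\<beta> v wv = (\<Sum>a\<in>UNIV. \<beta> v (f a) *\<^sub>R \<omega> (e a))" by (simp add: wv_def \<beta>_sum mult.commute)
  then show ?thesis using expand_linear[OF l] by simp
qed

text \<open>Tracing the cyclic identity solves it for \<open>K\<close>.\<close>

lemma K_eq: "p \<odot> hop i - i \<odot> hop p = \<omega> p *\<^sub>R i - \<omega> i *\<^sub>R p"
proof -
  have "(\<Sum>a\<in>UNIV. \<beta> (f a) (e a) *\<^sub>R K p i + \<beta> (f a) (K p i) *\<^sub>R e a + \<beta> (f a) p *\<^sub>R K i (e a)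
    + \<beta> (f a) (K i (e a)) *\<^sub>R p + \<beta> (f a) i *\<^sub>R K (e a) p + \<beta> (f a) (K (e a) p) *\<^sub>R i) = 0"
    by (simp add: K_cyclic)
  moreover have "(\<Sum>a\<in>UNIV. \<beta> (f a) (e a) *\<^sub>R K p i) = N *\<^sub>R K p i"
    using dimension(1) by (simp add: scaleR_sum_left[symmetric] \<beta>_sym[of "f _"])
  moreover have "(\<Sum>a\<in>UNIV. \<beta> (f a) (K p i) *\<^sub>R e a) = K p i"
    using expand[of "K p i"] by (simp add: \<beta>_sym[of "f _"])
  moreover have "(\<Sum>a\<in>UNIV. \<beta> (f a) p *\<^sub>R K i (e a)) = K i p"
    using expand_linear[OF K_linear(1), of p i] by (simp add: \<beta>_sym[of "f _"])
  moreover have "(\<Sum>a\<in>UNIV. \<beta> (f a) (K i (e a)) *\<^sub>R p) = \<kappa> i *\<^sub>R p"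
    by (simp add: \<kappa>_def scaleR_sum_left)
  moreover have "(\<Sum>a\<in>UNIV. \<beta> (f a) i *\<^sub>R K (e a) p) = K i p"
    using expand_linear[OF K_linear(2), of i p] by (simp add: \<beta>_sym[of "f _"])
  moreover have "(\<Sum>a\<in>UNIV. \<beta> (f a) (K (e a) p) *\<^sub>R i) = - \<kappa> p *\<^sub>R i"
  proof -
    have "\<beta> (f a) (K (e a) p) = - \<beta> (f a) (K p (e a))" for a
      using \<beta>_simps(4)[of "f a" 0 "K p (e a)"] by (simp add: K_anti[of "e a" p])
    then show ?thesis by (simp add: \<kappa>_def scaleR_sum_left[symmetric] sum_negf)
  qed
  ultimately have "N *\<^sub>R K p i + K p i + K i p + \<kappa> i *\<^sub>R p + K i p + - \<kappa> p *\<^sub>R i = 0"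
    by (simp add: sum.distrib)
  then have "(N - 1) *\<^sub>R K p i = \<kappa> p *\<^sub>R i - \<kappa> i *\<^sub>R p"
    unfolding K_anti[of i p] by (simp add: algebra_simps)
  then have "(1 / (N - 1)) *\<^sub>R ((N - 1) *\<^sub>R K p i) = (1 / (N - 1)) *\<^sub>R (\<kappa> p *\<^sub>R i - \<kappa> i *\<^sub>R p)" by simp
  then have "K p i = \<omega> p *\<^sub>R i - \<omega> i *\<^sub>R p" using dimension(2) by (simp add: \<omega>_def scaleR_diff_right)
  then show ?thesis by (simp add: K_def)
qed

text \<open>The preceding identity read through the invariant form.\<close>

lemma hop_star: "hop (j \<odot> x) = j \<odot> hop x + \<omega> x *\<^sub>R j - \<beta> x j *\<^sub>R wv"
proof (rule \<beta>_nondegenerate)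
  fix i
  have "\<beta> (hop (j \<odot> x)) i = \<beta> j (x \<odot> hop i)" by (simp add: hop_adj star_adj)
  also have "x \<odot> hop i = i \<odot> hop x + \<omega> x *\<^sub>R i - \<omega> i *\<^sub>R x" using K_eq[of x i] by (simp add: algebra_simps)
  also have "\<beta> j \<dots> = \<beta> (j \<odot> i) (hop x) + \<omega> x * \<beta> j i - \<omega> i * \<beta> j x" by (simp add: star_adj)
  also have "\<beta> (j \<odot> i) (hop x) = \<beta> (j \<odot> hop x) i" by (metis \<beta>_sym star_adj star_comm)
  finally show "\<beta> (hop (j \<odot> x)) i = \<beta> (j \<odot> hop x + \<omega> x *\<^sub>R j - \<beta> x j *\<^sub>R wv) i"
    using \<omega>_wv[of i] by (simp add: \<beta>_sym[of wv i] \<beta>_sym[of x j])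
qed

lemma wv_\<omega>: "\<beta> wv v = \<omega> v"
  using \<omega>_wv[of v] by (simp add: \<beta>_sym)

definition Dv :: "'v \<Rightarrow> 'v" where "Dv u = hop (hop u) - wv \<odot> u"
definition z :: real where "z = (\<Sum>a\<in>UNIV. \<beta> (f a) (Dv (e a))) / N"

text \<open>Here \<open>hop\<close> is applied to the commutator formula; moved past the products with \<open>hop_star\<close>, it leaves
  a relation for the operator \<open>Dv\<close>, which tracing identifies as a multiple of the identity.\<close>

lemma Dv_exchange: "\<beta> x j *\<^sub>R Dv i + \<beta> x (Dv i) *\<^sub>R j = \<beta> x i *\<^sub>R Dv j + \<beta> x (Dv j) *\<^sub>R i"
proof -
  have adj: "\<beta> (u \<odot> x) v = \<beta> x (u \<odot> v)" for u v
    by (metis star_comm star_adj)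
  have om: "\<omega> (u \<odot> x) = \<beta> x (wv \<odot> u)" for u
    unfolding \<omega>_wv[symmetric] adj by (simp add: star_comm)
  have "hop (i \<odot> (j \<odot> x) - j \<odot> (i \<odot> x)) = (i \<odot> (j \<odot> hop x) - j \<odot> (i \<odot> hop x))
     - (\<beta> x j *\<^sub>R (i \<odot> wv) + \<beta> x (wv \<odot> i) *\<^sub>R j - \<beta> x i *\<^sub>R (j \<odot> wv) - \<beta> x (wv \<odot> j) *\<^sub>R i) + 0"
    (is "?l = ?r")
  proof -
    have "?l = (i \<odot> hop (j \<odot> x) + \<omega> (j \<odot> x) *\<^sub>R i - \<beta> (j \<odot> x) i *\<^sub>R wv) - (j \<odot> hop (i \<odot> x) + \<omega> (i \<odot> x) *\<^sub>R j - \<beta> (i \<odot> x) j *\<^sub>R wv)"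
      by (simp only: hop_simps hop_star[of i "j \<odot> x"] hop_star[of j "i \<odot> x"])
    also have "\<dots> = ?r"
      unfolding hop_star[of j x] hop_star[of i x] om adj
      by (simp add: star_comm[of i j] algebra_simps)
    finally show ?thesis .
  qed
  then show ?thesis
    unfolding commutator Dv_def by (simp add: hop_adj star_comm[of wv] algebra_simps)
qed

lemma hop_hop: "hop (hop u) = wv \<odot> u + z *\<^sub>R u"
proof -
  have Dl: "linear Dv" by (auto intro!: linearI simp: Dv_def algebra_simps)
  have "(\<Sum>a\<in>UNIV. \<beta> (f a) (e a) *\<^sub>R Dv u + \<beta> (f a) (Dv u) *\<^sub>R e a)
     = (\<Sum>a\<in>UNIV. \<beta> (f a) u *\<^sub>R Dv (e a) + \<beta> (f a) (Dv (e a)) *\<^sub>R u)"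
    by (simp add: Dv_exchange)
  moreover have "(\<Sum>a\<in>UNIV. \<beta> (f a) (e a) *\<^sub>R Dv u) = N *\<^sub>R Dv u"
    using dimension(1) by (simp add: scaleR_sum_left[symmetric] \<beta>_sym[of "f _"])
  moreover have "(\<Sum>a\<in>UNIV. \<beta> (f a) (Dv u) *\<^sub>R e a) = Dv u"
    using expand[of "Dv u"] by (simp add: \<beta>_sym[of "f _"])
  moreover have "(\<Sum>a\<in>UNIV. \<beta> (f a) u *\<^sub>R Dv (e a)) = Dv u"
    using expand_linear[OF Dl, of u] by (simp add: \<beta>_sym[of "f _"])
  moreover have "(\<Sum>a\<in>UNIV. \<beta> (f a) (Dv (e a)) *\<^sub>R u) = (N * z) *\<^sub>R u"
    using dimension(2) by (simp add: z_def scaleR_sum_left)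
  ultimately have "N *\<^sub>R Dv u = N *\<^sub>R (z *\<^sub>R u)" by (simp add: sum.distrib)
  moreover have "N \<noteq> 0" using dimension(2) by auto
  ultimately have "Dv u = z *\<^sub>R u" using scaleR_left_imp_eq by blast
  then show ?thesis by (simp add: Dv_def algebra_simps)
qed

text \<open>The algebra: a null unit \<open>(1, 0, 0)\<close>, a complementary null vector \<open>(0, 0, 1)\<close>, and the given
  product on the middle factor, corrected by the two forms.\<close>

definition mul :: "real \<times> 'v \<times> real \<Rightarrow> real \<times> 'v \<times> real \<Rightarrow> real \<times> 'v \<times> real" where
  "mul X Y = (case (X, Y) of ((a, u, b), (a', u', b')) \<Rightarrow>
    (a * a' + \<beta> (hop u) u' + b * \<omega> u' + b' * \<omega> u + z * b * b',
     a *\<^sub>R u' + a' *\<^sub>R u + u \<odot> u' + b *\<^sub>R hop u' + b' *\<^sub>R hop u + (b * b') *\<^sub>R wv,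
     a * b' + a' * b + \<beta> u u'))"

definition unit :: "real \<times> 'v \<times> real" where "unit = (1, 0, 0)"

definition frob :: "real \<times> 'v \<times> real \<Rightarrow> real \<times> 'v \<times> real \<Rightarrow> real" where
  "frob X Y = snd (snd (mul X Y))"

lemma \<omega>_simps [simp]: "\<omega> (u + v) = \<omega> u + \<omega> v" "\<omega> (c *\<^sub>R u) = c * \<omega> u" "\<omega> 0 = 0"
  by (simp_all flip: \<omega>_wv)

lemma mul_comm: "mul X Y = mul Y X"
  by (cases X; cases Y) (simp add: mul_def star_comm[of "fst (snd Y)"] hop_adj \<beta>_sym add_ac mult_ac,
     metis \<beta>_sym hop_adj star_comm)

lemma mul_unit: "mul unit X = X" "mul X unit = X"
  by (cases X; simp add: mul_def unit_def)+

lemma mul_bilinear: "bounded_bilinear mul"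
  unfolding bilinear_conv_bounded_bilinear[symmetric] bilinear_def
  by (auto intro!: linearI simp: mul_def algebra_simps scaleR_prod_def)

text \<open>Associativity on the middle factor is the curvature identity; mixed products need \<open>K_eq\<close>,
  \<open>hop_star\<close> and \<open>hop_hop\<close>.\<close>

lemma mul_assoc: "mul (mul X Y) Z = mul X (mul Y Z)"
proof -
  obtain a1 u1 b1 where X: "X = (a1, u1, b1)" by (cases X)
  obtain a2 u2 b2 where Y: "Y = (a2, u2, b2)" by (cases Y)
  obtain a3 u3 b3 where Z: "Z = (a3, u3, b3)" by (cases Z)
  have s3: "u1 \<odot> u2 \<odot> u3 = u1 \<odot> (u2 \<odot> u3) + \<beta> u2 u3 *\<^sub>R hop u1 + \<beta> u2 (hop u3) *\<^sub>R u1 - \<beta> u1 u2 *\<^sub>R hop u3 - \<beta> u1 (hop u2) *\<^sub>R u3"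
    using curvature[of u2 u1 u3] by (simp add: hop_adj star_comm[of u2 u1] star_comm[of "u2 \<odot> u3" u1] \<beta>_sym[of u2 u1]
        \<beta>_sym[of "u2" "hop u1"] algebra_simps)
  have Kx: "u2 \<odot> hop u1 = u1 \<odot> hop u2 - \<omega> u1 *\<^sub>R u2 + \<omega> u2 *\<^sub>R u1" 
    "u3 \<odot> hop u2 = u2 \<odot> hop u3 - \<omega> u2 *\<^sub>R u3 + \<omega> u3 *\<^sub>R u2" 
    "u3 \<odot> hop u1 = u1 \<odot> hop u3 - \<omega> u1 *\<^sub>R u3 + \<omega> u3 *\<^sub>R u1"
    using K_eq[of u1 u2] K_eq[of u2 u3] K_eq[of u1 u3] by (simp_all add: algebra_simps)
  have cm: "hop u1 \<odot> u2 = u2 \<odot> hop u1" "hop u2 \<odot> u3 = u3 \<odot> hop u2" "hop u1 \<odot> u3 = u3 \<odot> hop u1"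
    "wv \<odot> u3 = u3 \<odot> wv" "u1 \<odot> wv = wv \<odot> u1" by (rule star_comm)+
  have hh: "hop (hop u1) = wv \<odot> u1 + z *\<^sub>R u1" "hop (hop u2) = wv \<odot> u2 + z *\<^sub>R u2" "hop (hop u3) = u3 \<odot> wv + z *\<^sub>R u3"
    using hop_hop star_comm by metis+
  have hs: "hop (u1 \<odot> u2) = u1 \<odot> hop u2 + \<omega> u2 *\<^sub>R u1 - \<beta> u1 u2 *\<^sub>R wv"
    "hop (u2 \<odot> u3) = u2 \<odot> hop u3 + \<omega> u3 *\<^sub>R u2 - \<beta> u2 u3 *\<^sub>R wv"
    using hop_star[of u1 u2] hop_star[of u2 u3] by (simp_all add: \<beta>_sym)
  have v: "fst (snd (mul (mul X Y) Z)) = fst (snd (mul X (mul Y Z)))"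
    by (simp add: X Y Z mul_def cm s3 Kx hh hs algebra_simps hop_adj \<beta>_sym[of u3] \<beta>_sym[of u2 u1] \<beta>_sym[of "hop _"])
  have p: "snd (snd (mul (mul X Y) Z)) = snd (snd (mul X (mul Y Z)))"
    by (simp add: X Y Z mul_def algebra_simps hop_adj star_adj \<omega>_wv wv_\<omega>)
  have om: "\<omega> (u \<odot> v) = \<beta> u (hop (hop v)) - z * \<beta> u v" for u v
  proof -
    have "\<omega> (u \<odot> v) = \<beta> u (v \<odot> wv)" unfolding \<omega>_wv[symmetric] star_adj ..
    then show ?thesis by (simp add: hop_hop star_comm[of v wv])
  qed
  have q: "fst (mul (mul X Y) Z) = fst (mul X (mul Y Z))"
  proof -
    have 1: "\<beta> (u1 \<odot> u2) (hop u3) = \<beta> u1 (u2 \<odot> hop u3)" by (rule star_adj)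
    have 2: "\<beta> u1 (hop (u2 \<odot> u3)) = \<beta> u1 (u2 \<odot> hop u3) + \<omega> u3 * \<beta> u1 u2 - \<beta> u2 u3 * \<omega> u1"
      unfolding hs by (simp add: \<omega>_wv)
    have 3: "\<omega> (hop u) = \<beta> u (hop wv)" for u unfolding \<omega>_wv[symmetric] by (rule hop_adj)
    show ?thesis
      by (simp add: X Y Z mul_def om 1 2 3 algebra_simps hop_adj \<omega>_wv wv_\<omega>)
  qed
  show ?thesis using v p q by (simp add: prod_eq_iff)
qed

lemma frob_assoc: "frob (mul X Y) Z = frob X (mul Y Z)"
  by (simp add: frob_def mul_assoc)

end

text \<open>A multiple of a tensor plus a trace term again satisfies the condition.  The shifted operator is
  found by expanding the iterated product: its terms with \<open>\<beta>\<close> as a factor are absorbed in \<open>hop\<close>.\<close>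

lemma star_algebra_shift:
  assumes "star_algebra \<beta> star hop e f N"
  shows "star_algebra \<beta> (\<lambda>u v. c *\<^sub>R star u v + \<beta> n u *\<^sub>R v + \<beta> n v *\<^sub>R u + \<beta> u v *\<^sub>R n)
    (\<lambda>u. (c * c) *\<^sub>R hop u - c *\<^sub>R star n u - \<beta> n u *\<^sub>R n - (\<beta> n n / 2) *\<^sub>R u) e f N"
proof -
  interpret star_algebra \<beta> star hop e f N by fact
  let ?h = "\<lambda>u. (c * c) *\<^sub>R hop u - c *\<^sub>R star n u - \<beta> n u *\<^sub>R n - (\<beta> n n / 2) *\<^sub>R u"
  show ?thesis
  proof (rule star_algebra.intro)
    show "bilinear (\<lambda>u v. c *\<^sub>R star u v + \<beta> n u *\<^sub>R v + \<beta> n v *\<^sub>R u + \<beta> u v *\<^sub>R n)"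
      unfolding bilinear_def by (auto intro!: linearI simp: algebra_simps)
    show "c *\<^sub>R star u v + \<beta> n u *\<^sub>R v + \<beta> n v *\<^sub>R u + \<beta> u v *\<^sub>R n =
      c *\<^sub>R star v u + \<beta> n v *\<^sub>R u + \<beta> n u *\<^sub>R v + \<beta> v u *\<^sub>R n" for u v
      by (simp add: star_comm[of v u] \<beta>_sym[of v u])
    show "\<beta> (c *\<^sub>R star u v + \<beta> n u *\<^sub>R v + \<beta> n v *\<^sub>R u + \<beta> u v *\<^sub>R n) w =
       \<beta> u (c *\<^sub>R star v w + \<beta> n v *\<^sub>R w + \<beta> n w *\<^sub>R v + \<beta> v w *\<^sub>R n)" for u v w
      by (simp add: star_adj \<beta>_sym[of n] algebra_simps)
    show "linear ?h" by (rule linearI) (simp_all add: algebra_simps)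
    have nu: "\<beta> (star n u) v = \<beta> u (star n v)" for u v
    proof -
      have "\<beta> (star n u) v = \<beta> (star u n) v" by (simp only: star_comm[of n u])
      then show ?thesis by (simp only: star_adj)
    qed
    show "\<beta> (?h u) v = \<beta> u (?h v)" for u v
      using \<beta>_sym[of u n] by (simp add: nu hop_adj)
    fix x v w
    define q where "q = \<beta> n n / 2"
    have q: "\<beta> n n = q + q" "(q + q) / 2 = q" by (simp_all add: q_def)
    have two: "(2 * a) *\<^sub>R v = a *\<^sub>R v + a *\<^sub>R v" "(b * (2 * a)) *\<^sub>R v = (b * a) *\<^sub>R v + (b * a) *\<^sub>R v"
      for a b and v :: 'a
      by (simp_all add: scaleR_left_distrib[symmetric])
    have 1: "star (star x v) w = star (star x w) v + \<beta> x w *\<^sub>R hop v + \<beta> (hop x) w *\<^sub>R v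
      - \<beta> x v *\<^sub>R hop w - \<beta> (hop x) v *\<^sub>R w" using curvature[of x v w] by (simp add: algebra_simps)
    have 2: "star v w = star w v" by (rule star_comm)
    have 3: "\<beta> (star n x) v = \<beta> n (star x v)" "\<beta> (star n x) w = \<beta> n (star x w)" by (rule star_adj)+
    have 4: "\<beta> (star x v) w = \<beta> x (star w v)" "\<beta> (star x w) v = \<beta> x (star w v)" by (simp_all only: star_adj 2)
    have 5: "\<beta> v w = \<beta> w v" "\<beta> x n = \<beta> n x" "\<beta> v n = \<beta> n v" "\<beta> w n = \<beta> n w" by (rule \<beta>_sym)+
    show "c *\<^sub>R star (c *\<^sub>R star x v + \<beta> n x *\<^sub>R v + \<beta> n v *\<^sub>R x + \<beta> x v *\<^sub>R n) w +
       \<beta> n (c *\<^sub>R star x v + \<beta> n x *\<^sub>R v + \<beta> n v *\<^sub>R x + \<beta> x v *\<^sub>R n) *\<^sub>R w +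
       \<beta> n w *\<^sub>R (c *\<^sub>R star x v + \<beta> n x *\<^sub>R v + \<beta> n v *\<^sub>R x + \<beta> x v *\<^sub>R n) +
       \<beta> (c *\<^sub>R star x v + \<beta> n x *\<^sub>R v + \<beta> n v *\<^sub>R x + \<beta> x v *\<^sub>R n) w *\<^sub>R n +
       \<beta> x v *\<^sub>R ?h w + \<beta> (?h x) v *\<^sub>R w =
       c *\<^sub>R star (c *\<^sub>R star x w + \<beta> n x *\<^sub>R w + \<beta> n w *\<^sub>R x + \<beta> x w *\<^sub>R n) v +
       \<beta> n (c *\<^sub>R star x w + \<beta> n x *\<^sub>R w + \<beta> n w *\<^sub>R x + \<beta> x w *\<^sub>R n) *\<^sub>R v +
       \<beta> n v *\<^sub>R (c *\<^sub>R star x w + \<beta> n x *\<^sub>R w + \<beta> n w *\<^sub>R x + \<beta> x w *\<^sub>R n) +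
       \<beta> (c *\<^sub>R star x w + \<beta> n x *\<^sub>R w + \<beta> n w *\<^sub>R x + \<beta> x w *\<^sub>R n) v *\<^sub>R n +
       \<beta> x w *\<^sub>R ?h v + \<beta> (?h x) w *\<^sub>R v"
      by (simp add: 1 2 3 4 5 q two algebra_simps)
  qed (rule \<beta>_bilinear \<beta>_sym expand expand' dimension)+
qed

context nondegenerate_form
begin

definition bform :: "real^'n \<Rightarrow> real^'n \<Rightarrow> real" where "bform u v = u \<bullet> (\<gamma> *v v)"
definition raise :: "('n \<Rightarrow> real) \<Rightarrow> real^'n" where "raise \<phi> = matrix_inv \<gamma> *v (\<chi> k. \<phi> k)"

lemma bform_axis: "bform u (axis l 1) = (\<Sum>k\<in>UNIV. \<gamma> $ l $ k * u $ k)" "bform (axis i 1) (axis j 1) = \<gamma> $ i $ j"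
proof -
  have "bform u (axis l 1) = (\<Sum>k\<in>UNIV. u $ k * \<gamma> $ k $ l)" for u l
    unfolding bform_def inner_vec_def by (simp add: matrix_vector_mult_def axis_def sum_delta)
  then show 1: "bform u (axis l 1) = (\<Sum>k\<in>UNIV. \<gamma> $ l $ k * u $ k)" for u l
    by (simp add: \<gamma>_sym[of l] mult.commute)
  show "bform (axis i 1) (axis j 1) = \<gamma> $ i $ j"
    unfolding 1 by (simp add: axis_def sum_delta \<gamma>_sym[of j i])
qed

lemma bform_bilinear: "bilinear bform"
  unfolding bform_def bilinear_def
  by (auto intro!: linearI simp: inner_add_left inner_add_right matrix_vector_right_distrib matrix_vector_mult_scaleR)

lemma bform_sym: "bform u v = bform v u"
proof -
  have e: "bform u v = (\<Sum>i\<in>UNIV. \<Sum>j\<in>UNIV. u $ i * (\<gamma> $ i $ j * v $ j))" for u v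
    by (simp add: bform_def inner_vec_def matrix_vector_mult_def sum_distrib_left)
  have "bform v u = (\<Sum>j\<in>UNIV. \<Sum>i\<in>UNIV. v $ i * (\<gamma> $ i $ j * u $ j))"
    unfolding e by (rule sum.swap)
  also have "\<dots> = bform u v" unfolding e
    by (intro sum.cong refl) (simp add: \<gamma>_sym mult_ac)
  finally show ?thesis ..
qed

lemma bform_raise: "bform (raise \<phi>) v = (\<Sum>k\<in>UNIV. \<phi> k * v $ k)"
proof -
  have "bform (raise \<phi>) v = v \<bullet> (\<gamma> *v (matrix_inv \<gamma> *v (\<chi> k. \<phi> k)))"
    by (subst bform_sym) (simp add: bform_def raise_def)
  also have "\<dots> = v \<bullet> (\<chi> k. \<phi> k)" by (simp add: matrix_vector_mul_assoc ginv_mult)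
  finally show ?thesis by (simp add: inner_vec_def mult.commute)
qed

lemma bform_raise_raise: "bform (raise \<phi>) (raise \<psi>) = trace_form \<gamma> (\<lambda>a b. \<phi> a * \<psi> b)"
  unfolding bform_raise trace_form_def by (simp add: raise_def matrix_vector_mult_def sum_distrib_left mult_ac)

lemma bform_eqI: "(\<And>l. bform u (axis l 1) = bform v (axis l 1)) \<Longrightarrow> u = v"
proof -
  assume "\<And>l. bform u (axis l 1) = bform v (axis l 1)"
  then have "\<gamma> *v u = \<gamma> *v v" by (simp add: bform_axis vec_eq_iff matrix_vector_mult_def)
  then have "matrix_inv \<gamma> *v (\<gamma> *v u) = matrix_inv \<gamma> *v (\<gamma> *v v)" by simp
  then show ?thesis by (simp add: matrix_vector_mul_assoc ginv_mult)
qed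

lemma raise_add: "raise (\<lambda>k. \<phi> k + \<psi> k) = raise \<phi> + raise \<psi>"
  by (rule bform_eqI) (simp add: bilinear_ladd[OF bform_bilinear] bform_raise sum.distrib distrib_right)

lemma raise_scale: "raise (\<lambda>k. c * \<phi> k) = c *\<^sub>R raise \<phi>"
  by (rule bform_eqI) (simp add: bilinear_lmul[OF bform_bilinear] bform_raise sum_distrib_left mult_ac)

end

lemma linear_eq_axis:
  assumes "linear F" "linear G" "\<And>k. F (axis k 1) = G (axis k 1)"
  shows "F (v :: real^'n::finite) = G v"
  using linear_partials[OF assms(1), of v] linear_partials[OF assms(2), of v] by (simp only: assms(3))

lemma scaleR_sum_axis: "(\<Sum>k\<in>UNIV. axis i (1::real) $ k * g k) = g i" for i :: "'n::finite"
  by (simp add: axis_def sum_delta)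

context nondegenerate_form
begin

text \<open>A cubic tensor as a product, and a quadratic one as an operator, by raising the last index.\<close>

definition prod3 :: "('n \<Rightarrow> 'n \<Rightarrow> 'n \<Rightarrow> real) \<Rightarrow> real^'n \<Rightarrow> real^'n \<Rightarrow> real^'n" where
  "prod3 T u v = raise (\<lambda>k. \<Sum>i\<in>UNIV. u $ i * (\<Sum>j\<in>UNIV. v $ j * T i j k))"

definition op2 :: "('n \<Rightarrow> 'n \<Rightarrow> real) \<Rightarrow> real^'n \<Rightarrow> real^'n" where
  "op2 g u = raise (\<lambda>k. \<Sum>i\<in>UNIV. u $ i * g i k)"

lemma prod3_axis: "prod3 T (axis i 1) (axis j 1) = raise (T i j)"
  by (simp add: prod3_def scaleR_sum_axis)

lemma op2_axis: "op2 g (axis i 1) = raise (g i)"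
  by (simp add: op2_def scaleR_sum_axis)

lemma prod3_bilinear: "bilinear (prod3 T)"
  unfolding bilinear_def prod3_def
  by (auto intro!: linearI simp: raise_add[symmetric] raise_scale[symmetric] distrib_right distrib_left sum.distrib
      sum_distrib_left mult_ac)

lemma op2_linear: "linear (op2 g)"
  unfolding op2_def
  by (auto intro!: linearI simp: raise_add[symmetric] raise_scale[symmetric] distrib_right distrib_left sum.distrib
      sum_distrib_left mult_ac)

lemma bform_raise_axis: "bform (raise \<phi>) (axis l 1) = \<phi> l" "bform (axis l 1) (raise \<phi>) = \<phi> l"
  using bform_raise[of \<phi> "axis l 1"] scaleR_sum_axis[of l \<phi>] bform_sym[of "axis l 1"] by (simp_all add: mult.commute)

text \<open>The axioms are multilinear, and on basis vectors they are the symmetries of \<open>S\<close> and the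
  Kulkarni-Nomizu form of the condition.\<close>

lemma star_algebra_of_tensor:
  assumes n: "CARD('n) \<ge> 3" and S: "totally_symmetric 3 S" "totally_tracefree \<gamma> 3 S"
    and star: "star_condition \<gamma> S"
  shows "\<exists>hop. star_algebra bform (prod3 (\<lambda>i j k. S [i, j, k])) hop (\<lambda>a. axis a 1)
    (\<lambda>a. raise (\<lambda>k. if k = a then 1 else 0)) (real CARD('n))"
proof -
  have sym: "S [i, j, k] = S [j, i, k]" "S [i, j, k] = S [i, k, j]" for i j k
    using S(1)[unfolded totally_symmetric_def all_length_3] by (auto simp: add_mset_commute)
  obtain g where g: "\<And>i j. g i j = g j i" "\<And>i j k l. contr1 \<gamma> S i j k l - contr1 \<gamma> S i k j l =
    \<gamma> $ i $ j * g k l + \<gamma> $ k $ l * g i j - \<gamma> $ i $ k * g j l - \<gamma> $ j $ l * g i k"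
    using star_condition_kulkarni_nomizu[OF assms] by blast
  let ?T = "\<lambda>i j k. S [i, j, k]" and ?h = "op2 (\<lambda>i j. - g i j)"
  let ?e = "\<lambda>a. axis a 1 :: real^'n" and ?f = "\<lambda>a. raise (\<lambda>k. if k = a then 1 else 0)"
  note lin = bilinear_ladd bilinear_radd bilinear_lmul bilinear_rmul bilinear_lsub bilinear_rsub
  note pl = lin[OF prod3_bilinear] lin[OF bform_bilinear] linear_add[OF op2_linear] linear_scale[OF op2_linear]
  have bf: "bform v (?f a) = v $ a" for v a
    by (subst bform_sym) (simp add: bform_raise sum_delta)
  have "star_algebra bform (prod3 ?T) ?h ?e ?f (real CARD('n))"
  proof (rule star_algebra.intro)
    have comm: "prod3 ?T u v = prod3 ?T v u" for u v
    proof -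
      have "prod3 ?T u v = (\<lambda>u. prod3 ?T v u) u"
      proof (rule linear_eq_axis[of "\<lambda>u. prod3 ?T u v"])
        fix i
        show "prod3 ?T (?e i) v = prod3 ?T v (?e i)"
          by (rule linear_eq_axis[of "\<lambda>v. prod3 ?T (?e i) v" "\<lambda>v. prod3 ?T v (?e i)"])
            (auto intro!: linearI simp: pl prod3_axis sym(1)[of i])
      qed (auto intro!: linearI simp: pl)
      then show ?thesis by simp
    qed
    show "prod3 ?T u v = prod3 ?T v u" for u v by (rule comm)
    have adj0: "bform (prod3 ?T (?e i) (?e j)) (?e k) = bform (?e i) (prod3 ?T (?e j) (?e k))" for i j k
      by (simp add: prod3_axis bform_raise_axis) (metis sym)
    have adj1: "bform (prod3 ?T (?e i) (?e j)) w = bform (?e i) (prod3 ?T (?e j) w)" for i j w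
      by (rule linear_eq_axis) (auto intro!: linearI simp: pl adj0)
    have adj2: "bform (prod3 ?T (?e i) v) w = bform (?e i) (prod3 ?T v w)" for i v w
      by (rule linear_eq_axis[of "\<lambda>v. bform (prod3 ?T (?e i) v) w" "\<lambda>v. bform (?e i) (prod3 ?T v w)"])
        (auto intro!: linearI simp: pl adj1)
    have adj: "bform (prod3 ?T u v) w = bform u (prod3 ?T v w)" for u v w
      by (rule linear_eq_axis[of "\<lambda>u. bform (prod3 ?T u v) w" "\<lambda>u. bform u (prod3 ?T v w)"])
        (auto intro!: linearI simp: pl adj2)
    show "bform (prod3 ?T u v) w = bform u (prod3 ?T v w)" for u v w by (rule adj)
    have hadj0: "bform (?h (?e i)) (?e j) = bform (?e i) (?h (?e j))" for i j
      by (simp add: op2_axis bform_raise_axis g(1)[of i j])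
    have hadj1: "bform (?h (?e i)) v = bform (?e i) (?h v)" for i v
      by (rule linear_eq_axis) (auto intro!: linearI simp: pl hadj0)
    show "bform (?h u) v = bform u (?h v)" for u v
      by (rule linear_eq_axis[of "\<lambda>u. bform (?h u) v" "\<lambda>u. bform u (?h v)"])
        (auto intro!: linearI simp: pl hadj1)
    let ?L = "\<lambda>x v w. prod3 ?T (prod3 ?T x v) w + bform x v *\<^sub>R ?h w + bform (?h x) v *\<^sub>R w"
    have c0: "?L (?e i) (?e j) (?e k) = ?L (?e i) (?e k) (?e j)" for i j k
    proof (rule bform_eqI)
      fix l
      have C: "bform (prod3 ?T (prod3 ?T (?e i) (?e j)) (?e k)) (?e l) = contr1 \<gamma> S i j k l" for i j k l
        using adj[of "prod3 ?T (?e i) (?e j)" "?e k" "?e l"]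
        by (simp only: prod3_axis bform_raise_raise contr1_trace)
      show "bform (?L (?e i) (?e j) (?e k)) (?e l) = bform (?L (?e i) (?e k) (?e j)) (?e l)"
        using g(2)[of i j k l]
        by (simp add: pl C op2_axis bform_raise_axis bform_axis(2) algebra_simps)
    qed
    have c1: "?L (?e i) (?e j) w = ?L (?e i) w (?e j)" for i j w
      by (rule linear_eq_axis[of "\<lambda>w. ?L (?e i) (?e j) w" "\<lambda>w. ?L (?e i) w (?e j)"]; (rule c0 | auto intro!: linearI simp: pl algebra_simps))
    have c2: "?L (?e i) v w = ?L (?e i) w v" for i v w
      by (rule linear_eq_axis[of "\<lambda>v. ?L (?e i) v w" "\<lambda>v. ?L (?e i) w v"]; (rule c1 | auto intro!: linearI simp: pl algebra_simps))
    show "?L x v w = ?L x w v" for x v w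
      by (rule linear_eq_axis[of "\<lambda>x. ?L x v w" "\<lambda>x. ?L x w v"]; (rule c2 | auto intro!: linearI simp: pl algebra_simps))
    show "(\<Sum>a\<in>UNIV. bform v (?f a) *\<^sub>R ?e a) = v" for v
      using vec_sum_axis[of v] by (simp add: bf)
    show "(\<Sum>a\<in>UNIV. bform v (?e a) *\<^sub>R ?f a) = v" for v
    proof (rule bform_eqI)
      fix l
      have "bform (\<Sum>a\<in>UNIV. bform v (?e a) *\<^sub>R ?f a) (?e l) = (\<Sum>a\<in>UNIV. bform v (?e a) * bform (?f a) (?e l))"
      proof -
        have L: "linear (\<lambda>u. bform u (?e l))" by (auto intro!: linearI simp: pl)
        show ?thesis by (simp only: linear_sum[OF L] linear_scale[OF L] real_scaleR_def)
      qed
      also have "\<dots> = bform v (?e l)" by (simp add: bform_raise_axis sum_delta)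
      finally show "bform (\<Sum>a\<in>UNIV. bform v (?e a) *\<^sub>R ?f a) (?e l) = bform v (?e l)" .
    qed
    show "(\<Sum>a\<in>UNIV. bform (?e a) (?f a)) = real CARD('n)" by (simp add: bf axis_def)
    show "2 \<le> real CARD('n)" using n by simp
  qed (rule bform_bilinear bform_sym prod3_bilinear op2_linear)+
  then show ?thesis by blast
qed

end

section \<open>The equations at one point\<close>

context nondegenerate_form
begin

text \<open>The pairing of covectors by the inverse metric.\<close>

definition pr :: "('n \<Rightarrow> real) \<Rightarrow> ('n \<Rightarrow> real) \<Rightarrow> real" where
  "pr \<phi> \<psi> = trace_form \<gamma> (\<lambda>a b. \<phi> a * \<psi> b)"

lemma pr_sym: "pr \<phi> \<psi> = pr \<psi> \<phi>"
  unfolding pr_def by (subst trace_form_flip[symmetric]) (simp add: mult.commute)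

lemma pr_left: "pr (\<lambda>a. \<phi> a + \<phi>' a) \<psi> = pr \<phi> \<psi> + pr \<phi>' \<psi>" "pr (\<lambda>a. \<phi> a - \<phi>' a) \<psi> = pr \<phi> \<psi> - pr \<phi>' \<psi>"
  "pr (\<lambda>a. c * \<phi> a) \<psi> = c * pr \<phi> \<psi>" "pr (\<lambda>a. \<phi> a * c) \<psi> = pr \<phi> \<psi> * c"
  by (simp_all add: pr_def trace_form_def distrib_left distrib_right left_diff_distrib right_diff_distrib sum.distrib sum_subtractf
      sum_distrib_left mult_ac)

lemma pr_right: "pr \<psi> (\<lambda>a. \<phi> a + \<phi>' a) = pr \<psi> \<phi> + pr \<psi> \<phi>'" "pr \<psi> (\<lambda>a. \<phi> a - \<phi>' a) = pr \<psi> \<phi> - pr \<psi> \<phi>'"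
  "pr \<psi> (\<lambda>a. c * \<phi> a) = c * pr \<psi> \<phi>" "pr \<psi> (\<lambda>a. \<phi> a * c) = pr \<psi> \<phi> * c"
  unfolding pr_sym[of \<psi>] by (rule pr_left)+

lemma pr_\<gamma>: "pr (\<lambda>a. \<gamma> $ a $ i) \<psi> = \<psi> i" "pr (\<lambda>a. \<gamma> $ i $ a) \<psi> = \<psi> i"
  "pr \<psi> (\<lambda>a. \<gamma> $ a $ i) = \<psi> i" "pr \<psi> (\<lambda>a. \<gamma> $ i $ a) = \<psi> i"
  by (simp_all add: pr_def trace_form_contract)

lemma trace_form_exchange:
  "trace_form \<gamma> (\<lambda>a b. trace_form \<gamma> (\<lambda>c d. F a b c d)) = trace_form \<gamma> (\<lambda>c d. trace_form \<gamma> (\<lambda>a b. F a b c d))"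
proof -
  have "trace_form \<gamma> (\<lambda>a b. trace_form \<gamma> (\<lambda>c d. F a b c d)) =
     trace_form \<gamma> (\<lambda>a b. \<Sum>c\<in>UNIV. \<Sum>d\<in>UNIV. ginv \<gamma> c d * F a b c d)" by (simp add: trace_form_def)
  also have "\<dots> = (\<Sum>c\<in>UNIV. \<Sum>d\<in>UNIV. ginv \<gamma> c d * trace_form \<gamma> (\<lambda>a b. F a b c d))"
    by (simp only: trace_form_sum trace_form_cmult)
  finally show ?thesis by (simp add: trace_form_def)
qed

lemma trace_form_pr: "trace_form \<gamma> (\<lambda>a b. pr \<phi> (F a b)) = pr \<phi> (\<lambda>c. trace_form \<gamma> (\<lambda>a b. F a b c))"
  "trace_form \<gamma> (\<lambda>a b. pr (F a b) \<phi>) = pr (\<lambda>c. trace_form \<gamma> (\<lambda>a b. F a b c)) \<phi>"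
proof -
  show *: "trace_form \<gamma> (\<lambda>a b. pr \<phi> (F a b)) = pr \<phi> (\<lambda>c. trace_form \<gamma> (\<lambda>a b. F a b c))" for \<phi>
    unfolding pr_def by (subst trace_form_exchange) (simp add: trace_form_cmult)
  show "trace_form \<gamma> (\<lambda>a b. pr (F a b) \<phi>) = pr (\<lambda>c. trace_form \<gamma> (\<lambda>a b. F a b c)) \<phi>"
    unfolding pr_sym[of _ \<phi>] by (rule *)
qed

end

text \<open>The tensors \<open>T\<close>, \<open>H\<close>, \<open>P\<close> come from the Frobenius algebra and the light cone; here only
  their symmetries matter.  The last assumption, the total symmetry of a quadratic expression, is what
  remains of associativity.  The covariant derivatives of \<open>T\<close>, of its trace \<open>\<theta>\<close> and of the trace-free
  tensor \<open>s\<close> will turn out to be \<open>dT\<close>, \<open>d\<theta>\<close> and \<open>ds\<close>; their formulas are derived in the next section.\<close>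

locale tractor_tensors = nondegenerate_form \<gamma> for \<gamma> :: "real^'n::finite^'n" +
  fixes T :: "'n \<Rightarrow> 'n \<Rightarrow> 'n \<Rightarrow> real" and H P :: "'n \<Rightarrow> 'n \<Rightarrow> real"
  assumes n3: "CARD('n) \<ge> 3"
    and T_sym: "T i j k = T j i k" "T i j k = T i k j"
    and H_sym: "H i j = H j i" and P_sym: "P i j = P j i"
    and Q_sym: "pr (T l i) (T j k) + H l i * \<gamma> $ j $ k + \<gamma> $ l $ i * H j k =
      pr (T l j) (T i k) + H l j * \<gamma> $ i $ k + \<gamma> $ l $ j * H i k"
begin

definition n :: real where "n = real CARD('n)"
definition w :: real where "w = 1 / (n + 2)"
definition q :: real where "q = 1 / (n - 2)"
definition \<theta> :: "'n \<Rightarrow> real" where "\<theta> k = trace_form \<gamma> (\<lambda>a b. T a b k)"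
definition \<Theta> :: "'n \<Rightarrow> 'n \<Rightarrow> 'n \<Rightarrow> 'n \<Rightarrow> real" where "\<Theta> i j k l = pr (T i j) (T k l)"
definition T\<theta> :: "'n \<Rightarrow> 'n \<Rightarrow> real" where "T\<theta> i j = pr (T i j) \<theta>"
definition T2 :: "'n \<Rightarrow> 'n \<Rightarrow> real" where "T2 i j = trace_form \<gamma> (\<lambda>a b. \<Theta> i a j b)"
definition \<theta>2 :: real where "\<theta>2 = pr \<theta> \<theta>"
definition trH :: real where "trH = trace_form \<gamma> H"
definition trP :: real where "trP = trace_form \<gamma> P"

definition dT :: "'n \<Rightarrow> 'n \<Rightarrow> 'n \<Rightarrow> 'n \<Rightarrow> real" where
  "dT l i j k = - (\<Theta> l i j k + H l i * \<gamma> $ j $ k + \<gamma> $ l $ i * H j k)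
     - (P l i * \<gamma> $ j $ k + P l j * \<gamma> $ i $ k + P l k * \<gamma> $ i $ j)
     - (\<gamma> $ l $ i * H j k + \<gamma> $ l $ j * H i k + \<gamma> $ l $ k * H i j)"

definition d\<theta> :: "'n \<Rightarrow> 'n \<Rightarrow> real" where "d\<theta> l k = trace_form \<gamma> (\<lambda>a b. dT l a b k)"

definition s :: "'n \<Rightarrow> 'n \<Rightarrow> 'n \<Rightarrow> real" where
  "s i j k = - 3 * (T i j k - w * (\<gamma> $ i $ j * \<theta> k + \<gamma> $ i $ k * \<theta> j + \<gamma> $ j $ k * \<theta> i))"

definition ds :: "'n \<Rightarrow> 'n \<Rightarrow> 'n \<Rightarrow> 'n \<Rightarrow> real" where
  "ds l i j k = - 3 * (dT l i j k - w * (\<gamma> $ i $ j * d\<theta> l k + \<gamma> $ i $ k * d\<theta> l j + \<gamma> $ j $ k * d\<theta> l i))"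

text \<open>With the constants \<open>w\<close> and \<open>q\<close> instead of fractions, these relations are all that is needed to
  compare coefficients.\<close>

lemma nw: "n * w = 1 - 2 * w" and nq: "n * q = 1 + 2 * q" and n_pos: "n \<ge> 3"
  using n3 by (auto simp: n_def w_def q_def field_simps)

lemma \<Theta>_sym: "\<Theta> i j k l = \<Theta> j i k l" "\<Theta> i j k l = \<Theta> i j l k" "\<Theta> i j k l = \<Theta> k l i j"
proof -
  have "T i j = T j i" for i j using T_sym(1) by blast
  then show "\<Theta> i j k l = \<Theta> j i k l" "\<Theta> i j k l = \<Theta> i j l k" by (simp_all add: \<Theta>_def)
  show "\<Theta> i j k l = \<Theta> k l i j" unfolding \<Theta>_def by (rule pr_sym)
qed

lemma T\<theta>_sym: "T\<theta> i j = T\<theta> j i"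
proof -
  have "T i j = T j i" using T_sym(1) by blast
  then show ?thesis by (simp add: T\<theta>_def)
qed

lemma \<theta>_alt: "trace_form \<gamma> (\<lambda>a b. T k a b) = \<theta> k" "trace_form \<gamma> (\<lambda>a b. T a k b) = \<theta> k"
  "trace_form \<gamma> (\<lambda>a b. T k b a) = \<theta> k" "trace_form \<gamma> (\<lambda>a b. T b k a) = \<theta> k" "trace_form \<gamma> (\<lambda>a b. T b a k) = \<theta> k"
proof -
  have "T k a b = T a b k" "T a k b = T a b k" "T k b a = T a b k" "T b k a = T a b k" "T b a k = T a b k" for a b
    using T_sym by metis+
  then show "trace_form \<gamma> (\<lambda>a b. T k a b) = \<theta> k" "trace_form \<gamma> (\<lambda>a b. T a k b) = \<theta> k"
    "trace_form \<gamma> (\<lambda>a b. T k b a) = \<theta> k" "trace_form \<gamma> (\<lambda>a b. T b k a) = \<theta> k" "trace_form \<gamma> (\<lambda>a b. T b a k) = \<theta> k"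
    unfolding \<theta>_def by presburger+
qed

lemma T2_alt: "trace_form \<gamma> (\<lambda>a b. \<Theta> i a b j) = T2 i j" "trace_form \<gamma> (\<lambda>a b. \<Theta> i b j a) = T2 i j"
  unfolding T2_def \<Theta>_sym(2)[of i _ _ j] by (rule refl, rule trace_form_flip[of "\<lambda>a b. \<Theta> i a j b"])

lemma trace_\<Theta>: "trace_form \<gamma> (\<lambda>a b. \<Theta> i j a b) = T\<theta> i j"
  unfolding \<Theta>_def trace_form_pr T\<theta>_def \<theta>_def ..

lemma trace_T\<theta>: "trace_form \<gamma> (\<lambda>a b. T\<theta> a b) = \<theta>2"
  unfolding T\<theta>_def trace_form_pr \<theta>2_def \<theta>_def ..

lemma Q_sym': "\<Theta> l i j k + H l i * \<gamma> $ j $ k + \<gamma> $ l $ i * H j k = \<Theta> l j i k + H l j * \<gamma> $ i $ k + \<gamma> $ l $ j * H i k"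
  unfolding \<Theta>_def by (rule Q_sym)

text \<open>The symmetry of the quadratic expression, traced over two indices, determines \<open>H\<close> by \<open>T\<close>.\<close>

lemma H_trace: "T2 l i = (n - 2) * H l i + \<gamma> $ l $ i * trH + T\<theta> l i"
proof -
  have "trace_form \<gamma> (\<lambda>a b. \<Theta> l i a b + H l i * \<gamma> $ a $ b + \<gamma> $ l $ i * H a b) =
    trace_form \<gamma> (\<lambda>a b. \<Theta> l a i b + H l a * \<gamma> $ i $ b + \<gamma> $ l $ a * H i b)"
    using Q_sym' by simp
  then show ?thesis
    by (simp add: trace_form_linear trace_form_contract trace_form_\<gamma> trace_\<Theta> T2_def[symmetric]
        trH_def[symmetric] n_def[symmetric] H_sym[of i l] algebra_simps)
qed

lemma trace_T2: "trace_form \<gamma> T2 = 2 * (n - 1) * trH + \<theta>2"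
proof -
  have "trace_form \<gamma> T2 = trace_form \<gamma> (\<lambda>l i. (n - 2) * H l i + \<gamma> $ l $ i * trH + T\<theta> l i)"
    using H_trace by presburger
  then show ?thesis
    by (simp add: trace_form_linear trace_form_\<gamma> trace_T\<theta> trH_def[symmetric] n_def[symmetric] algebra_simps)
qed

lemma d\<theta>_eq: "d\<theta> l k = - T\<theta> l k - (n + 2) * (H l k + P l k) - 2 * \<gamma> $ l $ k * trH"
proof -
  have "d\<theta> l k = - T2 l k - (n + 2) * P l k - 4 * H l k - \<gamma> $ l $ k * trH"
    unfolding d\<theta>_def dT_def
    by (simp add: trace_form_linear trace_form_contract trace_form_\<gamma> T2_alt
        trH_def[symmetric] n_def[symmetric]) (simp add: algebra_simps)
  then show ?thesis unfolding H_trace by (simp add: algebra_simps)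
qed

lemma d\<theta>_sym: "d\<theta> l k = d\<theta> k l"
  unfolding d\<theta>_eq T\<theta>_sym[of l] H_sym[of l] P_sym[of l] \<gamma>_sym[of l] ..

lemma s_sym: "s i j k = s j i k" "s i j k = s i k j"
  unfolding s_def using T_sym[of i j k] by (simp_all add: \<gamma>_sym[of j i] \<gamma>_sym[of k j] add_ac)

lemma s_tracefree: "trace_form \<gamma> (\<lambda>a b. s a b k) = 0"
proof -
  have "trace_form \<gamma> (\<lambda>a b. s a b k) = - 3 * (\<theta> k - w * (n * \<theta> k + \<theta> k + \<theta> k))"
    unfolding s_def by (simp add: trace_form_linear trace_form_contract trace_form_\<gamma> n_def[symmetric] \<theta>_def[symmetric])
  also have "\<dots> = - 3 * (1 - (n * w + 2 * w)) * \<theta> k" by (simp add: algebra_simps)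
  finally show ?thesis by (simp add: nw)
qed

lemma dT_sym: "dT l i j k = dT l j i k" "dT l i j k = dT l i k j"
proof -
  show "dT l i j k = dT l j i k"
    unfolding dT_def \<gamma>_sym[of j i] H_sym[of j i] using Q_sym'[of l i j k] by linarith
  show "dT l i j k = dT l i k j"
    unfolding dT_def \<gamma>_sym[of k j] H_sym[of k j] \<Theta>_sym(2)[of l i k j] by linarith
qed

lemma ds_sym: "ds l i j k = ds l j i k" "ds l i j k = ds l i k j"
  unfolding ds_def using dT_sym[of l i j k] by (simp_all add: \<gamma>_sym[of j i] \<gamma>_sym[of k j] add_ac)

lemma ds_tracefree: "trace_form \<gamma> (\<lambda>a b. ds l a b k) = 0"
proof -
  have "trace_form \<gamma> (\<lambda>a b. ds l a b k) = - 3 * (d\<theta> l k - w * (n * d\<theta> l k + d\<theta> l k + d\<theta> l k))"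
    unfolding ds_def by (simp add: trace_form_linear trace_form_contract trace_form_\<gamma> n_def[symmetric] d\<theta>_def[symmetric])
  also have "\<dots> = - 3 * (1 - (n * w + 2 * w)) * d\<theta> l k" by (simp add: algebra_simps)
  finally show ?thesis by (simp add: nw)
qed

lemma pr_s_s: "pr (s i l) (s j k) = 9 * (\<Theta> i l j k
   - w * (\<gamma> $ i $ l * T\<theta> j k + \<theta> l * T j k i + \<theta> i * T j k l + \<gamma> $ j $ k * T\<theta> i l + \<theta> k * T i l j + \<theta> j * T i l k)
   + w * w * (\<gamma> $ i $ l * \<gamma> $ j $ k * \<theta>2 + 2 * (\<theta> j * (\<gamma> $ i $ l * \<theta> k)) + 2 * (\<theta> i * (\<gamma> $ j $ k * \<theta> l))
      + \<gamma> $ i $ j * (\<theta> l * \<theta> k) + \<theta> j * (\<gamma> $ i $ k * \<theta> l) + \<theta> i * (\<gamma> $ l $ j * \<theta> k) + \<gamma> $ l $ k * (\<theta> i * \<theta> j)))"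
proof -
  have s: "s i j = (\<lambda>k. - 3 * (T i j k - w * (\<gamma> $ i $ j * \<theta> k + \<gamma> $ i $ k * \<theta> j + \<gamma> $ j $ k * \<theta> i)))" for i j
    by (rule ext) (rule s_def)
  have e: "pr \<theta> (T j k) = T\<theta> j k" unfolding T\<theta>_def by (rule pr_sym)
  show ?thesis unfolding s
    by (simp add: pr_left pr_right pr_\<gamma> \<Theta>_def[symmetric] T\<theta>_def[symmetric] \<theta>2_def[symmetric] e)
      (simp add: \<gamma>_sym[of j i] \<gamma>_sym[of k i] \<gamma>_sym[of j l] \<gamma>_sym[of k l] algebra_simps)
qed

lemma pr_s_\<theta>: "pr (s j k) \<theta> = - 3 * (T\<theta> j k - w * (\<gamma> $ j $ k * \<theta>2 + 2 * (\<theta> j * \<theta> k)))"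
proof -
  have s: "s i j = (\<lambda>k. - 3 * (T i j k - w * (\<gamma> $ i $ j * \<theta> k + \<gamma> $ i $ k * \<theta> j + \<gamma> $ j $ k * \<theta> i)))" for i j
    by (rule ext) (rule s_def)
  show ?thesis unfolding s
    by (simp add: pr_left pr_right pr_\<gamma> T\<theta>_def[symmetric] \<theta>2_def[symmetric])
qed

lemma trace_s2: "trace_form \<gamma> (\<lambda>a c. pr (s i c) (s j a)) = 9 * (T2 i j - w * (4 * T\<theta> i j + 2 * (\<theta> i * \<theta> j))
     + w * w * (2 * (\<gamma> $ i $ j * \<theta>2) + (n + 6) * (\<theta> i * \<theta> j)))"
proof -
  have 1: "trace_form \<gamma> (\<lambda>a c. \<theta> c * T j a i) = T\<theta> i j"
  proof -
    have "T j a i = T i j a" for a using T_sym by metis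
    then show ?thesis unfolding T\<theta>_def pr_def by (simp add: mult.commute)
  qed
  have 2: "trace_form \<gamma> (\<lambda>a c. \<theta> a * T i c j) = T\<theta> i j"
  proof -
    have "T i c j = T i j c" for c using T_sym by metis
    then show ?thesis unfolding T\<theta>_def by (subst pr_sym) (simp add: pr_def)
  qed
  have 3: "trace_form \<gamma> (\<lambda>a c. \<theta> c * \<theta> a) = \<theta>2" unfolding \<theta>2_def pr_def by (simp add: mult.commute)
  have 4: "trace_form \<gamma> (\<lambda>a c. \<gamma> $ c $ a) = n" unfolding n_def using trace_form_flip[of "\<lambda>a c. \<gamma> $ a $ c"] trace_form_\<gamma> by simp
  show ?thesis unfolding pr_s_s
    by (simp add: trace_form_linear trace_form_contract trace_form_contract_\<gamma> T2_alt \<theta>_alt 1 2 3 4 T\<theta>_sym[of j i])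
      (simp add: algebra_simps \<gamma>_sym[of j i])
qed

text \<open>The factor \<open>4 q\<close> is the coefficient \<open>4 / (n - 2)\<close> of this term in the equation for \<open>S\<close>; it removes
  the factor \<open>n - 2\<close> that \<open>H\<close> gets in \<open>H_trace\<close>.\<close>

lemma trace_s2_scaled: "4 * q * trace_form \<gamma> (\<lambda>a c. pr (s i c) (s j a)) =
   36 * (H i j + q * \<gamma> $ i $ j * trH + w * T\<theta> i j + 2 * q * w * w * \<gamma> $ i $ j * \<theta>2 - w * w * (\<theta> i * \<theta> j))"
proof -
  have q1: "q * (n - 2) = 1" using nq by (simp add: algebra_simps)
  have q2: "q * (1 - 4 * w) = w"
  proof -
    have "1 - 4 * w = (n - 2) * w" using nw by (simp add: algebra_simps)
    then show ?thesis using q1 by (simp add: mult.assoc[symmetric])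
  qed
  have q3: "q * ((n + 6) * (w * w) - 2 * w) = - (w * w)"
  proof -
    have "2 * w = 2 * (n * w + 2 * w) * w" by (simp add: nw)
    then have "(n + 6) * (w * w) - 2 * w = - ((n - 2) * (w * w))" by (simp add: algebra_simps)
    then have "q * ((n + 6) * (w * w) - 2 * w) = - (q * (n - 2) * (w * w))" by simp
    then show ?thesis using q1 by simp
  qed
  have "4 * q * trace_form \<gamma> (\<lambda>a c. pr (s i c) (s j a)) = 36 * ((q * (n - 2)) * H i j + q * \<gamma> $ i $ j * trH
     + (q * (1 - 4 * w)) * T\<theta> i j + 2 * q * w * w * \<gamma> $ i $ j * \<theta>2 + (q * ((n + 6) * (w * w) - 2 * w)) * (\<theta> i * \<theta> j))"
    unfolding trace_s2 H_trace by (simp add: algebra_simps)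
  then show ?thesis unfolding q1 q2 q3 by simp
qed

context
  fixes S \<tau> :: "'n tensor"
  assumes S: "\<And>i j k. S [i, j, k] = s i j k" and \<tau>: "\<And>k. \<tau> [k] = - 3 * w * \<theta> k"
begin

lemma contr1_s: "contr1 \<gamma> S i j k l = pr (s i j) (s k l)"
  unfolding contr1_trace pr_def S ..

lemma contr2_s: "contr2 \<gamma> S i j = trace_form \<gamma> (\<lambda>a c. pr (s i c) (s j a))"
proof -
  have "trace_form \<gamma> (\<lambda>b d. s i c d * s j a b) = pr (s i c) (s j a)" for a c
    unfolding pr_def by (rule trace_form_flip[of "\<lambda>b d. s i c b * s j a d"])
  then show ?thesis unfolding contr2_trace S by simp
qed

lemma contrSt_s: "contrSt \<gamma> S \<tau> j k = 9 * w * (T\<theta> j k - w * (\<gamma> $ j $ k * \<theta>2 + 2 * (\<theta> j * \<theta> k)))"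
proof -
  have "contrSt \<gamma> S \<tau> j k = pr (s j k) (\<lambda>b. - 3 * w * \<theta> b)"
    unfolding contrSt_def pr_def trace_form_def S \<tau> by (simp add: mult_ac)
  also have "\<dots> = - 3 * w * pr (s j k) \<theta>" by (rule pr_right(3))
  finally show ?thesis unfolding pr_s_\<theta> by (simp add: algebra_simps)
qed

lemma norm2S_s: "norm2S \<gamma> S = 9 * (n - 1) * (2 * trH + w * \<theta>2)"
proof -
  have c2: "contr2 \<gamma> S i j = 9 * (T2 i j - w * (4 * T\<theta> i j + 2 * (\<theta> i * \<theta> j))
     + w * w * (2 * (\<gamma> $ i $ j * \<theta>2) + (n + 6) * (\<theta> i * \<theta> j)))" for i j
    unfolding contr2_s by (rule trace_s2)
  have "norm2S \<gamma> S = trace_form \<gamma> (contr2 \<gamma> S)" by (simp add: norm2S_def trace_form_def)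
  also have "\<dots> = 9 * (trace_form \<gamma> T2 - w * (4 * \<theta>2 + 2 * \<theta>2) + w * w * (2 * (n * \<theta>2) + (n + 6) * \<theta>2))"
  proof -
    have e: "contr2 \<gamma> S = (\<lambda>i j. 9 * (T2 i j - w * (4 * T\<theta> i j + 2 * (\<theta> i * \<theta> j))
     + w * w * (2 * (\<gamma> $ i $ j * \<theta>2) + (n + 6) * (\<theta> i * \<theta> j))))" by (intro ext) (rule c2)
    show ?thesis unfolding e
      by (simp add: trace_form_linear trace_form_\<gamma> trace_T\<theta> n_def[symmetric] pr_def[symmetric] \<theta>2_def[symmetric])
  qed
  also have "\<dots> = 9 * (2 * (n - 1) * trH + (1 - 6 * w + 3 * w * (n * w + 2 * w)) * \<theta>2)"
    unfolding trace_T2 by (simp add: algebra_simps)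
  also have "\<dots> = 9 * (2 * (n - 1) * trH + (n * w + 2 * w - 3 * w) * \<theta>2)" by (simp add: nw)
  finally show ?thesis by (simp add: algebra_simps)
qed

lemma norm2t_s: "norm2t \<gamma> \<tau> = 9 * w * w * \<theta>2"
proof -
  have "norm2t \<gamma> \<tau> = pr (\<lambda>a. - 3 * w * \<theta> a) (\<lambda>b. - 3 * w * \<theta> b)"
    unfolding norm2t_def pr_def trace_form_def \<tau> by (simp add: mult_ac)
  also have "\<dots> = - 3 * w * (- 3 * w * pr \<theta> \<theta>)" by (simp only: pr_left(3) pr_right(3))
  finally show ?thesis by (simp add: \<theta>2_def)
qed

text \<open>Both sides are totally symmetric and trace-free in \<open>i\<close>, \<open>j\<close>, \<open>k\<close>, so that terms with the metric as a
  factor in these indices may be ignored.  The symmetry of the quadratic expression serves to replace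
  three times \<open>\<Theta>\<^sub>l\<^sub>i\<^sub>j\<^sub>k\<close> by the symmetric sum that occurs on the right-hand side.\<close>

lemma equation_c: "ds l i j k = rhs_c \<gamma> S \<tau> [l, i, j, k]"
proof -
  let ?X = "\<lambda>i j k. contr1 \<gamma> S i l j k + 3 * S [i, j, l] * \<tau> [k] + S [i, j, k] * \<tau> [l]
        + (4 / (real CARD('n) - 2) * contr2 \<gamma> S j k - 3 * contrSt \<gamma> S \<tau> j k) * \<gamma> $ i $ l"
  let ?f = "\<lambda>i j k. ?X i j k + ?X i k j + ?X j i k + ?X j k i + ?X k i j + ?X k j i"
  \<comment> \<open>The ignored terms: the coefficient of \<open>\<gamma>\<^sub>j\<^sub>k\<close> in the difference of the two sides.\<close>
  let ?t = "\<lambda>i. 18 * (- (w * T\<theta> i l) + w * w * \<gamma> $ i $ l * \<theta>2) - 36 * w * w * \<theta> i * \<theta> l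
     + 2 * \<gamma> $ i $ l * (72 * q * w * w * \<theta>2 + 27 * w * w * \<theta>2 + 36 * q * trH)
     - 18 * H i l - 54 * P i l - 54 * w * d\<theta> l i"
  have c2: "4 / (real CARD('n) - 2) * contr2 \<gamma> S j k = 36 * (H j k + q * \<gamma> $ j $ k * trH + w * T\<theta> j k
      + 2 * q * w * w * \<gamma> $ j $ k * \<theta>2 - w * w * (\<theta> j * \<theta> k))" for j k
    unfolding contr2_s using trace_s2_scaled[of j k] by (simp add: q_def n_def)
  have "tf_part \<gamma> 3 (tens3 ?f) [i, j, k] = 18 * ds l i j k"
  proof (rule tf_part_3_eqI[OF n3, where t = ?t])
    show "trace_form \<gamma> (\<lambda>a b. 18 * ds l a b k) = 0" for k by (simp add: trace_form_cmult ds_tracefree)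
    show "18 * ds l i j k = 18 * ds l j i k" "18 * ds l i j k = 18 * ds l i k j" for i j k
      using ds_sym[of l i j k] by simp_all
    fix i j k
    have d: "18 * ds l i j k = 
       18 * (\<Theta> l i j k + \<Theta> l j i k + \<Theta> l k i j + H l i * \<gamma> $ j $ k + H l j * \<gamma> $ i $ k + H l k * \<gamma> $ i $ j)
       + 54 * (P l i * \<gamma> $ j $ k + P l j * \<gamma> $ i $ k + P l k * \<gamma> $ i $ j)
       + 72 * (\<gamma> $ l $ i * H j k + \<gamma> $ l $ j * H i k + \<gamma> $ l $ k * H i j)
       + 54 * w * (\<gamma> $ i $ j * d\<theta> l k + \<gamma> $ i $ k * d\<theta> l j + \<gamma> $ j $ k * d\<theta> l i)"
    proof -
      have three: "X = Y \<Longrightarrow> X = Z \<Longrightarrow> 3 * X = X + Y + Z" for X Y Z :: real by simp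
      have "\<Theta> l i k j + H l i * \<gamma> $ k $ j + \<gamma> $ l $ i * H k j = \<Theta> l k i j + H l k * \<gamma> $ i $ j + \<gamma> $ l $ k * H i j"
        by (rule Q_sym')
      then have "\<Theta> l i j k + H l i * \<gamma> $ j $ k + \<gamma> $ l $ i * H j k = \<Theta> l k i j + H l k * \<gamma> $ i $ j + \<gamma> $ l $ k * H i j"
        by (simp only: \<Theta>_sym(2)[of l i k j] \<gamma>_sym[of k j] H_sym[of k j])
      then have "3 * (\<Theta> l i j k + H l i * \<gamma> $ j $ k + \<gamma> $ l $ i * H j k) = \<Theta> l i j k + \<Theta> l j i k + \<Theta> l k i j
        + (H l i * \<gamma> $ j $ k + H l j * \<gamma> $ i $ k + H l k * \<gamma> $ i $ j)
        + (\<gamma> $ l $ i * H j k + \<gamma> $ l $ j * H i k + \<gamma> $ l $ k * H i j)"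
        using three[OF Q_sym'[of l i j k]] by (simp only: add_ac)
      then show ?thesis unfolding ds_def dT_def by (simp add: algebra_simps)
    qed
    show "?f i j k - 18 * ds l i j k = \<gamma> $ i $ j * ?t k + \<gamma> $ i $ k * ?t j + \<gamma> $ j $ k * ?t i"
      unfolding d c2 contr1_s pr_s_s contrSt_s S \<tau> s_def
      by (simp add: T_sym \<Theta>_sym T\<theta>_sym H_sym P_sym \<gamma>_sym algebra_simps)
  qed
  then show ?thesis
    by (simp add: rhs_c_def Let_def tens4_def Pi_op_def)
qed

context
  fixes Ric :: "'n \<Rightarrow> 'n \<Rightarrow> real"
  assumes Ric: "\<And>i j. Ric i j = (n - 2) * P i j + \<gamma> $ i $ j * trP"
begin

text \<open>Modulo the metric both sides are \<open>3 (H + P) + 3 w T\<theta>\<close>, and the traces agree by construction; \<open>u\<close> is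
  the coefficient of the metric in the difference.\<close>

lemma equation_a: "- 3 * w * d\<theta> i j = rhs_a \<gamma> Ric S \<tau> (trace_form \<gamma> (\<lambda>a b. - 3 * w * d\<theta> a b)) [i, j]"
proof -
  define K where "K = (\<lambda>i j. 3 / (real CARD('n) - 2) * Ric i j
       + 1 / (3 * (real CARD('n) - 2)) * contr2 \<gamma> S i j + 1 / 3 * \<tau> [i] * \<tau> [j])"
  define u where "u = 6 * w * trH - (3 * q * trP + 3 * q * trH + 6 * q * w * w * \<theta>2)"
  have q1: "q * (n - 2) = 1" using nq by (simp add: algebra_simps)
  have w1: "w * (n + 2) = 1" using nw by (simp add: algebra_simps)
  have "K i j = - 3 * w * d\<theta> i j - \<gamma> $ i $ j * u" for i j
  proof -
    have "K i j = 3 * q * Ric i j + 1 / 12 * (4 * q * trace_form \<gamma> (\<lambda>a c. pr (s i c) (s j a))) + 3 * w * w * \<theta> i * \<theta> j"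
      unfolding K_def \<tau> contr2_s by (simp add: q_def n_def)
    also have "3 * q * Ric i j = 3 * (q * (n - 2)) * P i j + 3 * q * trP * \<gamma> $ i $ j" unfolding Ric by (simp add: algebra_simps)
    finally have K: "K i j = 3 * P i j + 3 * q * trP * \<gamma> $ i $ j + 3 * (H i j + q * \<gamma> $ i $ j * trH + w * T\<theta> i j
        + 2 * q * w * w * \<gamma> $ i $ j * \<theta>2)"
      unfolding trace_s2_scaled q1 by (simp add: algebra_simps)
    have "- 3 * w * d\<theta> i j = 3 * w * T\<theta> i j + 3 * (w * (n + 2)) * (H i j + P i j) + 6 * w * \<gamma> $ i $ j * trH"
      unfolding d\<theta>_eq by (simp add: algebra_simps)
    then show ?thesis unfolding K w1 u_def by (simp add: algebra_simps)
  qed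
  then have K: "K = (\<lambda>i j. - 3 * w * d\<theta> i j - \<gamma> $ i $ j * u)" by (intro ext)
  have "trace_form \<gamma> K = trace_form \<gamma> (\<lambda>a b. - 3 * w * d\<theta> a b) - n * u"
    unfolding K by (simp only: trace_form_diff trace_form_multc trace_form_\<gamma> n_def)
  moreover have "n \<noteq> 0" using n_pos by simp
  ultimately show ?thesis
    unfolding rhs_a_def Let_def K_def[symmetric]
    by (simp add: tens2_def[of _ "[i, j]"] tf_part_2 n_def[symmetric]) (simp add: K field_simps)
qed

lemma equation_b: "trace_form \<gamma> (\<lambda>a b. - 3 * w * d\<theta> a b) = rhs_b \<gamma> (trace_form \<gamma> Ric) S \<tau>"
proof -
  have n1: "n - 1 \<noteq> 0" "n + 2 \<noteq> 0" using n_pos by auto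
  have R: "trace_form \<gamma> Ric = 2 * (n - 1) * trP"
  proof -
    have "Ric = (\<lambda>i j. (n - 2) * P i j + \<gamma> $ i $ j * trP)" by (intro ext) (rule Ric)
    then show ?thesis by (simp add: trace_form_linear trace_form_\<gamma> n_def[symmetric] trP_def[symmetric] algebra_simps)
  qed
  have "trace_form \<gamma> (\<lambda>a b. - 3 * w * d\<theta> a b) = 3 * w * \<theta>2 + 3 * (w * (n + 2)) * (trH + trP) + 6 * w * n * trH"
  proof -
    have "(\<lambda>a b. - 3 * w * d\<theta> a b) = (\<lambda>a b. - 3 * w * (- T\<theta> a b - (n + 2) * (H a b + P a b) - 2 * (\<gamma> $ a $ b * trH)))"
      unfolding d\<theta>_eq by (simp add: mult.assoc)
    then show ?thesis
      by (simp add: trace_form_linear trace_form_\<gamma> trace_T\<theta> n_def[symmetric] trP_def[symmetric] trH_def[symmetric] algebra_simps)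
  qed
  also have "\<dots> = 3 * trP + 3 * (w * (n + 2)) * trH + 6 * w * n * trH + 3 * (w * (n + 2)) * w * \<theta>2"
    using nw by (simp add: algebra_simps)
  also have "\<dots> = rhs_b \<gamma> (trace_form \<gamma> Ric) S \<tau>"
  proof -
    have a: "3 / (2 * (n - 1)) * (2 * (n - 1) * trP) = 3 * trP" using n1 by simp
    have b: "(3 * n + 2) / (6 * (n - 1) * (n + 2)) * (9 * (n - 1) * (2 * trH + w * \<theta>2)) = 3 / 2 * (3 * n + 2) * w * (2 * trH + w * \<theta>2)"
    proof -
      have "(3 * n + 2) / (6 * (n - 1) * (n + 2)) * (9 * (n - 1) * Y) = 3 / 2 * (3 * n + 2) * (1 / (n + 2)) * Y" for Y
      proof -
        have "m \<noteq> 0 \<Longrightarrow> p \<noteq> 0 \<Longrightarrow> a / (6 * m * p) * (9 * m * Y) = 3 / 2 * a * (1 / p) * Y" for a m p :: real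
          by (simp add: field_simps)
        from this[OF n1] show ?thesis .
      qed
      then show ?thesis by (simp add: w_def)
    qed
    show ?thesis
      unfolding rhs_b_def Let_def n_def[symmetric] R norm2S_s norm2t_s a b
      by (simp add: field_simps)
  qed
  finally show ?thesis .
qed

end

end

end

section \<open>Light-cone immersions\<close>

context chart_metric
begin

lemma trace_form_smooth:
  assumes "\<And>a b. smoothv U (F a b)" shows "smoothv U (\<lambda>y. trace_form (h y) (\<lambda>a b. F a b y))"
  unfolding trace_form_def by (intro smoothv_sum_UNIV smoothv_mult ginv_smooth assms U)

text \<open>Traces commute with covariant differentiation.\<close>

lemma pv_trace_form:
  assumes x: "x \<in> U" and F: "\<And>a b. smoothv U (F a b)"
  shows "pv l (\<lambda>y. trace_form (h y) (\<lambda>a b. F a b y)) x = trace_form (h x) (\<lambda>a b. pv l (F a b) x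
     - (\<Sum>c\<in>UNIV. \<Gamma> x c l a * F c b x) - (\<Sum>c\<in>UNIV. \<Gamma> x c l b * F a c x))"
proof -
  have d: "F a b differentiable (at x)" "(\<lambda>y. ginv (h y) a b) differentiable (at x)" for a b
    using smoothv_differentiable[OF F x] smoothv_differentiable[OF ginv_smooth x] by auto
  have "pv l (\<lambda>y. trace_form (h y) (\<lambda>a b. F a b y)) x = (\<Sum>a\<in>UNIV. \<Sum>b\<in>UNIV.
     pv l (\<lambda>y. ginv (h y) a b) x * F a b x + ginv (h x) a b * pv l (F a b) x)"
    unfolding trace_form_def by (simp add: pv_sum pv_mult d differentiable_mult differentiable_sum_UNIV)
  also have "\<dots> = trace_form (h x) (\<lambda>a b. pv l (F a b) x)
     - (\<Sum>a\<in>UNIV. \<Sum>b\<in>UNIV. \<Sum>c\<in>UNIV. \<Gamma> x a l c * ginv (h x) c b * F a b x)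
     - (\<Sum>a\<in>UNIV. \<Sum>b\<in>UNIV. \<Sum>c\<in>UNIV. \<Gamma> x b l c * ginv (h x) a c * F a b x)"
    by (simp add: inverse_metric_compatible[OF x] trace_form_def left_diff_distrib sum.distrib sum_subtractf
        sum_distrib_right sum_negf)
  also have "(\<Sum>a\<in>UNIV. \<Sum>b\<in>UNIV. \<Sum>c\<in>UNIV. \<Gamma> x a l c * ginv (h x) c b * F a b x)
      = trace_form (h x) (\<lambda>c b. \<Sum>a\<in>UNIV. \<Gamma> x a l c * F a b x)"
  proof -
    have "(\<Sum>a\<in>UNIV. \<Sum>b\<in>UNIV. \<Sum>c\<in>UNIV. \<Gamma> x a l c * ginv (h x) c b * F a b x)
       = (\<Sum>a\<in>UNIV. \<Sum>c\<in>UNIV. \<Sum>b\<in>UNIV. \<Gamma> x a l c * ginv (h x) c b * F a b x)"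
      by (rule sum.cong[OF refl], rule sum.swap)
    also have "\<dots> = (\<Sum>c\<in>UNIV. \<Sum>a\<in>UNIV. \<Sum>b\<in>UNIV. \<Gamma> x a l c * ginv (h x) c b * F a b x)" by (rule sum.swap)
    also have "\<dots> = (\<Sum>c\<in>UNIV. \<Sum>b\<in>UNIV. \<Sum>a\<in>UNIV. \<Gamma> x a l c * ginv (h x) c b * F a b x)"
      by (rule sum.cong[OF refl], rule sum.swap)
    finally show ?thesis by (simp add: trace_form_def sum_distrib_left mult_ac)
  qed
  also have "(\<Sum>a\<in>UNIV. \<Sum>b\<in>UNIV. \<Sum>c\<in>UNIV. \<Gamma> x b l c * ginv (h x) a c * F a b x)
      = trace_form (h x) (\<lambda>a c. \<Sum>b\<in>UNIV. \<Gamma> x b l c * F a b x)"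
  proof -
    have "(\<Sum>a\<in>UNIV. \<Sum>b\<in>UNIV. \<Sum>c\<in>UNIV. \<Gamma> x b l c * ginv (h x) a c * F a b x)
       = (\<Sum>a\<in>UNIV. \<Sum>c\<in>UNIV. \<Sum>b\<in>UNIV. \<Gamma> x b l c * ginv (h x) a c * F a b x)"
      by (rule sum.cong[OF refl], rule sum.swap)
    then show ?thesis by (simp add: trace_form_def sum_distrib_left mult_ac)
  qed
  finally show ?thesis by (simp add: trace_form_diff)
qed

end

text \<open>The geometric situation: an immersion \<open>X\<close> into the null cone of an algebra with invariant form,
  inducing the metric \<open>h\<close>, its inverse \<open>V\<close> in the algebra, and the second null normal \<open>Y\<close>.  Together with
  the partial derivatives of \<open>X\<close> the two null vectors form a moving frame, which \<open>complete\<close> expresses by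
  Parseval's identity.\<close>

locale light_cone = chart_metric h U
  for h :: "real^'n::finite \<Rightarrow> real^'n^'n" and U :: "(real^'n) set" +
  fixes mul :: "'e::euclidean_space \<Rightarrow> 'e \<Rightarrow> 'e" and B :: "'e \<Rightarrow> 'e \<Rightarrow> real" and one :: 'e
    and X V Y :: "real^'n \<Rightarrow> 'e"
  assumes n3: "CARD('n) \<ge> 3"
    and mul: "bounded_bilinear mul" and mul_comm: "mul a b = mul b a"
    and mul_assoc: "mul (mul a b) c = mul a (mul b c)" and mul_one: "mul one a = a"
    and B: "bounded_bilinear B" and B_inv: "B (mul a b) c = B a (mul b c)"
    and X: "smoothv U X" and V: "smoothv U V" and XV: "x \<in> U \<Longrightarrow> mul (X x) (V x) = one"
    and null: "x \<in> U \<Longrightarrow> B (X x) (X x) = 0" and iso: "x \<in> U \<Longrightarrow> B (pv i X x) (pv j X x) = h x $ i $ j"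
    and XY: "x \<in> U \<Longrightarrow> B (X x) (Y x) = 1" and YY: "x \<in> U \<Longrightarrow> B (Y x) (Y x) = 0"
    and YZ: "x \<in> U \<Longrightarrow> B (Y x) (pv i X x) = 0"
    and complete: "x \<in> U \<Longrightarrow> B v v' = B v (Y x) * B v' (X x) + B v (X x) * B v' (Y x)
       + trace_form (h x) (\<lambda>a b. B v (pv a X x) * B v' (pv b X x))"
begin

abbreviation Z :: "'n \<Rightarrow> real^'n \<Rightarrow> 'e" where "Z i \<equiv> pv i X"

interpretation mul: bounded_bilinear mul by (rule mul)
interpretation B: bounded_bilinear B by (rule B)

lemma B_one: "B a b = B (mul a b) one"
  by (simp add: B_inv mul_comm[of b one] mul_one)

lemma B_sym: "B a b = B b a"
  using B_one[of a b] B_one[of b a] by (simp add: mul_comm)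

lemma mul_lcomm: "mul a (mul b c) = mul b (mul a c)"
  by (metis mul_comm mul_assoc)

lemmas mul_ac = mul_assoc mul_comm mul_lcomm

lemma VX: "x \<in> U \<Longrightarrow> mul (V x) (X x) = one"
  using XV mul_comm by simp

lemma Z_smooth: "smoothv U (Z i)" by (rule smoothv_pv[OF X])

lemma Z_diff: "x \<in> U \<Longrightarrow> Z i differentiable (at x)" by (rule smoothv_differentiable[OF Z_smooth])

lemma Z_commute: "x \<in> U \<Longrightarrow> pv i (Z j) x = pv j (Z i) x"
  by (rule pv_commute[OF U _ X])

lemma pv_zero:
  fixes f :: "real^'n \<Rightarrow> real"
  assumes "x \<in> U" "\<And>y. y \<in> U \<Longrightarrow> f y = c" shows "pv k f x = 0"
  using pv_cong[of U x f "\<lambda>_. c" k] assms U by simp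

lemma XZ: "x \<in> U \<Longrightarrow> B (X x) (Z i x) = 0"
proof -
  assume x: "x \<in> U"
  have d: "X differentiable (at x)" by (rule smoothv_differentiable[OF X x])
  have "pv i (\<lambda>y. B (X y) (X y)) x = 0" by (rule pv_zero[OF x null])
  then show ?thesis unfolding pv_bilinear[OF B d d] using B_sym[of "X x" "Z i x"] by simp
qed

lemma pvZ_X: "x \<in> U \<Longrightarrow> B (pv i (Z j) x) (X x) = - h x $ i $ j"
proof -
  assume x: "x \<in> U"
  have d: "X differentiable (at x)" by (rule smoothv_differentiable[OF X x])
  have "pv i (\<lambda>y. B (X y) (Z j y)) x = 0" by (rule pv_zero[OF x XZ])
  then show ?thesis unfolding pv_bilinear[OF B d Z_diff[OF x]] iso[OF x] using B_sym[of "X x"] by simp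
qed

lemma pvZ_Z: "x \<in> U \<Longrightarrow> B (pv k (Z j) x) (Z i x) = (\<Sum>m\<in>UNIV. h x $ i $ m * \<Gamma> x m k j)"
proof -
  assume x: "x \<in> U"
  have dh: "pv k (\<lambda>y. h y $ i $ j) x = B (pv k (Z i) x) (Z j x) + B (Z i x) (pv k (Z j) x)" for k i j
    using pv_cong[OF U x, of "\<lambda>y. h y $ i $ j" "\<lambda>y. B (Z i y) (Z j y)" k] iso
      pv_bilinear[OF B Z_diff[OF x] Z_diff[OF x]] by simp
  show ?thesis unfolding christoffel_lower[OF x] dh
    using Z_commute[OF x, of k j] Z_commute[OF x, of k i] Z_commute[OF x, of j i]
      B_sym[of "Z i x"] B_sym[of "Z k x"] B_sym[of "Z j x"] by simp
qed

text \<open>\<open>N\<close> is the second fundamental form of the immersion; it has values in the span of \<open>X\<close> and \<open>Y\<close>.\<close>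

definition N :: "'n \<Rightarrow> 'n \<Rightarrow> real^'n \<Rightarrow> 'e" where
  "N i j x = pv i (Z j) x - (\<Sum>a\<in>UNIV. \<Gamma> x a i j *\<^sub>R Z a x)"

definition P :: "real^'n \<Rightarrow> 'n \<Rightarrow> 'n \<Rightarrow> real" where "P x i j = - B (N i j x) (Y x)"

definition T :: "real^'n \<Rightarrow> 'n \<Rightarrow> 'n \<Rightarrow> 'n \<Rightarrow> real" where
  "T x i j k = B (V x) (mul (Z i x) (mul (Z j x) (Z k x)))"

definition H :: "real^'n \<Rightarrow> 'n \<Rightarrow> 'n \<Rightarrow> real" where "H x i j = B (V x) (mul (Y x) (mul (Z i x) (Z j x)))"

lemma pvZ_eq: "pv i (Z j) x = N i j x + (\<Sum>a\<in>UNIV. \<Gamma> x a i j *\<^sub>R Z a x)"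
  by (simp add: N_def)

lemma N_sym: "x \<in> U \<Longrightarrow> N i j x = N j i x"
  unfolding N_def using Z_commute christoffel_sym by simp

lemma N_X: "x \<in> U \<Longrightarrow> B (N i j x) (X x) = - h x $ i $ j"
  unfolding N_def by (simp add: B.diff_left B.sum_left B.scaleR_left pvZ_X B_sym[of "Z _ x"] XZ)

lemma N_Z: "x \<in> U \<Longrightarrow> B (N k j x) (Z i x) = 0"
  unfolding N_def by (simp add: B.diff_left B.sum_left B.scaleR_left pvZ_Z iso h_sym[of x i] mult.commute)

lemma N_smooth: "smoothv U (N i j)"
  unfolding N_def
  by (intro smoothv_diff smoothv_pv X U smoothv_sum_UNIV smoothv_bilinear[OF bounded_bilinear_scaleR] christoffel_smooth)

lemma N_pair: "x \<in> U \<Longrightarrow> B (N i j x) v = - P x i j * B v (X x) - h x $ i $ j * B v (Y x)"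
  using complete[of x "N i j x" v] by (simp add: N_X N_Z P_def trace_form_zero)

text \<open>Products in the algebra are only used through the frame components of the vectors \<open>W\<close>.\<close>

definition W :: "'n \<Rightarrow> 'n \<Rightarrow> real^'n \<Rightarrow> 'e" where "W l i x = mul (V x) (mul (Z l x) (Z i x))"

lemma W_X: "x \<in> U \<Longrightarrow> B (W l i x) (X x) = h x $ l $ i"
proof -
  assume x: "x \<in> U"
  have "mul (W l i x) (X x) = mul (mul (V x) (X x)) (mul (Z l x) (Z i x))" by (simp only: W_def mul_ac)
  then have "B (W l i x) (X x) = B (Z l x) (Z i x)"
    unfolding B_one[of "W l i x"] B_one[of "Z l x"] by (simp add: VX[OF x] mul_one)
  then show ?thesis using iso[OF x] by simp
qed

lemma W_Y: "x \<in> U \<Longrightarrow> B (W l i x) (Y x) = H x l i"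
  unfolding H_def B_one[of "W l i x"] B_one[of "V x"] by (simp add: W_def mul_ac)

lemma W_Z: "x \<in> U \<Longrightarrow> B (W l i x) (Z a x) = T x l i a"
  unfolding T_def B_one[of "W l i x"] B_one[of "V x"] by (simp add: W_def mul_ac)

text \<open>The quadratic expression is \<open>B(W\<^sub>l\<^sub>i, W\<^sub>j\<^sub>k) = B(V\<^sup>2 Z\<^sub>l Z\<^sub>i Z\<^sub>j, Z\<^sub>k)\<close>, computed with the frame.\<close>

lemma tractor: "x \<in> U \<Longrightarrow> tractor_tensors (h x) (T x) (H x) (P x)"
proof -
  assume x: "x \<in> U"
  interpret nondegenerate_form "h x" by (rule h_form[OF x])
  let ?w = "\<lambda>l i. W l i x"
  note wX = W_X[OF x] and wY = W_Y[OF x] and wZ = W_Z[OF x]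
  have Q: "B (?w l i) (?w j k) = pr (T x l i) (T x j k) + H x l i * h x $ j $ k + h x $ l $ i * H x j k" for l i j k
    using complete[OF x, of "?w l i" "?w j k"] by (simp add: wX wY wZ pr_def)
  show ?thesis
  proof (intro tractor_tensors.intro tractor_tensors_axioms.intro)
    show "nondegenerate_form (h x)" by (rule h_form[OF x])
    show "CARD('n) \<ge> 3" by (rule n3)
    show "T x i j k = T x j i k" "T x i j k = T x i k j" for i j k
      unfolding T_def by (simp_all add: mul_ac)
    show "H x i j = H x j i" for i j unfolding H_def by (simp add: mul_ac)
    show "P x i j = P x j i" for i j unfolding P_def using N_sym[OF x] by simp
    show "pr (T x l i) (T x j k) + H x l i * h x $ j $ k + h x $ l $ i * H x j k =
       pr (T x l j) (T x i k) + H x l j * h x $ i $ k + h x $ l $ j * H x i k" for l i j k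
      unfolding Q[symmetric] B_one[of "?w _ _"] by (simp add: W_def mul_ac)
  qed
qed

lemma pv_V: "x \<in> U \<Longrightarrow> pv k V x = - mul (mul (V x) (Z k x)) (V x)"
  using smoothv_algebra_inverse(2)[OF mul mul_assoc, of one U V X x k] mul_one mul_comm XV VX U X by simp

lemma T_smooth: "smoothv U (\<lambda>x. T x i j k)"
  unfolding T_def by (intro smoothv_bilinear[OF B] smoothv_bilinear[OF mul] V Z_smooth U)

text \<open>Differentiating \<open>V\<close> gives the quadratic expression; differentiating a factor \<open>Z\<^sub>i\<close> gives its second
  fundamental form, which contributes \<open>P\<close> through \<open>X\<close> and \<open>H\<close> through \<open>Y\<close>.\<close>

lemma pv_T:
  assumes x: "x \<in> U"
  shows "pv l (\<lambda>x. T x i j k) x = tractor_tensors.dT (h x) (T x) (H x) (P x) l i j k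
    + (\<Sum>a\<in>UNIV. \<Gamma> x a l i * T x a j k) + (\<Sum>a\<in>UNIV. \<Gamma> x a l j * T x i a k) + (\<Sum>a\<in>UNIV. \<Gamma> x a l k * T x i j a)"
proof -
  interpret tt: tractor_tensors "h x" "T x" "H x" "P x" by (rule tractor[OF x])
  let ?w = "\<lambda>l i. W l i x"
  note wX = W_X[OF x] and wY = W_Y[OF x] and wZ = W_Z[OF x]
  note dZ = Z_diff[OF x]
  have dV: "V differentiable (at x)" by (rule smoothv_differentiable[OF V x])
  note db = differentiable_bilinear[OF mul]
  have "pv l (\<lambda>x. T x i j k) x = B (pv l V x) (mul (Z i x) (mul (Z j x) (Z k x)))
     + B (V x) (mul (pv l (Z i) x) (mul (Z j x) (Z k x))) + B (V x) (mul (Z i x) (mul (pv l (Z j) x) (Z k x)))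
     + B (V x) (mul (Z i x) (mul (Z j x) (pv l (Z k) x)))"
    unfolding T_def by (simp add: pv_bilinear[OF B] pv_bilinear[OF mul] dV dZ db B.add_right mul.add_right)
  also have "B (V x) (mul (pv l (Z i) x) (mul (Z j x) (Z k x))) = B (pv l (Z i) x) (?w j k)"
    unfolding B_one[of "V x"] B_one[of "pv l (Z i) x"] by (simp add: W_def mul_ac)
  also have "B (V x) (mul (Z i x) (mul (pv l (Z j) x) (Z k x))) = B (pv l (Z j) x) (?w i k)"
    unfolding B_one[of "V x"] B_one[of "pv l (Z j) x"] by (simp add: W_def mul_ac)
  also have "B (V x) (mul (Z i x) (mul (Z j x) (pv l (Z k) x))) = B (pv l (Z k) x) (?w i j)"
    unfolding B_one[of "V x"] B_one[of "pv l (Z k) x"] by (simp add: W_def mul_ac)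
  also have "B (pv l V x) (mul (Z i x) (mul (Z j x) (Z k x))) = - B (?w l i) (?w j k)"
    unfolding pv_V[OF x] B.minus_left B_one[of "mul (mul (V x) (Z l x)) (V x)"] B_one[of "?w l i"]
    by (simp add: W_def mul_ac)
  finally have main: "pv l (\<lambda>x. T x i j k) x = - B (?w l i) (?w j k) + B (pv l (Z i) x) (?w j k)
     + B (pv l (Z j) x) (?w i k) + B (pv l (Z k) x) (?w i j)" .
  have Q: "B (?w l i) (?w j k) = tt.\<Theta> l i j k + H x l i * h x $ j $ k + h x $ l $ i * H x j k"
    using complete[OF x, of "?w l i" "?w j k"] by (simp add: wX wY wZ tt.pr_def tt.\<Theta>_def)
  have dz: "B (pv l (Z i) x) (?w j k) = - P x l i * h x $ j $ k - h x $ l $ i * H x j k + (\<Sum>a\<in>UNIV. \<Gamma> x a l i * T x a j k)" for i j k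
  proof -
    have "B (Z a x) (?w j k) = T x a j k" for a
      using wZ[of j k a] B_sym[of "Z a x"] tt.T_sym by metis
    then show ?thesis
      unfolding pvZ_eq B.add_left B.sum_left B.scaleR_left N_pair[OF x] wX wY by simp
  qed
  have "T x a i k = T x i a k" "T x a i j = T x i j a" for a using tt.T_sym by metis+
  then show ?thesis unfolding main Q dz tt.dT_def by (simp add: algebra_simps)
qed

text \<open>The Gauss equation expresses the curvature by the second fundamental form; its trace shows that
  \<open>P\<close> is the Schouten tensor.\<close>

lemma gauss:
  assumes x: "x \<in> U"
  shows "(\<Sum>m\<in>UNIV. h x $ i $ m * riemann h x m j l k) = B (N k j x) (N l i x) - B (N l j x) (N k i x)"
proof -
  have dN: "N i j differentiable (at x)" for i j by (rule smoothv_differentiable[OF N_smooth x])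
  have dG: "(\<lambda>x. \<Gamma> x m i j) differentiable (at x)" for m i j by (rule smoothv_differentiable[OF christoffel_smooth x])
  have dpZ: "pv k (Z j) differentiable (at x)" for k j by (rule smoothv_differentiable[OF smoothv_pv[OF Z_smooth] x])
  note dZ = Z_diff[OF x]
  note dS = differentiable_bilinear[OF bounded_bilinear_scaleR dG dZ]
  have 1: "B (pv l (N k j) x) (Z i x) = - B (N k j x) (N l i x)" for l k j
  proof -
    have "pv l (\<lambda>y. B (N k j y) (Z i y)) x = 0" by (rule pv_zero[OF x N_Z])
    then have "B (pv l (N k j) x) (Z i x) + B (N k j x) (pv l (Z i) x) = 0"
      unfolding pv_bilinear[OF B dN dZ] .
    moreover have "B (N k j x) (pv l (Z i) x) = B (N k j x) (N l i x)"
      unfolding pvZ_eq[of l i] by (simp add: B.add_right B.sum_right B.scaleR_right N_Z[OF x])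
    ultimately show ?thesis by simp
  qed
  have 2: "B (pv l (N k j) x) (Z i x) = B (pv l (pv k (Z j)) x) (Z i x)
     - (\<Sum>a\<in>UNIV. h x $ i $ a * pv l (\<lambda>y. \<Gamma> y a k j) x) - (\<Sum>m\<in>UNIV. h x $ i $ m * (\<Sum>a\<in>UNIV. \<Gamma> x m l a * \<Gamma> x a k j))" for l k
  proof -
    have "pv l (N k j) x = pv l (pv k (Z j)) x
       - (\<Sum>a\<in>UNIV. pv l (\<lambda>y. \<Gamma> y a k j) x *\<^sub>R Z a x + \<Gamma> x a k j *\<^sub>R pv l (Z a) x)"
      unfolding N_def[abs_def]
      by (simp add: pv_diff dpZ dS differentiable_sum_UNIV pv_sum pv_bilinear[OF bounded_bilinear_scaleR dG dZ])
    then have "B (pv l (N k j) x) (Z i x) = B (pv l (pv k (Z j)) x) (Z i x)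
       - (\<Sum>a\<in>UNIV. pv l (\<lambda>y. \<Gamma> y a k j) x * h x $ a $ i) - (\<Sum>a\<in>UNIV. \<Gamma> x a k j * (\<Sum>m\<in>UNIV. h x $ i $ m * \<Gamma> x m l a))"
      by (simp add: B.diff_left B.sum_left B.add_left B.scaleR_left iso[OF x] pvZ_Z[OF x] sum.distrib)
    moreover have "(\<Sum>a\<in>UNIV. \<Gamma> x a k j * (\<Sum>m\<in>UNIV. h x $ i $ m * \<Gamma> x m l a))
        = (\<Sum>m\<in>UNIV. h x $ i $ m * (\<Sum>a\<in>UNIV. \<Gamma> x m l a * \<Gamma> x a k j))"
      unfolding sum_distrib_left by (subst sum.swap) (simp add: mult_ac)
    moreover have "(\<Sum>a\<in>UNIV. pv l (\<lambda>y. \<Gamma> y a k j) x * h x $ a $ i) = (\<Sum>a\<in>UNIV. h x $ i $ a * pv l (\<lambda>y. \<Gamma> y a k j) x)"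
      using h_sym[OF x] by (simp add: mult.commute)
    ultimately show ?thesis by simp
  qed
  have comm: "pv l (pv k (Z j)) x = pv k (pv l (Z j)) x" by (rule pv_commute[OF U x Z_smooth])
  have "(\<Sum>m\<in>UNIV. h x $ i $ m * riemann h x m j l k) =
     (\<Sum>a\<in>UNIV. h x $ i $ a * pv l (\<lambda>y. \<Gamma> y a k j) x) - (\<Sum>a\<in>UNIV. h x $ i $ a * pv k (\<lambda>y. \<Gamma> y a l j) x)
     + (\<Sum>m\<in>UNIV. h x $ i $ m * (\<Sum>a\<in>UNIV. \<Gamma> x m l a * \<Gamma> x a k j)) - (\<Sum>m\<in>UNIV. h x $ i $ m * (\<Sum>a\<in>UNIV. \<Gamma> x m k a * \<Gamma> x a l j))"
    by (simp add: riemann_def pd_eq_pv sum_subtractf sum.distrib algebra_simps)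
  also have "\<dots> = B (pv k (N l j) x) (Z i x) - B (pv l (N k j) x) (Z i x)"
    unfolding 2 comm by simp
  finally show ?thesis unfolding 1 by simp
qed

lemma ricci_eq:
  assumes x: "x \<in> U"
  shows "ricci h x j k = (real CARD('n) - 2) * P x j k + h x $ j $ k * trace_form (h x) (P x)"
proof -
  interpret tt: tractor_tensors "h x" "T x" "H x" "P x" by (rule tractor[OF x])
  have R: "(\<Sum>m\<in>UNIV. h x $ i $ m * riemann h x m j l k) =
     P x k j * h x $ l $ i + h x $ k $ j * P x l i - (P x l j * h x $ k $ i + h x $ l $ j * P x k i)" for i l
    unfolding gauss[OF x] by (simp add: N_pair[OF x, of _ _ "N _ _ x"] N_X[OF x]) (simp add: P_def)
  have "trace_form (h x) (\<lambda>l i. \<Sum>m\<in>UNIV. h x $ i $ m * riemann h x m j l k)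
     = (\<Sum>m\<in>UNIV. trace_form (h x) (\<lambda>l i. h x $ i $ m * riemann h x m j l k))" by (rule trace_form_sum)
  also have "\<dots> = ricci h x j k"
    unfolding ricci_def by (simp add: tt.trace_form_contract(3)[of _ "\<lambda>l. riemann h x _ j l k"])
  finally have "ricci h x j k = trace_form (h x) (\<lambda>l i. P x k j * h x $ l $ i + h x $ k $ j * P x l i
      - (P x l j * h x $ k $ i + h x $ l $ j * P x k i))" unfolding R ..
  then show ?thesis
    by (simp add: trace_form_linear tt.trace_form_contract tt.trace_form_\<gamma> tt.P_sym[of k j] tt.\<gamma>_sym[of k j] algebra_simps)
qed

definition \<theta> :: "'n \<Rightarrow> real^'n \<Rightarrow> real" where "\<theta> k y = trace_form (h y) (\<lambda>a b. T y a b k)"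

definition w :: real where "w = 1 / (real CARD('n) + 2)"

definition S :: "real^'n \<Rightarrow> 'n tensor" where
  "S y = tens3 (\<lambda>i j k. - 3 * (T y i j k - w * (h y $ i $ j * \<theta> k y + h y $ i $ k * \<theta> j y + h y $ j $ k * \<theta> i y)))"

lemma \<theta>_smooth: "smoothv U (\<theta> k)"
  unfolding \<theta>_def by (rule trace_form_smooth[OF T_smooth])

lemma pv_\<theta>:
  assumes x: "x \<in> U"
  shows "pv l (\<theta> k) x = tractor_tensors.d\<theta> (h x) (T x) (H x) (P x) l k + (\<Sum>c\<in>UNIV. \<Gamma> x c l k * \<theta> c x)"
proof -
  interpret tt: tractor_tensors "h x" "T x" "H x" "P x" by (rule tractor[OF x])
  have "pv l (\<theta> k) x = trace_form (h x) (\<lambda>a b. tt.dT l a b k + (\<Sum>c\<in>UNIV. \<Gamma> x c l k * T x a b c))"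
    unfolding \<theta>_def pv_trace_form[OF x T_smooth] pv_T[OF x] by (simp add: algebra_simps)
  then show ?thesis
    by (simp add: trace_form_add trace_form_sum trace_form_cmult tt.d\<theta>_def \<theta>_def)
qed

lemma S_eq: "x \<in> U \<Longrightarrow> S x [i, j, k] = tractor_tensors.s (h x) (T x) i j k"
proof -
  assume x: "x \<in> U"
  interpret tt: tractor_tensors "h x" "T x" "H x" "P x" by (rule tractor[OF x])
  show ?thesis by (simp add: S_def tens3_def tt.s_def tt.w_def tt.n_def w_def tt.\<theta>_def \<theta>_def)
qed

lemma S_smooth: "smoothv U (\<lambda>x. S x [i, j, k])"
  unfolding S_def tens3_def
  by (simp, intro smoothv_mult smoothv_diff smoothv_add smoothv_const T_smooth \<theta>_smooth h_smooth smoothv_uminus smoothv_cmult U)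

lemma covD_S:
  assumes x: "x \<in> U"
  shows "covD h S x [l, i, j, k] = tractor_tensors.ds (h x) (T x) (H x) (P x) l i j k"
proof -
  interpret tt: tractor_tensors "h x" "T x" "H x" "P x" by (rule tractor[OF x])
  have tw: "tt.w = w" by (simp add: tt.w_def tt.n_def w_def)
  have t\<theta>: "tt.\<theta> k = \<theta> k x" for k by (simp add: tt.\<theta>_def \<theta>_def)
  have dT: "(\<lambda>x. T x i j k) differentiable (at x)" for i j k by (rule smoothv_differentiable[OF T_smooth x])
  have d\<theta>: "\<theta> k differentiable (at x)" for k by (rule smoothv_differentiable[OF \<theta>_smooth x])
  have dh: "(\<lambda>x. h x $ i $ j) differentiable (at x)" for i j by (rule smoothv_differentiable[OF h_smooth x])
  have dh\<theta>: "(\<lambda>x. h x $ i $ j * \<theta> k x) differentiable (at x)" for i j k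
    by (intro differentiable_mult dh d\<theta>)
  have ph\<theta>: "pv l (\<lambda>x. h x $ i $ j * \<theta> k x) x = (\<Sum>a\<in>UNIV. \<Gamma> x a l i * (h x $ a $ j * \<theta> k x)) + (\<Sum>a\<in>UNIV. \<Gamma> x a l j * (h x $ i $ a * \<theta> k x))
     + (\<Sum>a\<in>UNIV. \<Gamma> x a l k * (h x $ i $ j * \<theta> a x)) + h x $ i $ j * tt.d\<theta> l k" for i j k
    unfolding pv_mult[OF dh d\<theta>] metric_compatible[OF x] pv_\<theta>[OF x]
    by (simp add: distrib_right distrib_left sum_distrib_left sum_distrib_right mult_ac)
  have pS: "pv l (\<lambda>y. S y [i, j, k]) x = - 3 * (pv l (\<lambda>y. T y i j k) x - w * (pv l (\<lambda>x. h x $ i $ j * \<theta> k x) x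
      + pv l (\<lambda>x. h x $ i $ k * \<theta> j x) x + pv l (\<lambda>x. h x $ j $ k * \<theta> i x) x))"
  proof -
    have c: "pv l (\<lambda>y. c * f y) x = c * pv l f x" if "f differentiable (at x)"
      for c and f :: "real^'n \<Rightarrow> real"
      using that pv_mult[of "\<lambda>_. c" x f l] by simp
    have d1: "(\<lambda>x. h x $ i $ j * \<theta> k x + h x $ i $ k * \<theta> j x + h x $ j $ k * \<theta> i x) differentiable (at x)"
      by (intro differentiable_add dh\<theta>)
    have "pv l (\<lambda>y. S y [i, j, k]) x = - 3 * pv l (\<lambda>y. T y i j k - w * (h y $ i $ j * \<theta> k y + h y $ i $ k * \<theta> j y + h y $ j $ k * \<theta> i y)) x"
    proof -
      have e: "(\<lambda>y. S y [i, j, k]) = (\<lambda>y. - 3 * (T y i j k - w * (h y $ i $ j * \<theta> k y + h y $ i $ k * \<theta> j y + h y $ j $ k * \<theta> i y)))"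
        by (rule ext) (simp add: S_def tens3_def)
      show ?thesis unfolding e
        by (rule c) (intro differentiable_diff differentiable_mult differentiable_const d1 dT)
    qed
    then show ?thesis
      using d1 dT dh\<theta> by (simp add: pv_diff c pv_add differentiable_add differentiable_mult)
  qed
  show ?thesis
    unfolding covD_3 pS pv_T[OF x] ph\<theta> S_eq[OF x] tt.ds_def tt.s_def tw t\<theta>
    by (simp add: algebra_simps sum.distrib sum_subtractf sum_distrib_left sum_negf)
qed

theorem solution_exists:
  assumes p: "p \<in> U"
  shows "\<exists>r t. r > 0 \<and> ball p r \<subseteq> U \<and> smoothv (ball p r) t \<and> t p = t0 \<and>
    (\<forall>x\<in>ball p r. solves_system_at h t S x \<and> (\<forall>k. grad t x [k] = - 3 * w * \<theta> k x))"
proof -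
  have closed: "pv j (\<lambda>x. - 3 * w * \<theta> k x) x = pv k (\<lambda>x. - 3 * w * \<theta> j x) x" if x: "x \<in> U" for x j k
  proof -
    interpret tt: tractor_tensors "h x" "T x" "H x" "P x" by (rule tractor[OF x])
    have d\<theta>: "\<theta> k differentiable (at x)" for k by (rule smoothv_differentiable[OF \<theta>_smooth x])
    have "pv l (\<lambda>x. - 3 * w * \<theta> k x) x = - 3 * w * pv l (\<theta> k) x" for l k
      using pv_mult[of "\<lambda>_. - 3 * w" x "\<theta> k" l] d\<theta> by simp
    then show ?thesis using tt.d\<theta>_sym[of j k] christoffel_sym[OF x, of _ j k] by (simp add: pv_\<theta>[OF x])
  qed
  have sm: "smoothv U (\<lambda>x. - 3 * w * \<theta> k x)" for k
    by (intro smoothv_cmult \<theta>_smooth U)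
  obtain r t where t: "r > 0" "ball p r \<subseteq> U" "t p = t0" "smoothv (ball p r) t"
    "\<And>x k. x \<in> ball p r \<Longrightarrow> pv k t x = - 3 * w * \<theta> k x"
    using poincare[OF U p, where \<theta> = "\<lambda>k x. - 3 * w * \<theta> k x" and ?t0.0 = t0] sm closed by blast
  have "solves_system_at h t S x \<and> (\<forall>k. grad t x [k] = - 3 * w * \<theta> k x)" if xr: "x \<in> ball p r" for x
  proof -
    have x: "x \<in> U" using xr t by blast
    interpret tt: tractor_tensors "h x" "T x" "H x" "P x" by (rule tractor[OF x])
    have tw: "tt.w = w" by (simp add: tt.w_def tt.n_def w_def)
    have t\<theta>: "tt.\<theta> k = \<theta> k x" for k by (simp add: tt.\<theta>_def \<theta>_def)
    have g: "grad t y [k] = - 3 * w * \<theta> k y" if "y \<in> ball p r" for y k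
      using t(5)[OF that] by (simp add: grad_def pd_eq_pv)
    have g': "grad t x [k] = - 3 * tt.w * tt.\<theta> k" for k using g[OF xr] tw t\<theta> by simp
    have cg: "covD h (grad t) x [l, k] = - 3 * tt.w * tt.d\<theta> l k" for l k
    proof -
      have "pv l (\<lambda>y. grad t y [k]) x = pv l (\<lambda>y. - 3 * w * \<theta> k y) x"
        by (rule pv_cong[OF open_ball xr g])
      also have "\<dots> = - 3 * w * pv l (\<theta> k) x"
        using pv_mult[of "\<lambda>_. - 3 * w" x "\<theta> k" l] smoothv_differentiable[OF \<theta>_smooth x] by simp
      finally show ?thesis unfolding covD_1 g[OF xr] pv_\<theta>[OF x] tw
        by (simp add: sum_distrib_left algebra_simps)
    qed
    have D: "divergence h (grad t) x = trace_form (h x) (\<lambda>a b. - 3 * tt.w * tt.d\<theta> a b)"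
      unfolding divergence_def trace_form_def cg ..
    have Ric: "ricci h x i j = (tt.n - 2) * P x i j + h x $ i $ j * tt.trP" for i j
      unfolding ricci_eq[OF x] tt.n_def tt.trP_def ..
    have sc: "scalar_curv h x = trace_form (h x) (ricci h x)"
      unfolding scalar_curv_def trace_form_def ..
    note S = S_eq[OF x]
    have "solves_system_at h t S x"
      unfolding solves_system_at_def D sc cg covD_S[OF x]
      using tt.equation_a[where S = "S x" and \<tau> = "grad t x", OF S g' Ric]
        tt.equation_b[where S = "S x" and \<tau> = "grad t x", OF S g' Ric]
        tt.equation_c[where S = "S x" and \<tau> = "grad t x", OF S g'] by blast
    then show ?thesis using g[OF xr] by blast
  qed
  then show ?thesis using t by blast
qed

lemma S_symmetric_tracefree:
  assumes x: "x \<in> U" shows "totally_symmetric 3 (S x)" "totally_tracefree (h x) 3 (S x)"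
proof -
  interpret tt: tractor_tensors "h x" "T x" "H x" "P x" by (rule tractor[OF x])
  have sym: "S x [i, j, k] = S x [j, i, k]" "S x [i, j, k] = S x [i, k, j]" for i j k
    unfolding S_eq[OF x] by (rule tt.s_sym)+
  show "totally_symmetric 3 (S x)"
    unfolding totally_symmetric_def
  proof (intro allI impI)
    fix I J :: "'n list" assume "length I = 3" and m': "mset I = mset J"
    then obtain i j k where I: "I = [i, j, k]" by (blast elim: length_3E)
    note m = m'[unfolded I]
    then have "length J = 3" using mset_eq_length[OF m] by simp
    then obtain a b c where J: "J = [a, b, c]" by (rule length_3E)
    have perm: "(a = i \<and> b = j \<and> c = k) \<or> (a = i \<and> b = k \<and> c = j) \<or> (a = j \<and> b = i \<and> c = k) \<or>
        (a = j \<and> b = k \<and> c = i) \<or> (a = k \<and> b = i \<and> c = j) \<or> (a = k \<and> b = j \<and> c = i)"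
      using m unfolding J by (auto simp: add_eq_conv_ex split: if_splits)
    then show "S x I = S x J" unfolding I J using sym by metis
  qed
  show "totally_tracefree (h x) 3 (S x)"
    unfolding totally_tracefree_3
  proof (intro conjI allI)
    show t: "trace_form (h x) (\<lambda>a b. S x [a, b, k]) = 0" for k unfolding S_eq[OF x] by (rule tt.s_tracefree)
    have e: "(\<lambda>a b. S x [a, j, b]) = (\<lambda>a b. S x [a, b, j])" for j by (intro ext) (rule sym)
    show "trace_form (h x) (\<lambda>a b. S x [a, j, b]) = 0" for j unfolding e by (rule t)
    have "S x [i, a, b] = S x [a, b, i]" for a b i using sym by metis
    then have e': "(\<lambda>a b. S x [i, a, b]) = (\<lambda>a b. S x [a, b, i])" for i by (intro ext)
    show "trace_form (h x) (\<lambda>a b. S x [i, a, b]) = 0" for i unfolding e' by (rule t)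
  qed
qed

end

section \<open>Conformally flat metrics lie on the light cone\<close>

lemma smoothv_Pair:
  assumes "open U" "smoothv U f" "smoothv U g" shows "smoothv U (\<lambda>x. (f x, g x))"
proof -
  have "bounded_linear (\<lambda>a. (a, 0))" "bounded_linear (\<lambda>b. (0, b))"
    by (auto intro!: bounded_linear_Pair bounded_linear_ident bounded_linear_zero)
  then have "smoothv U (\<lambda>x. (f x, 0) + (0, g x))"
    using assms by (intro smoothv_add smoothv_linear[where L = "\<lambda>a. (a, 0)"] smoothv_linear[where L = "\<lambda>b. (0, b)"])
  then show ?thesis by simp
qed

lemma pv_Pair:
  assumes "f differentiable (at x)" "g differentiable (at x)"
  shows "pv k (\<lambda>x. (f x, g x)) x = (pv k f x, pv k g x)"
  using pv_eqI[OF has_derivative_Pair[OF frechet_derivative_works[THEN iffD1, OF assms(1)]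
      frechet_derivative_works[THEN iffD1, OF assms(2)]]] by (simp add: pv_def)

text \<open>By bootstrapping from the equation \<open>\<partial>\<^sub>k f = - \<partial>\<^sub>k\<rho> f / 2\<rho>\<close>.\<close>

lemma smoothv_inverse_sqrt:
  fixes \<rho> :: "real^'n::finite \<Rightarrow> real"
  assumes U: "open U" and \<rho>: "smoothv U \<rho>" and pos: "\<And>x. x \<in> U \<Longrightarrow> \<rho> x > 0"
  shows "smoothv U (\<lambda>x. inverse (sqrt (\<rho> x)))"
proof (rule smoothv_bootstrap_bilinear[OF U bounded_bilinear_mult])
  have d: "((\<lambda>x. inverse (sqrt (\<rho> x))) has_derivative
      (\<lambda>v. (- inverse (sqrt (\<rho> x)) / (2 * \<rho> x)) * frechet_derivative \<rho> (at x) v)) (at x)" if x: "x \<in> U" for x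
  proof -
    have "((\<lambda>z. inverse (sqrt z)) has_field_derivative (- inverse (sqrt (\<rho> x)) / (2 * \<rho> x))) (at (\<rho> x))"
      using pos[OF x] by (auto intro!: derivative_eq_intros simp: field_simps power2_eq_square real_sqrt_mult_self)
    then have 1: "((\<lambda>z. inverse (sqrt z)) has_derivative (\<lambda>h. (- inverse (sqrt (\<rho> x)) / (2 * \<rho> x)) * h)) (at (\<rho> x))"
      unfolding has_field_derivative_def .
    have 2: "(\<rho> has_derivative frechet_derivative \<rho> (at x)) (at x)"
      using smoothv_differentiable[OF \<rho> x] frechet_derivative_works by blast
    show ?thesis by (rule has_derivative_compose[OF 2 1])
  qed
  show "(\<lambda>x. inverse (sqrt (\<rho> x))) differentiable (at x)" if "x \<in> U" for x
    using d[OF that] differentiable_def by blast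
  show "smoothv U (\<lambda>x. - (1/2) * (inverse (\<rho> x) * pv k \<rho> x))" for k
  proof -
    have "\<rho> x \<noteq> 0" if "x \<in> U" for x using pos[OF that] by simp
    then show ?thesis by (intro smoothv_cmult smoothv_mult smoothv_inverse smoothv_pv \<rho> U)
  qed
  show "pv k (\<lambda>x. inverse (sqrt (\<rho> x))) x = - (1/2) * (inverse (\<rho> x) * pv k \<rho> x) * inverse (sqrt (\<rho> x))"
    if "x \<in> U" for k x
    using pv_eqI[OF d[OF that], of k] by (simp add: pv_def field_simps)
qed

lemma transpose_bounded_linear: "bounded_linear (transpose :: real^'n^'m \<Rightarrow> real^'m^'n)"
  unfolding linear_conv_bounded_linear[symmetric]
  by (auto intro!: linearI simp: transpose_def vec_eq_iff)

lemma nondegenerate_form_scaleR: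
  assumes "nondegenerate_form \<gamma>" "c \<noteq> 0" shows "nondegenerate_form (c *\<^sub>R \<gamma>)"
proof -
  interpret nondegenerate_form \<gamma> by fact
  note s = bounded_bilinear.scaleR_left[OF matrix_mult_bilinear] bounded_bilinear.scaleR_right[OF matrix_mult_bilinear]
  show ?thesis
  proof
    show "transpose (c *\<^sub>R \<gamma>) = c *\<^sub>R \<gamma>"
      using linear_scale[OF bounded_linear.linear[OF transpose_bounded_linear], of c \<gamma>] \<gamma>_transpose by simp
    show "invertible (c *\<^sub>R \<gamma>)"
      unfolding invertible_def using assms(2)
      by (intro exI[of _ "inverse c *\<^sub>R matrix_inv \<gamma>"]) (simp add: s ginv_mult)
  qed
qed

text \<open>Flat coordinates \<open>y\<close> for the flat metric in the conformal class: \<open>u\<close> is its parallel coframe,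
  \<open>dy = u\<close>, and constancy of the metric in the coframe follows from uniqueness for the linear
  system satisfied by the defect.\<close>

lemma flat_coordinates:
  fixes g :: "real^'n::finite \<Rightarrow> real^'n^'n"
  assumes "chart_metric g U" and p: "p \<in> U" and flat: "\<And>x m i j k. x \<in> U \<Longrightarrow> riemann g x m i j k = 0"
    and \<gamma>: "g p = (l * l) *\<^sub>R \<gamma>"
  shows "\<exists>r y u. r > 0 \<and> ball p r \<subseteq> U \<and> smoothv (ball p r) (y :: real^'n \<Rightarrow> real^'n) \<and> y p = 0 \<and> u p = l *\<^sub>R mat 1 \<and>
     (\<forall>x\<in>ball p r. (\<forall>k. pv k y x = u x $ k) \<and> g x = u x ** \<gamma> ** transpose (u x))"
proof -
  interpret chart_metric g U by fact
  define A where "A = (\<lambda>k x. (\<chi> i m. \<Gamma> x m k i) :: real^'n^'n)"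
  have A: "smoothv U (A k)" for k
    unfolding A_def by (intro smoothv_axis U) (simp add: christoffel_smooth)
  have pA: "pv j (A k) x $ i $ m = pv j (\<lambda>y. \<Gamma> y m k i) x" if x: "x \<in> U" for j k x i m
  proof -
    have d: "A k differentiable (at x)" by (rule smoothv_differentiable[OF A x])
    have "pv j (\<lambda>y. A k y $ i $ m) x = pv j (A k) x $ i $ m"
      using pv_component[OF d, of j i] pv_component[OF differentiable_linear[OF bounded_linear_vec_nth d], of j i m] by simp
    then show ?thesis by (simp add: A_def)
  qed
  note add = bounded_bilinear.add_left[OF matrix_mult_bilinear]
  have fl: "pv j (A k) x ** w + A k x ** (A j x ** w) = pv k (A j) x ** w + A j x ** (A k x ** w)"
    if x: "x \<in> U" for x j k and w :: "real^'n^'n"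
  proof -
    have "pv j (A k) x + A k x ** A j x = pv k (A j) x + A j x ** A k x"
    proof (simp only: vec_eq_iff, intro allI)
      fix i m
      show "(pv j (A k) x + A k x ** A j x) $ i $ m = (pv k (A j) x + A j x ** A k x) $ i $ m"
        using flat[OF x, of m i j k] unfolding riemann_def pd_eq_pv
        by (simp add: pA[OF x]) (simp add: matrix_matrix_mult_def A_def sum_subtractf mult.commute)
    qed
    then have "(pv j (A k) x + A k x ** A j x) ** w = (pv k (A j) x + A j x ** A k x) ** w" by simp
    then show ?thesis by (simp add: add matrix_mul_assoc)
  qed
  obtain r1 u where u: "r1 > 0" "ball p r1 \<subseteq> U" "u p = l *\<^sub>R mat 1" "smoothv (ball p r1) u"
    "\<And>x k. x \<in> ball p r1 \<Longrightarrow> pv k u x = A k x ** u x"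
    using flat_linear_system_solvable[OF matrix_mult_bilinear U p, where A = A and ?u0.0 = "l *\<^sub>R mat 1"] A fl by blast
  have du: "u differentiable (at x)" if "x \<in> ball p r1" for x by (rule smoothv_differentiable[OF u(4) that])
  have closed: "pv j (\<lambda>x. u x $ k) x = pv k (\<lambda>x. u x $ j) x" if x: "x \<in> ball p r1" for x j k
  proof -
    have "x \<in> U" using x u by blast
    then show ?thesis
      by (simp add: pv_component[OF du[OF x]] u(5)[OF x] vec_eq_iff matrix_matrix_mult_def A_def christoffel_sym[of x _ j k])
  qed
  obtain r2 y where y: "r2 > 0" "ball p r2 \<subseteq> ball p r1" "y p = 0" "smoothv (ball p r2) y"
    "\<And>x k. x \<in> ball p r2 \<Longrightarrow> pv k y x = u x $ k"
    using poincare[OF open_ball _ smoothv_component[OF open_ball u(4)] closed, of p 0] u(1) by auto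
  define m where "m = (\<lambda>(a :: real^'n^'n) (d :: real^'n^'n). a ** d + d ** transpose a)"
  have m: "bounded_bilinear m"
    unfolding m_def bilinear_conv_bounded_bilinear[symmetric] bilinear_def
    by (auto intro!: linearI simp: matrix_matrix_mult_def transpose_def vec_eq_iff sum.distrib sum_distrib_left algebra_simps)
  define D where "D = (\<lambda>x. g x - u x ** \<gamma> ** transpose (u x))"
  have dtu: "(\<lambda>x. transpose (u x)) differentiable (at x)" if "x \<in> ball p r1" for x
    by (rule differentiable_linear[OF transpose_bounded_linear du[OF that]])
  note mb = matrix_mult_bilinear
  have dug: "(\<lambda>x. u x ** \<gamma>) differentiable (at x)" if "x \<in> ball p r1" for x
    by (rule differentiable_bilinear[OF mb du[OF that] differentiable_const])
  have dg: "g differentiable (at x)" if "x \<in> ball p r1" for x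
    using smoothv_differentiable[OF h_matrix_smooth] u(2) that by blast
  have dD: "D differentiable (at x)" if "x \<in> ball p r1" for x
    unfolding D_def by (intro differentiable_diff dg differentiable_bilinear[OF mb dug dtu] that)
  have pD: "pv k D x = m (A k x) (D x)" if x: "x \<in> ball p r1" for x k
  proof -
    have xU: "x \<in> U" using x u by blast
    have pg: "pv k g x = m (A k x) (g x)"
    proof (simp only: vec_eq_iff, intro allI)
      fix i j
      have "pv k g x $ i $ j = pv k (\<lambda>y. g y $ i $ j) x"
        using pv_component[OF dg[OF x], of k i] pv_component[OF differentiable_linear[OF bounded_linear_vec_nth dg[OF x]], of k i j] by simp
      then show "pv k g x $ i $ j = m (A k x) (g x) $ i $ j"
        unfolding metric_compatible[OF xU]
        by (simp add: m_def A_def matrix_matrix_mult_def transpose_def mult.commute)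
    qed
    have "pv k (\<lambda>x. u x ** \<gamma> ** transpose (u x)) x = (A k x ** u x) ** \<gamma> ** transpose (u x) + u x ** \<gamma> ** transpose (A k x ** u x)"
      by (simp add: pv_bilinear[OF mb dug[OF x] dtu[OF x]] pv_bilinear[OF mb du[OF x] differentiable_const]
          pv_linear[OF transpose_bounded_linear du[OF x]] u(5)[OF x] bounded_bilinear.zero_right[OF mb])
    also have "\<dots> = m (A k x) (u x ** \<gamma> ** transpose (u x))"
      by (simp add: m_def matrix_transpose_mul matrix_mul_assoc)
    finally show ?thesis
      unfolding D_def using pv_diff[OF dg[OF x] differentiable_bilinear[OF mb dug[OF x] dtu[OF x]], of k] pg
      by (simp add: bounded_bilinear.diff_right[OF m])
  qed
  have Dp: "D p = 0"
    unfolding D_def u(3) \<gamma>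
    using linear_scale[OF bounded_linear.linear[OF transpose_bounded_linear], of l "mat 1 :: real^'n^'n"]
    by (simp add: bounded_bilinear.scaleR_left[OF mb] bounded_bilinear.scaleR_right[OF mb] transpose_mat)
  have Ac: "continuous_on (ball p r1) (A k)" for k
    using continuous_on_subset[OF smoothv_continuous_on[OF A] u(2)] .
  obtain r3 where r3: "r3 > 0" "ball p r3 \<subseteq> ball p r1" "\<And>x. x \<in> ball p r3 \<Longrightarrow> D x = 0"
    using linear_system_unique[OF open_ball _ dD m Ac pD Dp] u(1) by auto
  let ?r = "min r2 r3"
  have sub: "ball p ?r \<subseteq> ball p r2" "ball p ?r \<subseteq> ball p r3" by auto
  have "?r > 0" using y r3 by simp
  moreover have "ball p ?r \<subseteq> U" using sub y u by blast
  moreover have "smoothv (ball p ?r) y" using smoothv_subset[OF y(4) sub(1)] .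
  moreover have "\<forall>x\<in>ball p ?r. (\<forall>k. pv k y x = u x $ k) \<and> g x = u x ** \<gamma> ** transpose (u x)"
    using y(5) r3(3) sub by (auto simp: D_def)
  ultimately show ?thesis using y(3) u(3) by blast
qed

context nondegenerate_form
begin

definition cone_form :: "real \<times> (real^'n) \<times> real \<Rightarrow> real \<times> (real^'n) \<times> real \<Rightarrow> real" where
  "cone_form v v' = fst v * snd (snd v') + fst v' * snd (snd v) + bform (fst (snd v)) (fst (snd v'))"

lemma cone_form_bilinear: "bounded_bilinear cone_form"
  unfolding bilinear_conv_bounded_bilinear[symmetric] bilinear_def cone_form_def
  by (auto intro!: linearI simp: bilinear_ladd[OF bform_bilinear] bilinear_radd[OF bform_bilinear]
      bilinear_lmul[OF bform_bilinear] bilinear_rmul[OF bform_bilinear] algebra_simps)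

lemma bform_matrix: "(u ** \<gamma> ** transpose u) $ i $ j = bform (u $ i) (u $ j)"
proof -
  have "bform (u $ i) (u $ j) = (\<Sum>a\<in>UNIV. u $ i $ a * (\<Sum>b\<in>UNIV. \<gamma> $ a $ b * u $ j $ b))"
    by (simp add: bform_def inner_vec_def matrix_vector_mult_def)
  moreover have "(u ** \<gamma> ** transpose u) $ i $ j = (\<Sum>b\<in>UNIV. (\<Sum>a\<in>UNIV. u $ i $ a * \<gamma> $ a $ b) * u $ j $ b)"
    by (simp add: matrix_matrix_mult_def transpose_def)
  moreover have "(\<Sum>b\<in>UNIV. (\<Sum>a\<in>UNIV. u $ i $ a * \<gamma> $ a $ b) * u $ j $ b) = (\<Sum>a\<in>UNIV. u $ i $ a * (\<Sum>b\<in>UNIV. \<gamma> $ a $ b * u $ j $ b))"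
    unfolding sum_distrib_left sum_distrib_right by (subst sum.swap) (simp add: mult.assoc)
  ultimately show ?thesis by simp
qed

text \<open>In flat coordinates \<open>y\<close> the paraboloid \<open>(l, y, - \<beta>(y, y) / 2l)\<close> lies on the cone and induces the
  flat metric.  Rescaling it by \<open>\<rho>\<^bsup>-1/2\<^esup>\<close> multiplies the induced metric by \<open>1 / \<rho>\<close>, since a null vector is
  orthogonal to itself and to the derivatives of the paraboloid.  With \<open>l\<^sup>2 = \<rho>(p)\<close> the base point is
  mapped to \<open>(1, 0, 0)\<close>, the unit of the algebra.\<close>

lemma light_cone_immersion:
  assumes "chart_metric h U" and p: "p \<in> U" and hp: "h p = \<gamma>"
    and \<rho>: "smoothv U \<rho>" "\<And>x. x \<in> U \<Longrightarrow> \<rho> x > 0"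
    and flat: "\<And>x m i j k. x \<in> U \<Longrightarrow> riemann (\<lambda>z. \<rho> z *\<^sub>R h z) x m i j k = 0"
  shows "\<exists>r X Y0 \<omega>. r > 0 \<and> ball p r \<subseteq> U \<and> smoothv (ball p r) X \<and> X p = (1, 0, 0) \<and>
    (\<forall>i. pv i X p = (\<omega> i, axis i 1, 0)) \<and>
    (\<forall>x\<in>ball p r. cone_form (X x) (X x) = 0 \<and> (\<forall>i j. cone_form (pv i X x) (pv j X x) = h x $ i $ j) \<and>
       cone_form (X x) (Y0 x) = 1 \<and>
       (\<forall>v. cone_form v (X x) = 0 \<longrightarrow> cone_form v (Y0 x) = 0 \<longrightarrow> (\<forall>i. cone_form v (pv i X x) = 0) \<longrightarrow> v = 0))"
proof -
  interpret c: chart_metric h U by fact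
  have g: "chart_metric (\<lambda>z. \<rho> z *\<^sub>R h z) U"
  proof (rule chart_metric.intro)
    show "open U" by (rule c.U)
    show "smoothv U (\<lambda>x. (\<rho> x *\<^sub>R h x) $ i $ j)" for i j
      using smoothv_mult[OF c.U \<rho>(1) c.h_smooth[of i j]] by simp
    show "nondegenerate_form (\<rho> x *\<^sub>R h x)" if "x \<in> U" for x
      using nondegenerate_form_scaleR[OF c.h_form[OF that], of "\<rho> x"] \<rho>(2)[OF that] by simp
  qed
  define l where "l = sqrt (\<rho> p)"
  have l: "l > 0" "l * l = \<rho> p" using \<rho>(2)[OF p] by (auto simp: l_def)
  have gp: "\<rho> p *\<^sub>R h p = (l * l) *\<^sub>R \<gamma>" using l hp by simp
  obtain r y u where r: "r > 0" "ball p r \<subseteq> U" "smoothv (ball p r) (y :: real^'n \<Rightarrow> real^'n)" "y p = 0" "u p = l *\<^sub>R mat 1"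
    "\<And>x k. x \<in> ball p r \<Longrightarrow> pv k y x = u x $ k"
    "\<And>x. x \<in> ball p r \<Longrightarrow> \<rho> x *\<^sub>R h x = u x ** \<gamma> ** transpose (u x)"
    using flat_coordinates[OF g p flat gp] by blast
  have pr: "p \<in> ball p r" using r by simp
  note bs = bilinear_ladd[OF bform_bilinear] bilinear_radd[OF bform_bilinear]
      bilinear_lmul[OF bform_bilinear] bilinear_rmul[OF bform_bilinear] bilinear_lzero[OF bform_bilinear] bilinear_rzero[OF bform_bilinear]
  have bb: "bounded_bilinear bform" using bform_bilinear bilinear_conv_bounded_bilinear by blast
  define \<Omega> where "\<Omega> = (\<lambda>x. inverse (sqrt (\<rho> x)))"
  have \<Omega>: "smoothv (ball p r) \<Omega>"
    unfolding \<Omega>_def using smoothv_subset[OF smoothv_inverse_sqrt[OF c.U \<rho>] r(2)] .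
  have \<Omega>_pos: "\<Omega> x > 0" "\<Omega> x * \<Omega> x * \<rho> x = 1" if "x \<in> ball p r" for x
  proof -
    have "\<rho> x > 0" using \<rho>(2) r(2) that by blast
    then show "\<Omega> x > 0" "\<Omega> x * \<Omega> x * \<rho> x = 1" by (auto simp: \<Omega>_def field_simps)
  qed
  define b where "b = (\<lambda>x. - (1 / (2 * l)) * bform (y x) (y x))"
  have b: "smoothv (ball p r) b" unfolding b_def
    by (intro smoothv_cmult open_ball smoothv_bilinear[OF bb] r)
  define Xh where "Xh = (\<lambda>x. (l, y x, b x))"
  have Xh: "smoothv (ball p r) Xh" unfolding Xh_def by (intro smoothv_Pair open_ball smoothv_const r b)
  define X where "X = (\<lambda>x. \<Omega> x *\<^sub>R Xh x)"
  have X: "smoothv (ball p r) X" unfolding X_def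
    by (intro smoothv_bilinear[OF bounded_bilinear_scaleR] open_ball \<Omega> Xh)
  have pXh: "pv i Xh x = (0, u x $ i, - (1 / l) * bform (y x) (u x $ i))" if x: "x \<in> ball p r" for i x
  proof -
    have "pv i b x = - (1 / l) * bform (y x) (u x $ i)"
      unfolding b_def using pv_mult[of "\<lambda>_. - (1 / (2 * l))" x "\<lambda>x. bform (y x) (y x)" i]
        differentiable_bilinear[OF bb smoothv_differentiable[OF r(3) x] smoothv_differentiable[OF r(3) x]]
      by (simp add: pv_bilinear[OF bb smoothv_differentiable[OF r(3) x] smoothv_differentiable[OF r(3) x]] r(6)[OF x] bform_sym[of "u x $ i"])
    then show ?thesis
      unfolding Xh_def using smoothv_differentiable[OF r(3) x] smoothv_differentiable[OF b x]
      by (simp add: pv_Pair differentiable_Pair r(6)[OF x])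
  qed
  have pX: "pv i X x = pv i \<Omega> x *\<^sub>R Xh x + \<Omega> x *\<^sub>R pv i Xh x" if x: "x \<in> ball p r" for i x
    unfolding X_def by (rule pv_bilinear[OF bounded_bilinear_scaleR smoothv_differentiable[OF \<Omega> x] smoothv_differentiable[OF Xh x]])
  note cb = bounded_bilinear.add_left[OF cone_form_bilinear] bounded_bilinear.add_right[OF cone_form_bilinear]
    bounded_bilinear.scaleR_left[OF cone_form_bilinear] bounded_bilinear.scaleR_right[OF cone_form_bilinear]
  have c0: "cone_form (Xh x) (Xh x) = 0" for x
    using l by (simp add: cone_form_def Xh_def b_def field_simps)
  have c1: "cone_form (Xh x) (pv i Xh x) = 0" "cone_form (pv i Xh x) (Xh x) = 0" if "x \<in> ball p r" for x i
    using l bform_sym[of "u x $ i" "y x"] unfolding pXh[OF that] cone_form_def by (simp_all add: Xh_def)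
  have c2: "cone_form (pv i Xh x) (pv j Xh x) = \<rho> x * h x $ i $ j" if "x \<in> ball p r" for x i j
    using arg_cong[OF r(7)[OF that], of "\<lambda>m. m $ i $ j"]
    by (simp add: pXh[OF that] cone_form_def bform_matrix)
  define Y0 where "Y0 = (\<lambda>x. (0 :: real, 0 :: real^'n, 1 / (\<Omega> x * l)))"
  have main: "cone_form (X x) (X x) = 0" "cone_form (pv i X x) (pv j X x) = h x $ i $ j" "cone_form (X x) (Y0 x) = 1"
    if x: "x \<in> ball p r" for x i j
  proof -
    show "cone_form (X x) (X x) = 0" unfolding X_def cb c0 by simp
    show "cone_form (pv i X x) (pv j X x) = h x $ i $ j"
      unfolding pX[OF x] cb c0 c1[OF x] c2[OF x] using \<Omega>_pos(2)[OF x] by (simp add: mult.assoc[symmetric])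
    show "cone_form (X x) (Y0 x) = 1"
      unfolding X_def cb using \<Omega>_pos(1)[OF x] l by (simp add: cone_form_def Xh_def Y0_def bs)
  qed
  have nd: "v = 0" if x: "x \<in> ball p r" and v: "cone_form v (X x) = 0" "cone_form v (Y0 x) = 0" "\<And>i. cone_form v (pv i X x) = 0" for x v
  proof -
    obtain a w e where v_eq: "v = (a, w, e)" by (cases v)
    have a: "a = 0" using v(2) \<Omega>_pos(1)[OF x] l by (simp add: v_eq cone_form_def Y0_def bs)
    have vX: "cone_form v (Xh x) = 0" using v(1) \<Omega>_pos(1)[OF x] unfolding X_def cb by simp
    have "cone_form v (pv i Xh x) = 0" for i
      using v(3)[of i] \<Omega>_pos(1)[OF x] unfolding pX[OF x] cb vX by simp
    then have "bform w (u x $ i) = 0" for i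
      by (simp add: pXh[OF x] v_eq cone_form_def a)
    then have "(u x *v (\<gamma> *v w)) $ i = 0" for i
      unfolding bform_sym[of w] by (simp add: bform_def inner_vec_def matrix_vector_mult_def)
    then have 0: "u x *v (\<gamma> *v w) = 0" by (simp add: vec_eq_iff)
    have xU: "x \<in> U" using x r by blast
    interpret g: nondegenerate_form "\<rho> x *\<^sub>R h x" using chart_metric.h_form[OF g xU] .
    have "u x ** (\<gamma> ** transpose (u x) ** matrix_inv (\<rho> x *\<^sub>R h x)) = mat 1"
      using g.ginv_mult(1) r(7)[OF x] by (simp add: matrix_mul_assoc)
    then obtain i where i: "i ** u x = mat 1" using matrix_left_right_inverse by blast
    have "i *v (u x *v (\<gamma> *v w)) = \<gamma> *v w" 
      unfolding matrix_vector_mul_assoc[of i "u x"] i by (rule matrix_vector_mul_lid)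
    then have "\<gamma> *v w = 0" using 0 by simp
    then have "matrix_inv \<gamma> *v (\<gamma> *v w) = 0" by simp
    then have w: "w = 0" by (simp add: matrix_vector_mul_assoc ginv_mult)
    have "e = 0" using vX l by (simp add: v_eq cone_form_def Xh_def a w bs)
    then show "v = 0" using a w by (simp add: v_eq zero_prod_def)
  qed
  have Xp: "X p = (1, 0, 0)"
    using l by (simp add: X_def Xh_def \<Omega>_def l_def[symmetric] r(4) b_def bs)
  have pXp: "pv i X p = (pv i \<Omega> p * l, axis i 1, 0)" for i
    using l unfolding pX[OF pr] pXh[OF pr]
    by (simp add: Xh_def \<Omega>_def l_def[symmetric] r(4,5) b_def bs mat_def axis_def vec_eq_iff)
  show ?thesis
    using r(1,2) X Xp pXp main nd by (intro exI[of _ r] exI[of _ X] exI[of _ Y0] exI[of _ "\<lambda>i. pv i \<Omega> p * l"]) auto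
qed

end

section \<open>Solutions with prescribed initial values\<close>

lemma chart_metric_subset:
  assumes "chart_metric h U" "open V" "V \<subseteq> U" shows "chart_metric h V"
proof (rule chart_metric.intro)
  interpret chart_metric h U by fact
  show "smoothv V (\<lambda>x. h x $ i $ j)" for i j by (rule smoothv_subset[OF h_smooth assms(3)])
  show "nondegenerate_form (h x)" if "x \<in> V" for x using h_form that assms(3) by blast
qed (rule assms(2))

context nondegenerate_form
begin

text \<open>The second null normal is obtained from any vector \<open>Y0\<close> transversal to the null normal \<open>X\<close>: its
  tangential part is removed first, and then a multiple of \<open>X\<close> makes it null.\<close>

lemma null_frame:
  fixes B :: "'e::euclidean_space \<Rightarrow> 'e \<Rightarrow> real" and X Y0 :: 'e and Z :: "'n \<Rightarrow> 'e"
  assumes B: "bounded_bilinear B" and sym: "\<And>v v'. B v v' = B v' v"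
    and XX: "B X X = 0" and XZ: "\<And>i. B X (Z i) = 0" and ZZ: "\<And>i j. B (Z i) (Z j) = \<gamma> $ i $ j" and XY: "B X Y0 = 1"
    and nd: "\<And>v. B v X = 0 \<Longrightarrow> B v Y0 = 0 \<Longrightarrow> (\<And>i. B v (Z i) = 0) \<Longrightarrow> v = 0"
  shows "\<exists>Y. B X Y = 1 \<and> B Y Y = 0 \<and> (\<forall>i. B Y (Z i) = 0) \<and>
     (\<forall>v v'. B v v' = B v Y * B v' X + B v X * B v' Y + trace_form \<gamma> (\<lambda>a b. B v (Z a) * B v' (Z b)))"
proof -
  interpret B: bounded_bilinear B by fact
  note bl = B.add_left B.add_right B.diff_left B.diff_right B.scaleR_left B.scaleR_right B.sum_left B.sum_right
  define R where "R = (\<lambda>\<phi>. \<Sum>a\<in>UNIV. \<Sum>b\<in>UNIV. (ginv \<gamma> a b * \<phi> a) *\<^sub>R Z b)"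
  have RZ: "B (R \<phi>) (Z c) = \<phi> c" for \<phi> c
  proof -
    have "B (R \<phi>) (Z c) = trace_form \<gamma> (\<lambda>a b. \<phi> a * \<gamma> $ b $ c)"
      by (simp add: R_def bl ZZ trace_form_def mult.assoc)
    then show ?thesis by (simp add: trace_form_contract)
  qed
  have XR: "B X (R \<phi>) = 0" for \<phi> by (simp add: R_def bl XZ)
  have vR: "B v' (R \<phi>) = trace_form \<gamma> (\<lambda>a b. \<phi> a * B v' (Z b))" for v' \<phi>
    by (simp add: R_def bl trace_form_def mult.assoc)
  define Y1 where "Y1 = Y0 - R (\<lambda>a. B Y0 (Z a))"
  define Y where "Y = Y1 - (B Y1 Y1 / 2) *\<^sub>R X"
  have Y1: "B X Y1 = 1" "B Y1 (Z c) = 0" for c by (simp_all add: Y1_def bl XY XR RZ)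
  have Y: "B X Y = 1" "B Y (Z c) = 0" for c by (simp_all add: Y_def bl Y1 XX XZ)
  have YY: "B Y Y = 0" using Y1 sym[of Y1 X] by (simp add: Y_def bl XX)
  have YR: "B Y (R \<phi>) = 0" for \<phi> by (simp add: vR Y trace_form_zero)
  have comp: "B v v' = B v Y * B v' X + B v X * B v' Y + trace_form \<gamma> (\<lambda>a b. B v (Z a) * B v' (Z b))" for v v'
  proof -
    define q where "q = v - B v Y *\<^sub>R X - B v X *\<^sub>R Y - R (\<lambda>a. B v (Z a))"
    have qX: "B q X = 0" using Y sym[of Y X] XR sym[of "R _" X] by (simp add: q_def bl XX)
    have qZ: "B q (Z c) = 0" for c by (simp add: q_def bl XZ Y RZ)
    have qY: "B q Y = 0" using YR sym[of "R _" Y] by (simp add: q_def bl Y YY)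
    have "Y0 = Y + (B Y1 Y1 / 2) *\<^sub>R X + R (\<lambda>a. B Y0 (Z a))" by (simp add: Y_def Y1_def)
    then have "B q Y0 = B q (Y + (B Y1 Y1 / 2) *\<^sub>R X + R (\<lambda>a. B Y0 (Z a)))" by simp
    also have "\<dots> = 0" by (simp add: bl qX qY vR qZ trace_form_zero)
    finally have "q = 0" using nd[OF qX _ qZ] by blast
    then have v: "v = B v Y *\<^sub>R X + B v X *\<^sub>R Y + R (\<lambda>a. B v (Z a))" by (simp add: q_def diff_eq_eq add_ac)
    have "B v v' = B v' v" by (rule sym)
    also have "\<dots> = B v' (B v Y *\<^sub>R X + B v X *\<^sub>R Y + R (\<lambda>a. B v (Z a)))" using v by simp
    also have "\<dots> = B v Y * B v' X + B v X * B v' Y + trace_form \<gamma> (\<lambda>a b. B v (Z a) * B v' (Z b))"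
      by (simp only: bl vR real_scaleR_def)
    finally show ?thesis .
  qed
  show ?thesis using Y YY comp by (intro exI[of _ Y]) blast
qed

end

text \<open>Multiplication by an element close to the unit is injective, hence bijective in finite
  dimensions.\<close>

lemma algebra_inverse_near_unit:
  fixes m :: "'e::euclidean_space \<Rightarrow> 'e \<Rightarrow> 'e" and X :: "'x::euclidean_space \<Rightarrow> 'e"
  assumes m: "bounded_bilinear m" and one: "\<And>a. m e a = a" and X: "isCont X p" "X p = e"
  shows "\<exists>r>0. \<forall>x\<in>ball p r. \<exists>v. m (X x) v = e"
proof -
  interpret m: bounded_bilinear m by fact
  obtain K where K: "K > 0" "\<And>a b. norm (m a b) \<le> norm a * norm b * K" using m.pos_bounded by blast
  obtain r where r: "r > 0" "\<And>x. dist x p < r \<Longrightarrow> dist (X x) e < 1 / (2 * K)"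
    using X(1)[unfolded continuous_at_eps_delta, rule_format, of "1 / (2 * K)"] K X(2) by auto
  have "\<exists>v. m (X x) v = e" if "x \<in> ball p r" for x
  proof -
    have d: "norm (X x - e) < 1 / (2 * K)" using r(2)[of x] that by (simp add: dist_norm norm_minus_commute)
    have lin: "linear (m (X x))" using m.bounded_linear_right bounded_linear.linear by blast
    have "inj (m (X x))"
    proof (rule linear_injective_0[OF lin, THEN iffD2], intro allI impI)
      fix v assume "m (X x) v = 0"
      then have "v = - m (X x - e) v" by (simp add: m.diff_left one)
      then have "norm v = norm (m (X x - e) v)" by (metis norm_minus_cancel)
      also have "\<dots> \<le> norm (X x - e) * norm v * K" by (rule K)
      also have "\<dots> = (norm (X x - e) * K) * norm v" by simp
      also have "\<dots> \<le> (1/2) * norm v"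
        using d K(1) by (intro mult_right_mono) (auto simp: field_simps)
      finally show "v = 0" by simp
    qed
    then have "surj (m (X x))" using lin linear_injective_imp_surjective by blast
    then show ?thesis by (metis surjD)
  qed
  then show ?thesis using r(1) by blast
qed

text \<open>At the base point, where \<open>V = 1\<close> and \<open>\<partial>\<^sub>iX = (\<omega>\<^sub>i, e\<^sub>i, 0)\<close>, the tensor \<open>T\<close> is \<open>- \<Psi> / 3\<close> plus
  the trace of \<open>\<omega> + \<nu>\<close>; so the trace-free part gives \<open>S = \<Psi>\<close>, and the trace gives the gradient.\<close>

theorem system_solvable:
  fixes h :: "real^'n::finite \<Rightarrow> real^'n^'n" and \<Psi> :: "'n tensor" and v :: "'n \<Rightarrow> real"
  assumes n3: "CARD('n) \<ge> 3" and h: "chart_metric h U" and p: "p \<in> U"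
    and \<rho>: "smoothv U \<rho>" "\<And>x. x \<in> U \<Longrightarrow> \<rho> x > 0"
    and flat: "\<And>x m i j k. x \<in> U \<Longrightarrow> riemann (\<lambda>z. \<rho> z *\<^sub>R h z) x m i j k = 0"
    and \<Psi>: "totally_symmetric 3 \<Psi>" "totally_tracefree (h p) 3 \<Psi>" and star: "star_condition (h p) \<Psi>"
  shows "\<exists>W t S. open W \<and> p \<in> W \<and> W \<subseteq> U \<and> smooth_on W t \<and> smooth_symmetric_tracefree3_on h W S \<and>
    (\<forall>x\<in>W. solves_system_at h t S x) \<and> (\<forall>i j k. S p [i, j, k] = \<Psi> [i, j, k]) \<and> t p = t0 \<and> (\<forall>i. grad t p [i] = v i)"
proof -
  interpret f: nondegenerate_form "h p" by (rule chart_metric.h_form[OF h p])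
  obtain r X Y0 \<omega> where r: "r > 0" "ball p r \<subseteq> U" "smoothv (ball p r) X" "X p = (1, 0, 0)"
    "\<And>i. pv i X p = (\<omega> i, axis i 1, 0)"
    "\<And>x. x \<in> ball p r \<Longrightarrow> f.cone_form (X x) (X x) = 0"
    "\<And>x i j. x \<in> ball p r \<Longrightarrow> f.cone_form (pv i X x) (pv j X x) = h x $ i $ j"
    "\<And>x. x \<in> ball p r \<Longrightarrow> f.cone_form (X x) (Y0 x) = 1"
    "\<And>x v. x \<in> ball p r \<Longrightarrow> f.cone_form v (X x) = 0 \<Longrightarrow> f.cone_form v (Y0 x) = 0 \<Longrightarrow>
        (\<And>i. f.cone_form v (pv i X x) = 0) \<Longrightarrow> v = 0"
    using f.light_cone_immersion[OF h p refl \<rho> flat] by blast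
  let ?T = "\<lambda>i j k. \<Psi> [i, j, k]" and ?e = "\<lambda>a. axis a 1 :: real^'n" and ?f = "\<lambda>a. f.raise (\<lambda>k. if k = a then 1 else 0)"
  obtain hop where hop: "star_algebra f.bform (f.prod3 ?T) hop ?e ?f (real CARD('n))"
    using f.star_algebra_of_tensor[OF n3 \<Psi> star] by blast
  \<comment> \<open>This choice makes \<open>\<omega> + \<nu> = - v / 3\<close>, hence \<open>\<theta> = - (n + 2) v / 3\<close>.\<close>
  define \<nu> where "\<nu> = (\<lambda>k. - v k / 3 - \<omega> k)"
  define st where "st = (\<lambda>u w. (- 1/3) *\<^sub>R f.prod3 ?T u w + f.bform (f.raise \<nu>) u *\<^sub>R w + f.bform (f.raise \<nu>) w *\<^sub>R u
      + f.bform u w *\<^sub>R f.raise \<nu>)"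
  obtain hop' where "star_algebra f.bform st hop' ?e ?f (real CARD('n))"
    using star_algebra_shift[OF hop, of "- 1/3" "f.raise \<nu>"] unfolding st_def by blast
  then interpret alg: star_algebra f.bform st hop' ?e ?f "real CARD('n)" .
  have frob: "alg.frob = f.cone_form"
    by (intro ext) (auto simp: alg.frob_def alg.mul_def f.cone_form_def split: prod.splits)
  have one: "X p = alg.unit" by (simp add: r(4) alg.unit_def)
  have pr: "p \<in> ball p r" using r(1) by simp
  have cont: "isCont X p"
    using smoothv_differentiable[OF r(3) pr] differentiable_imp_continuous_within by blast
  obtain r' where r': "r' > 0" "\<And>x. x \<in> ball p r' \<Longrightarrow> \<exists>v. alg.mul (X x) v = alg.unit"
    using algebra_inverse_near_unit[OF alg.mul_bilinear alg.mul_unit(1) cont one] by blast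
  let ?W = "ball p (min r r')"
  have W: "?W \<subseteq> ball p r" "?W \<subseteq> ball p r'" "p \<in> ?W" "?W \<subseteq> U" using r r' by auto
  obtain V where V: "\<And>x. x \<in> ?W \<Longrightarrow> alg.mul (X x) (V x) = alg.unit"
  proof -
    have "\<forall>x\<in>?W. \<exists>v. alg.mul (X x) v = alg.unit" using r'(2) W(2) by blast
    from bchoice[OF this] show ?thesis using that by blast
  qed
  have X: "smoothv ?W X" by (rule smoothv_subset[OF r(3) W(1)])
  have Vs: "smoothv ?W V"
    by (rule smoothv_algebra_inverse(1)[OF alg.mul_bilinear alg.mul_assoc alg.mul_unit open_ball _ V X])
      (use V alg.mul_comm in simp)
  have hW: "chart_metric h ?W" by (rule chart_metric_subset[OF h open_ball W(4)])
  have csym: "f.cone_form a b = f.cone_form b a" for a b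
    by (simp add: f.cone_form_def f.bform_sym mult.commute)
  have "\<exists>Y. f.cone_form (X x) Y = 1 \<and> f.cone_form Y Y = 0 \<and> (\<forall>i. f.cone_form Y (pv i X x) = 0) \<and>
     (\<forall>v v'. f.cone_form v v' = f.cone_form v Y * f.cone_form v' (X x) + f.cone_form v (X x) * f.cone_form v' Y
        + trace_form (h x) (\<lambda>a b. f.cone_form v (pv a X x) * f.cone_form v' (pv b X x)))" if x: "x \<in> ?W" for x
  proof (rule nondegenerate_form.null_frame[OF chart_metric.h_form[OF hW x] f.cone_form_bilinear csym])
    have xr: "x \<in> ball p r" using x W by blast
    note r6 = r(6-9)[OF xr]
    show "f.cone_form (X x) (X x) = 0" "f.cone_form (X x) (Y0 x) = 1" by (rule r6)+
    show "f.cone_form (pv i X x) (pv j X x) = h x $ i $ j" for i j by (rule r(7)[OF xr])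
    show "f.cone_form (X x) (pv i X x) = 0" for i
    proof -
      have d: "X differentiable (at x)" by (rule smoothv_differentiable[OF r(3) xr])
      have "pv i (\<lambda>y. f.cone_form (X y) (X y)) x = pv i (\<lambda>y. 0) x"
        by (rule pv_cong[OF open_ball xr r(6)])
      then show ?thesis unfolding pv_bilinear[OF f.cone_form_bilinear d d]
        using csym[of "X x" "pv i X x"] by simp
    qed
    show "v = 0" if "f.cone_form v (X x) = 0" "f.cone_form v (Y0 x) = 0" "\<And>i. f.cone_form v (pv i X x) = 0" for v
      using r(9)[OF xr that] .
  qed
  then have "\<forall>x\<in>?W. \<exists>Y. f.cone_form (X x) Y = 1 \<and> f.cone_form Y Y = 0 \<and> (\<forall>i. f.cone_form Y (pv i X x) = 0) \<and>
     (\<forall>v v'. f.cone_form v v' = f.cone_form v Y * f.cone_form v' (X x) + f.cone_form v (X x) * f.cone_form v' Y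
        + trace_form (h x) (\<lambda>a b. f.cone_form v (pv a X x) * f.cone_form v' (pv b X x)))" by blast
  from bchoice[OF this] obtain Y where Y: "\<And>x. x \<in> ?W \<Longrightarrow> f.cone_form (X x) (Y x) = 1"
    "\<And>x. x \<in> ?W \<Longrightarrow> f.cone_form (Y x) (Y x) = 0" "\<And>x i. x \<in> ?W \<Longrightarrow> f.cone_form (Y x) (pv i X x) = 0"
    "\<And>x v v'. x \<in> ?W \<Longrightarrow> f.cone_form v v' = f.cone_form v (Y x) * f.cone_form v' (X x) + f.cone_form v (X x) * f.cone_form v' (Y x)
        + trace_form (h x) (\<lambda>a b. f.cone_form v (pv a X x) * f.cone_form v' (pv b X x))" by blast
  interpret lc: light_cone h ?W alg.mul f.cone_form alg.unit X V Y
  proof (rule light_cone.intro[OF hW], rule light_cone_axioms.intro)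
    show "f.cone_form (alg.mul a b) c = f.cone_form a (alg.mul b c)" for a b c
      using alg.frob_assoc unfolding frob .
    show "f.cone_form (pv i X x) (pv j X x) = h x $ i $ j" if "x \<in> ?W" for x i j using r(7) W(1) that by blast
    show "f.cone_form (X x) (X x) = 0" if "x \<in> ?W" for x using r(6) W(1) that by blast
  qed (rule n3 alg.mul_bilinear alg.mul_comm alg.mul_assoc alg.mul_unit f.cone_form_bilinear X Vs V Y; assumption?)+
  obtain r'' t where t: "r'' > 0" "ball p r'' \<subseteq> ?W" "smoothv (ball p r'') t" "t p = t0"
    "\<And>x. x \<in> ball p r'' \<Longrightarrow> solves_system_at h t lc.S x" "\<And>x k. x \<in> ball p r'' \<Longrightarrow> grad t x [k] = - 3 * lc.w * lc.\<theta> k x"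
    using lc.solution_exists[OF W(3), of t0] by blast
  have pt: "p \<in> ball p r''" using t(1) by simp
  have S: "smooth_symmetric_tracefree3_on h (ball p r'') lc.S"
    unfolding smooth_symmetric_tracefree3_on_def smooth_on_eq_smoothv
    using smoothv_subset[OF lc.S_smooth t(2)] lc.S_symmetric_tracefree t(2) by blast
  have Vp: "V p = alg.unit" using V[OF W(3)] by (simp add: one alg.mul_unit)
  have Tp: "lc.T p i j k = - (1/3) * (\<Psi> [i, j, k] + h p $ i $ j * v k + h p $ i $ k * v j + h p $ j $ k * v i)" for i j k
  proof -
    have br: "f.bform (f.raise \<phi>) (?e l) = \<phi> l" "f.bform (?e l) (f.raise \<phi>) = \<phi> l" for \<phi> l
      by (rule f.bform_raise_axis)+
    note bs = bilinear_ladd[OF f.bform_bilinear] bilinear_radd[OF f.bform_bilinear]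
      bilinear_lmul[OF f.bform_bilinear] bilinear_rmul[OF f.bform_bilinear] bilinear_lzero[OF f.bform_bilinear] bilinear_rzero[OF f.bform_bilinear]
    have st: "st (?e j) (?e k) = (- 1/3) *\<^sub>R f.raise (?T j k) + \<nu> j *\<^sub>R ?e k + \<nu> k *\<^sub>R ?e j + h p $ j $ k *\<^sub>R f.raise \<nu>"
      by (simp add: st_def br f.prod3_axis f.bform_axis(2))
    have sym: "\<Psi> [j, k, i] = \<Psi> [i, j, k]"
      using \<Psi>(1) unfolding totally_symmetric_def by (auto simp: add_mset_commute)
    have z: "hop' 0 = 0" "alg.\<omega> 0 = 0" by simp_all
    have "lc.T p i j k = f.cone_form (\<omega> i, ?e i, 0) (alg.mul (\<omega> j, ?e j, 0) (\<omega> k, ?e k, 0))"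
      unfolding lc.T_def Vp r(5) lc.B_inv[symmetric] alg.mul_unit ..
    also have "\<dots> = \<omega> i * h p $ j $ k + f.bform (?e i) (\<omega> j *\<^sub>R ?e k + \<omega> k *\<^sub>R ?e j + st (?e j) (?e k))"
      by (simp add: f.cone_form_def alg.mul_def f.bform_axis(2))
    also have "\<dots> = - (1/3) * \<Psi> [j, k, i] + (\<omega> i + \<nu> i) * h p $ j $ k + (\<omega> j + \<nu> j) * h p $ i $ k + (\<omega> k + \<nu> k) * h p $ i $ j"
      unfolding st bs br f.bform_axis(2) by (simp add: algebra_simps)
    also have "\<dots> = - (1/3) * (\<Psi> [i, j, k] + h p $ i $ j * v k + h p $ i $ k * v j + h p $ j $ k * v i)"
      unfolding sym by (simp add: \<nu>_def algebra_simps)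
    finally show ?thesis .
  qed
  have tr\<Psi>: "trace_form (h p) (\<lambda>a b. \<Psi> [a, b, k]) = 0" for k
    using \<Psi>(2) unfolding totally_tracefree_3 by blast
  have \<theta>p: "lc.\<theta> k p = - (1/3) * (real CARD('n) + 2) * v k" for k
    unfolding lc.\<theta>_def Tp
    by (simp only: trace_form_linear tr\<Psi> f.trace_form_\<gamma> f.trace_form_contract) (simp add: algebra_simps)
  have wn: "lc.w * (real CARD('n) + 2) = 1" by (simp add: lc.w_def)
  have "- 3 * lc.w * lc.\<theta> k p = (lc.w * (real CARD('n) + 2)) * v k" for k unfolding \<theta>p by simp
  then have gp: "- 3 * lc.w * lc.\<theta> k p = v k" for k unfolding wn by simp
  have Sp: "lc.S p [i, j, k] = \<Psi> [i, j, k]" for i j k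
  proof -
    have "lc.S p [i, j, k] = - 3 * lc.T p i j k - (h p $ i $ j * (- 3 * lc.w * lc.\<theta> k p)
        + h p $ i $ k * (- 3 * lc.w * lc.\<theta> j p) + h p $ j $ k * (- 3 * lc.w * lc.\<theta> i p))"
      by (simp add: lc.S_def tens3_def algebra_simps)
    then show ?thesis unfolding gp Tp by (simp add: algebra_simps)
  qed
  show ?thesis
    using t S Sp gp W(4) pt
    by (intro exI[of _ "ball p r''"] exI[of _ t] exI[of _ lc.S]) (auto simp: smooth_on_eq_smoothv)
qed

section \<open>First-order agreement and the Ricci identities\<close>

text \<open>Agreement to first order at a point is preserved by the operations of which the right-hand sides
  of the system consist.\<close>

definition jet_eq :: "real^'n::finite \<Rightarrow> (real^'n \<Rightarrow> real) \<Rightarrow> (real^'n \<Rightarrow> real) \<Rightarrow> bool" where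
  "jet_eq x f g \<longleftrightarrow> f differentiable (at x) \<and> g differentiable (at x) \<and> f x = g x \<and> (\<forall>k. pv k f x = pv k g x)"

lemma jet_eq_refl: "f differentiable (at x) \<Longrightarrow> jet_eq x f f"
  by (simp add: jet_eq_def)

lemma jet_eq_const: "jet_eq x (\<lambda>y. c) (\<lambda>y. c)"
  by (simp add: jet_eq_def)

lemma jet_eq_add: "jet_eq x f f' \<Longrightarrow> jet_eq x g g' \<Longrightarrow> jet_eq x (\<lambda>y. f y + g y) (\<lambda>y. f' y + g' y)"
  by (simp add: jet_eq_def pv_add)

lemma jet_eq_diff: "jet_eq x f f' \<Longrightarrow> jet_eq x g g' \<Longrightarrow> jet_eq x (\<lambda>y. f y - g y) (\<lambda>y. f' y - g' y)"
  by (simp add: jet_eq_def pv_diff)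

lemma jet_eq_mult: "jet_eq x f f' \<Longrightarrow> jet_eq x g g' \<Longrightarrow> jet_eq x (\<lambda>y. f y * g y) (\<lambda>y. f' y * g' y)"
  by (simp add: jet_eq_def pv_mult differentiable_mult)

lemma jet_eq_divide: "jet_eq x f f' \<Longrightarrow> jet_eq x (\<lambda>y. f y / c) (\<lambda>y. f' y / c)"
  using jet_eq_mult[OF _ jet_eq_const, of x f f' "inverse c"] by (simp add: divide_inverse)

lemma jet_eq_sum:
  fixes f f' :: "'i::finite \<Rightarrow> real^'n::finite \<Rightarrow> real"
  shows "(\<And>i. jet_eq x (f i) (f' i)) \<Longrightarrow> jet_eq x (\<lambda>y. \<Sum>i\<in>UNIV. f i y) (\<lambda>y. \<Sum>i\<in>UNIV. f' i y)"
  by (simp add: jet_eq_def pv_sum differentiable_sum_UNIV)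

lemma jet_eq_cong:
  assumes "open U" "x \<in> U" "\<And>y. y \<in> U \<Longrightarrow> f y = F y" "\<And>y. y \<in> U \<Longrightarrow> g y = G y" "jet_eq x F G"
  shows "jet_eq x f g"
  using assms differentiable_cong_open[of U x f F] differentiable_cong_open[of U x g G]
    pv_cong[of U x f F] pv_cong[of U x g G] unfolding jet_eq_def by metis

lemmas jet_eq_intros = jet_eq_const jet_eq_add jet_eq_diff jet_eq_mult jet_eq_divide jet_eq_sum

text \<open>The trace-free projections are written out, so that the right-hand sides become polynomials in the
  entries of the metric, its inverse, the curvature, \<open>S\<close> and \<open>dt\<close>.\<close>

definition sym6 :: "('n \<Rightarrow> 'n \<Rightarrow> 'n \<Rightarrow> real) \<Rightarrow> 'n \<Rightarrow> 'n \<Rightarrow> 'n \<Rightarrow> real" where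
  "sym6 X i j k = X i j k + X i k j + X j i k + X j k i + X k i j + X k j i"

definition rhs_c_term :: "real^'n::finite^'n \<Rightarrow> 'n tensor \<Rightarrow> 'n tensor \<Rightarrow> 'n \<Rightarrow> 'n \<Rightarrow> 'n \<Rightarrow> 'n \<Rightarrow> real" where
  "rhs_c_term \<gamma> S \<tau> l i j k = contr1 \<gamma> S i l j k + 3 * S [i, j, l] * \<tau> [k] + S [i, j, k] * \<tau> [l]
        + (4 / (real CARD('n) - 2) * contr2 \<gamma> S j k - 3 * contrSt \<gamma> S \<tau> j k) * \<gamma> $ i $ l"

definition rhs_a_term :: "real^'n::finite^'n \<Rightarrow> ('n \<Rightarrow> 'n \<Rightarrow> real) \<Rightarrow> 'n tensor \<Rightarrow> 'n tensor \<Rightarrow> 'n \<Rightarrow> 'n \<Rightarrow> real" where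
  "rhs_a_term \<gamma> Ric S \<tau> i j = 3 / (real CARD('n) - 2) * Ric i j + 1 / (3 * (real CARD('n) - 2)) * contr2 \<gamma> S i j
       + 1 / 3 * \<tau> [i] * \<tau> [j]"

context nondegenerate_form
begin

lemma rhs_c_explicit:
  assumes n3: "CARD('n) \<ge> 3"
  shows "rhs_c \<gamma> S \<tau> [l, i, j, k] = 1 / 18 * (sym6 (rhs_c_term \<gamma> S \<tau> l) i j k
     - (\<gamma> $ i $ j * trace_form \<gamma> (\<lambda>a b. sym6 (rhs_c_term \<gamma> S \<tau> l) a b k)
       + \<gamma> $ i $ k * trace_form \<gamma> (\<lambda>a b. sym6 (rhs_c_term \<gamma> S \<tau> l) a b j)
       + \<gamma> $ j $ k * trace_form \<gamma> (\<lambda>a b. sym6 (rhs_c_term \<gamma> S \<tau> l) a b i)) / (real CARD('n) + 2))"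
proof -
  have s: "sym6 X i j k = sym6 X j i k" "sym6 X i j k = sym6 X i k j" for X :: "'n \<Rightarrow> 'n \<Rightarrow> 'n \<Rightarrow> real" and i j k
    by (simp_all add: sym6_def)
  have "rhs_c \<gamma> S \<tau> [l, i, j, k] = 1 / 18 * tf_part \<gamma> 3 (tens3 (sym6 (rhs_c_term \<gamma> S \<tau> l))) [i, j, k]"
    by (simp add: rhs_c_def Let_def tens4_def Pi_op_def rhs_c_term_def[abs_def] sym6_def[abs_def])
  also have "tf_part \<gamma> 3 (tens3 (sym6 (rhs_c_term \<gamma> S \<tau> l))) [i, j, k] = sym6 (rhs_c_term \<gamma> S \<tau> l) i j k
     - (\<gamma> $ i $ j * trace_form \<gamma> (\<lambda>a b. sym6 (rhs_c_term \<gamma> S \<tau> l) a b k)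
       + \<gamma> $ i $ k * trace_form \<gamma> (\<lambda>a b. sym6 (rhs_c_term \<gamma> S \<tau> l) a b j)
       + \<gamma> $ j $ k * trace_form \<gamma> (\<lambda>a b. sym6 (rhs_c_term \<gamma> S \<tau> l) a b i)) / (real CARD('n) + 2)"
    by (rule tf_part_3[OF n3 s])
  finally show ?thesis .
qed

lemma rhs_a_explicit:
  "rhs_a \<gamma> Ric S \<tau> D [i, j] = rhs_a_term \<gamma> Ric S \<tau> i j
    - \<gamma> $ i $ j * (trace_form \<gamma> (rhs_a_term \<gamma> Ric S \<tau>) / real CARD('n)) + 1 / real CARD('n) * \<gamma> $ i $ j * D"
proof -
  have "rhs_a \<gamma> Ric S \<tau> D [i, j] = tf_part \<gamma> 2 (tens2 (rhs_a_term \<gamma> Ric S \<tau>)) [i, j] + 1 / real CARD('n) * \<gamma> $ i $ j * D"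
    by (simp add: rhs_a_def Let_def tens2_def[of _ "[i, j]"] rhs_a_term_def[abs_def])
  then show ?thesis by (simp only: tf_part_2)
qed

end

context chart_metric
begin

lemma jet_eq_metric: "x \<in> U \<Longrightarrow> jet_eq x (\<lambda>y. h y $ i $ j) (\<lambda>y. h y $ i $ j)"
  "x \<in> U \<Longrightarrow> jet_eq x (\<lambda>y. ginv (h y) i j) (\<lambda>y. ginv (h y) i j)"
  "x \<in> U \<Longrightarrow> jet_eq x (\<lambda>y. ricci h y i j) (\<lambda>y. ricci h y i j)"
  "x \<in> U \<Longrightarrow> jet_eq x (\<lambda>y. scalar_curv h y) (\<lambda>y. scalar_curv h y)"
  by (intro jet_eq_refl smoothv_differentiable[OF h_smooth] smoothv_differentiable[OF ginv_smooth] smoothv_differentiable[OF ricci_smooth]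
      smoothv_differentiable[OF scalar_curv_smooth]; assumption)+

context
  fixes S S' :: "real^'n \<Rightarrow> 'n tensor" and t t' :: "real^'n \<Rightarrow> real" and x :: "real^'n"
  assumes n3: "CARD('n) \<ge> 3" and x: "x \<in> U"
    and S: "\<And>i j k. jet_eq x (\<lambda>y. S y [i, j, k]) (\<lambda>y. S' y [i, j, k])"
    and t: "\<And>k. jet_eq x (\<lambda>y. grad t y [k]) (\<lambda>y. grad t' y [k])"
begin

lemma jet_eq_contr:
  "jet_eq x (\<lambda>y. contr1 (h y) (S y) i j k l) (\<lambda>y. contr1 (h y) (S' y) i j k l)"
  "jet_eq x (\<lambda>y. contr2 (h y) (S y) i j) (\<lambda>y. contr2 (h y) (S' y) i j)"
  "jet_eq x (\<lambda>y. contrSt (h y) (S y) (grad t y) i j) (\<lambda>y. contrSt (h y) (S' y) (grad t' y) i j)"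
  unfolding contr1_def contr2_def contrSt_def
  by (intro jet_eq_intros S t jet_eq_metric[OF x])+

lemma jet_eq_DS: "jet_eq x (\<lambda>y. DS_expr h t S y [l, i, j, k]) (\<lambda>y. DS_expr h t' S' y [l, i, j, k])"
proof (rule jet_eq_cong[OF U x])
  note e = nondegenerate_form.rhs_c_explicit[OF h_form n3]
  let ?X = "\<lambda>S \<tau> y. sym6 (rhs_c_term (h y) (S y) (\<tau> y) l)"
  let ?F = "\<lambda>S \<tau> y. 1 / 18 * (?X S \<tau> y i j k - (h y $ i $ j * trace_form (h y) (\<lambda>a b. ?X S \<tau> y a b k)
       + h y $ i $ k * trace_form (h y) (\<lambda>a b. ?X S \<tau> y a b j)
       + h y $ j $ k * trace_form (h y) (\<lambda>a b. ?X S \<tau> y a b i)) / (real CARD('n) + 2))"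
  show "DS_expr h t S y [l, i, j, k] = ?F S (grad t) y" if "y \<in> U" for y unfolding DS_expr_def by (rule e[OF that])
  show "DS_expr h t' S' y [l, i, j, k] = ?F S' (grad t') y" if "y \<in> U" for y unfolding DS_expr_def by (rule e[OF that])
  show "jet_eq x (?F S (grad t)) (?F S' (grad t'))"
    unfolding sym6_def rhs_c_term_def trace_form_def
    by (intro jet_eq_intros S t jet_eq_metric[OF x] jet_eq_contr)
qed

lemma jet_eq_Dt: "jet_eq x (\<lambda>y. Dt_expr h t S y [i, j]) (\<lambda>y. Dt_expr h t' S' y [i, j])"
proof (rule jet_eq_cong[OF U x])
  note e = nondegenerate_form.rhs_a_explicit[OF h_form]
  let ?F = "\<lambda>S \<tau> y. rhs_a_term (h y) (ricci h y) (S y) (\<tau> y) i j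
    - h y $ i $ j * (trace_form (h y) (rhs_a_term (h y) (ricci h y) (S y) (\<tau> y)) / real CARD('n))
    + 1 / real CARD('n) * h y $ i $ j * rhs_b (h y) (scalar_curv h y) (S y) (\<tau> y)"
  show "Dt_expr h t S y [i, j] = ?F S (grad t) y" if "y \<in> U" for y unfolding Dt_expr_def by (rule e[OF that])
  show "Dt_expr h t' S' y [i, j] = ?F S' (grad t') y" if "y \<in> U" for y unfolding Dt_expr_def by (rule e[OF that])
  show "jet_eq x (?F S (grad t)) (?F S' (grad t'))"
    unfolding rhs_a_term_def trace_form_def rhs_b_def Let_def norm2S_def norm2t_def
    by (intro jet_eq_intros S t jet_eq_metric[OF x] jet_eq_contr)
qed

end

text \<open>The inner derivatives of a true solution are those prescribed by the system, so that it
  satisfies the Ricci identities because partial derivatives commute.\<close>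

lemma solution_ricci_identities:
  assumes x: "x \<in> U" and W: "open W" "x \<in> W" "W \<subseteq> U" and t: "smoothv W t" and S: "\<And>i j k. smoothv W (\<lambda>y. S y [i, j, k])"
    and sol: "\<And>y. y \<in> W \<Longrightarrow> solves_system_at h t S y"
  shows "ricci_identities_at h t S x"
proof -
  have DS: "DS_expr h t S y [l, i, j, k] = covD h S y [l, i, j, k]" if "y \<in> W" for y l i j k
    using sol[OF that] by (simp add: solves_system_at_def DS_expr_def)
  have Dt: "Dt_expr h t S y [i, j] = covD h (grad t) y [i, j]" if "y \<in> W" for y i j
    using sol[OF that] by (simp add: solves_system_at_def Dt_expr_def)
  have 1: "covD h (DS_expr h t S) x [m, l, i, j, k] = covD h (covD h S) x [m, l, i, j, k]" for m l i j k
    using pv_cong[OF W(1,2) DS] by (simp add: covD_4 DS[OF W(2)])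
  have 2: "covD h (Dt_expr h t S) x [k, j, i] = covD h (covD h (grad t)) x [k, j, i]" for k j i
    using pv_cong[OF W(1,2) Dt] by (simp add: covD_2 Dt[OF W(2)])
  have g: "smoothv W (\<lambda>y. grad t y [i])" for i
    using smoothv_pv[OF t, of i] by (simp add: grad_def pd_eq_pv)
  show ?thesis
    unfolding ricci_identities_at_def 1 2
    using ricci_identity_rank3[where T = S, OF x W S] ricci_identity_covector[where T = "grad t", OF x W g] by blast
qed

text \<open>The system prescribes the covariant derivatives by the values.\<close>

lemma solves_system_cong:
  assumes S: "\<And>i j k. S x [i, j, k] = S' x [i, j, k]" and t: "\<And>k. grad t x [k] = grad t' x [k]"
    and sol: "solves_system_at h t S x" and sol': "solves_system_at h t' S' x"
  shows "covD h S x [l, i, j, k] = covD h S' x [l, i, j, k]" "covD h (grad t) x [i, j] = covD h (grad t') x [i, j]"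
proof -
  have c: "contr1 (h x) (S x) = contr1 (h x) (S' x)" "contr2 (h x) (S x) = contr2 (h x) (S' x)"
     "contrSt (h x) (S x) (grad t x) = contrSt (h x) (S' x) (grad t' x)"
    by (intro ext; simp add: contr1_def contr2_def contrSt_def S t)+
  have c': "norm2t (h x) (grad t x) = norm2t (h x) (grad t' x)" by (simp add: norm2t_def t)
  have "norm2S (h x) (S x) = norm2S (h x) (S' x)" by (simp add: norm2S_def c)
  then have b: "rhs_b (h x) R (S x) (grad t x) = rhs_b (h x) R (S' x) (grad t' x)" for R
    by (simp add: rhs_b_def c')
  have a: "rhs_a (h x) Ric (S x) (grad t x) D = rhs_a (h x) Ric (S' x) (grad t' x) D" for Ric D
    by (simp add: rhs_a_def t c)
  have cc: "rhs_c (h x) (S x) (grad t x) = rhs_c (h x) (S' x) (grad t' x)"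
    by (simp add: rhs_c_def S t c)
  show "covD h S x [l, i, j, k] = covD h S' x [l, i, j, k]" "covD h (grad t) x [i, j] = covD h (grad t') x [i, j]"
    using sol sol' unfolding solves_system_at_def by (simp_all add: a b cc)
qed

text \<open>Equal values give equal first derivatives by the system.  Hence the prescribed derivatives agree to
  first order, and their covariant derivatives agree.\<close>

lemma ricci_identities_transfer:
  assumes n3: "CARD('n) \<ge> 3" and x: "x \<in> U"
    and S: "\<And>i j k. S x [i, j, k] = S' x [i, j, k]" and t: "\<And>k. grad t x [k] = grad t' x [k]"
    and sol: "solves_system_at h t S x" and sol': "solves_system_at h t' S' x"
    and d: "\<And>i j k. (\<lambda>y. S y [i, j, k]) differentiable (at x)" "\<And>i j k. (\<lambda>y. S' y [i, j, k]) differentiable (at x)"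
      "\<And>k. (\<lambda>y. grad t y [k]) differentiable (at x)" "\<And>k. (\<lambda>y. grad t' y [k]) differentiable (at x)"
    and R: "ricci_identities_at h t' S' x"
  shows "ricci_identities_at h t S x"
proof -
  note eq = solves_system_cong[where S = S and S' = S' and t = t and t' = t', OF S t sol sol']
  have jS: "jet_eq x (\<lambda>y. S y [i, j, k]) (\<lambda>y. S' y [i, j, k])" for i j k
    using eq(1)[of _ i j k] unfolding jet_eq_def by (simp add: covD_3 S d)
  have jt: "jet_eq x (\<lambda>y. grad t y [k]) (\<lambda>y. grad t' y [k])" for k
    using eq(2)[of _ k] unfolding jet_eq_def by (simp add: covD_1 t d)
  note DS = jet_eq_DS[where S = S and S' = S' and t = t and t' = t', OF n3 x jS jt, unfolded jet_eq_def] and Dt = jet_eq_Dt[where S = S and S' = S' and t = t and t' = t', OF n3 x jS jt, unfolded jet_eq_def]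
  have 1: "covD h (DS_expr h t S) x [m, l, i, j, k] = covD h (DS_expr h t' S') x [m, l, i, j, k]" for m l i j k
    using DS by (simp add: covD_4)
  have 2: "covD h (Dt_expr h t S) x [k, j, i] = covD h (Dt_expr h t' S') x [k, j, i]" for k j i
    using Dt by (simp add: covD_2)
  show ?thesis using R unfolding ricci_identities_at_def 1 2 S t .
qed

end

lemma chart_metric_of_atlas:
  assumes "analytic_atlas A" "pseudo_riemannian_metric A g" "c \<in> A"
  shows "chart_metric (g c) (chart_image c)"
proof (rule chart_metric.intro)
  show "open (chart_image c)" using assms(1,3) by (auto simp: analytic_atlas_def is_chart_def)
  show "smoothv (chart_image c) (\<lambda>x. g c x $ i $ j)" for i j
    using assms(2,3) by (auto simp: pseudo_riemannian_metric_def real_analytic_on_def smooth_on_eq_smoothv)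
  show "nondegenerate_form (g c x)" if "x \<in> chart_image c" for x
    using assms(2,3) that by (intro nondegenerate_form.intro) (auto simp: pseudo_riemannian_metric_def)
qed

theorem theorem6p1:
  fixes A :: "('m::{t2_space, second_countable_topology}, 'n::finite) chart set"
    and g :: "('m, 'n) chart \<Rightarrow> real^'n \<Rightarrow> real^'n^'n"
  assumes dim: "CARD('n) \<ge> 3"
    and manifold: "analytic_atlas A"
    and metric: "pseudo_riemannian_metric A g"
    and conf_flat: "conformally_flat A g"
  shows
    "(weyl_vanishes A g \<longrightarrow>
       (\<forall>c\<in>A. \<forall>x\<in>chart_image c. \<forall>W t S.
          open W \<and> x \<in> W \<and> W \<subseteq> chart_image c \<and>
          smooth_on W t \<and> smooth_symmetric_tracefree3_on (g c) W S \<and>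
          solves_system_at (g c) t S x \<and> star_condition (g c x) (S x)
          \<longrightarrow> ricci_identities_at (g c) t S x))
     \<and>
     (\<forall>c\<in>A. \<forall>x0\<in>chart_image c. \<forall>(\<Psi> :: 'n tensor) (t0 :: real) (v :: 'n \<Rightarrow> real).
        totally_symmetric 3 \<Psi> \<and> totally_tracefree (g c x0) 3 \<Psi> \<and> star_condition (g c x0) \<Psi>
        \<longrightarrow> (\<exists>W t S.
              open W \<and> x0 \<in> W \<and> W \<subseteq> chart_image c \<and>
              smooth_on W t \<and> smooth_symmetric_tracefree3_on (g c) W S \<and>
              (\<forall>x\<in>W. solves_system_at (g c) t S x) \<and>
              (\<forall>i j k. S x0 [i, j, k] = \<Psi> [i, j, k]) \<and>
              t x0 = t0 \<and> (\<forall>i. grad t x0 [i] = v i)))"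
proof -
  have solvable: "\<exists>W t S. open W \<and> x0 \<in> W \<and> W \<subseteq> chart_image c \<and>
              smooth_on W t \<and> smooth_symmetric_tracefree3_on (g c) W S \<and>
              (\<forall>x\<in>W. solves_system_at (g c) t S x) \<and>
              (\<forall>i j k. S x0 [i, j, k] = \<Psi> [i, j, k]) \<and>
              t x0 = t0 \<and> (\<forall>i. grad t x0 [i] = v i)"
    if c: "c \<in> A" and x0: "x0 \<in> chart_image c"
      and \<Psi>: "totally_symmetric 3 \<Psi>" "totally_tracefree (g c x0) 3 \<Psi>" "star_condition (g c x0) \<Psi>"
    for c x0 and \<Psi> :: "'n tensor" and t0 :: real and v :: "'n \<Rightarrow> real"
  proof -
    obtain U \<rho> where U: "open U" "x0 \<in> U" "U \<subseteq> chart_image c" "smoothv U \<rho>" "\<And>y. y \<in> U \<Longrightarrow> \<rho> y > 0"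
      "\<And>y m i j k. y \<in> U \<Longrightarrow> riemann (\<lambda>z. \<rho> z *\<^sub>R g c z) y m i j k = 0"
      using bspec[OF bspec[OF conf_flat[unfolded conformally_flat_def smooth_on_eq_smoothv] c] x0]
      by (elim exE conjE) auto
    have "chart_metric (g c) U"
      by (rule chart_metric_subset[OF chart_metric_of_atlas[OF manifold metric c] U(1,3)])
    note sys = system_solvable[OF dim this U(2,4) _ _ \<Psi>, of t0 v, OF U(5) U(6), simplified]
    obtain W t S where w: "open W" "x0 \<in> W" "W \<subseteq> U" "smooth_on W t"
      "smooth_symmetric_tracefree3_on (g c) W S" "\<forall>x\<in>W. solves_system_at (g c) t S x"
      "\<forall>i j k. S x0 [i, j, k] = \<Psi> [i, j, k]" "t x0 = t0" "\<forall>i. grad t x0 [i] = v i"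
      using sys by (elim exE conjE) (rule that; assumption)
    show ?thesis
      by (intro exI[of _ W] exI[of _ t] exI[of _ S] conjI w(1,2,4-9)) (rule subset_trans[OF w(3) U(3)])
  qed
  have transfer: "ricci_identities_at (g c) t S x"
    if c: "c \<in> A" and x: "x \<in> chart_image c"
      and W: "open W" "x \<in> W" "W \<subseteq> chart_image c" "smooth_on W t" "smooth_symmetric_tracefree3_on (g c) W S"
      and sol: "solves_system_at (g c) t S x" and star: "star_condition (g c x) (S x)" for c x W t S
  proof -
    interpret chart_metric "g c" "chart_image c" by (rule chart_metric_of_atlas[OF manifold metric c])
    have smooth: "smoothv W t" "\<And>i j k. smoothv W (\<lambda>y. S y [i, j, k])"
      and sym: "totally_symmetric 3 (S x)" "totally_tracefree (g c x) 3 (S x)"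
      using W(2,4,5) by (simp_all add: smooth_on_eq_smoothv smooth_symmetric_tracefree3_on_def)
    obtain W' t' S' where s: "open W'" "x \<in> W'" "W' \<subseteq> chart_image c" "smooth_on W' t'"
       "smooth_symmetric_tracefree3_on (g c) W' S'" "\<forall>y\<in>W'. solves_system_at (g c) t' S' y"
       "\<forall>i j k. S' x [i, j, k] = S x [i, j, k]" "t' x = t x" "\<forall>i. grad t' x [i] = grad t x [i]"
      using solvable[OF c x sym star, of "t x" "\<lambda>i. grad t x [i]"]
      by (elim exE conjE) (rule that; assumption)
    have smooth': "smoothv W' t'" "\<And>i j k. smoothv W' (\<lambda>y. S' y [i, j, k])"
      using s(4,5) by (simp_all add: smooth_on_eq_smoothv smooth_symmetric_tracefree3_on_def)
    have sol': "solves_system_at (g c) t' S' y" if "y \<in> W'" for y using s(6) that by simp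
    have R: "ricci_identities_at (g c) t' S' x"
      by (rule solution_ricci_identities[where S = S' and t = t', OF x s(1-3) smooth' sol'])
    have gd: "(\<lambda>y. grad t y [k]) differentiable (at x)" "(\<lambda>y. grad t' y [k]) differentiable (at x)" for k
      using smoothv_differentiable[OF smoothv_pv[OF smooth(1), of k] W(2)] smoothv_differentiable[OF smoothv_pv[OF smooth'(1), of k] s(2)]
      by (simp_all add: grad_def pd_eq_pv)
    have eq: "S x [i, j, k] = S' x [i, j, k]" "grad t x [i] = grad t' x [i]" for i j k
      using s(7,9) by simp_all
    show ?thesis
      by (rule ricci_identities_transfer[where S = S and S' = S' and t = t and t' = t',
            OF dim x eq sol sol'[OF s(2)] smoothv_differentiable[OF smooth(2) W(2)] smoothv_differentiable[OF smooth'(2) s(2)] gd R])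
  qed
  show ?thesis
  proof (intro conjI impI ballI allI; elim conjE)
    fix c x W t S
    assume "c \<in> A" "x \<in> chart_image c" "open W" "x \<in> W" "W \<subseteq> chart_image c" "smooth_on W t"
      "smooth_symmetric_tracefree3_on (g c) W S" "solves_system_at (g c) t S x" "star_condition (g c x) (S x)"
    then show "ricci_identities_at (g c) t S x" by (rule transfer)
  qed (rule solvable)
qed

end
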